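(* Let $\mathcal{N}$ be a Hadamard channel and let $\lambda\geq 1$. Suppose the admissible state $\rho$ attains the supremum defining $f_\lambda(\mathcal{N})$. Then the point $(I(X;B)_\rho,\ I(A\rangle BX)_\rho)$ lies on the CQ trade-off curve of $\mathcal{N}$; more precisely, it belongs to $\mathcal{C}_{\mathrm{CQ}}(\mathcal{N})$ and for every $(C,Q)\in\mathcal{C}_{\mathrm{CQ}}(\mathcal{N})$ one has $C+\lambda Q\leq I(X;B)_\rho+\lambda I(A\rangle BX)_\rho = f_\lambda(\mathcal{N})$.
   Context: Let $\mathcal{N}^{A'\to B}$ be a finite-dimensional quantum channel with isometric extension $U_{\mathcal{N}}^{A'\to BE}$ and complementary channel $\mathcal{N}^c(\sigma)=\mathrm{Tr}_B\{U_{\mathcal{N}}\sigma U_{\mathcal{N}}^\dagger\}$. A channel is entanglement-breaking if it has the form $\sigma\mapsto\sum_y\mathrm{Tr}\{\Lambda_y\sigma\}\omega_y$ for a POVM $\{\Lambda_y\}$ and states $\omega_y$. $\mathcal{N}$ is a Hadamard channel if its complementary channel is entanglement-breaking. An admissible state for $\mathcal{N}$ is $\rho^{XABE}=\sum_x p_X(x)|x\rangle\langle x|^X\otimes U_{\mathcal{N}}(\phi_x^{AA'})U_{\mathcal{N}}^\dagger$ with $X$ a finite alphabet, $p_X$ a probability distribution, $A$ a finite-dimensional reference, each $\phi_x^{AA'}$ pure. Entropies are base 2; $I(A\rangle BX)\equiv -H(A|BX)=H(BX)-H(ABX)$. Define $f_\lambda(\mathcal{N})\equiv\sup_\rho\,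 [I(X;B)_\rho+\lambda I(A\rangle BX)_\rho]$ over admissible states. The one-shot CQ region $\mathcal{C}^{(1)}_{\mathrm{CQ}}(\mathcal{N})$ is the union over admissible $\rho$ of $\{(C,Q): 0\le C\le I(X;B)_\rho,\ 0\le Q\le I(A\rangle BX)_\rho\}$, and the CQ capacity region is $\mathcal{C}_{\mathrm{CQ}}(\mathcal{N})=\overline{\bigcup_{k\ge1}\frac1k\mathcal{C}^{(1)}_{\mathrm{CQ}}(\mathcal{N}^{\otimes k})}$. The CQ trade-off curve is the set of Pareto-optimal points of $\mathcal{C}_{\mathrm{CQ}}(\mathcal{N})$ (points $(C,Q)$ in the region with no other point $(C',Q')$ of the region satisfying $C'\ge C$, $Q'\ge Q$). *)

theory Defs
  imports "HOL-Analysis.Analysis" "Jordan_Normal_Form.Char_Poly"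
begin

text \<open>Composite systems with local dimensions d1, d2 use the index i1 * d2 + i2
  (standard Kronecker ordering).\<close>

definition adj :: "complex mat \<Rightarrow> complex mat" where
  "adj M = mat (dim_col M) (dim_row M) (\<lambda>(i,j). cnj (M $$ (j,i)))"

definition mtrace :: "complex mat \<Rightarrow> complex" where
  "mtrace M = (\<Sum>i<dim_row M. M $$ (i,i))"

definition kron :: "complex mat \<Rightarrow> complex mat \<Rightarrow> complex mat" where
  "kron A B = mat (dim_row A * dim_row B) (dim_col A * dim_col B)
     (\<lambda>(i,j). A $$ (i div dim_row B, j div dim_col B) * B $$ (i mod dim_row B, j mod dim_col B))"

definition ptrace_mid :: "nat \<Rightarrow> nat \<Rightarrow> nat \<Rightarrow> complex mat \<Rightarrow> complex mat" where
  "ptrace_mid d1 d2 d3 M = mat (d1 * d3) (d1 * d3)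
     (\<lambda>(i,j). \<Sum>k<d2. M $$ ((i div d3) * (d2 * d3) + k * d3 + i mod d3,
                             (j div d3) * (d2 * d3) + k * d3 + j mod d3))"

abbreviation ptrace_right :: "nat \<Rightarrow> nat \<Rightarrow> complex mat \<Rightarrow> complex mat" where
  "ptrace_right d1 d2 M \<equiv> ptrace_mid d1 d2 1 M"

abbreviation ptrace_left :: "nat \<Rightarrow> nat \<Rightarrow> complex mat \<Rightarrow> complex mat" where
  "ptrace_left d1 d2 M \<equiv> ptrace_mid 1 d1 d2 M"

definition ket :: "nat \<Rightarrow> nat \<Rightarrow> complex vec" where
  "ket n x = vec n (\<lambda>i. if i = x then 1 else 0)"

definition proj :: "complex vec \<Rightarrow> complex mat" where
  "proj v = mat (dim_vec v) (dim_vec v) (\<lambda>(i,j). v $ i * cnj (v $ j))"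

definition vnorm2 :: "complex vec \<Rightarrow> real" where
  "vnorm2 v = (\<Sum>i<dim_vec v. (cmod (v $ i))\<^sup>2)"

definition psd :: "nat \<Rightarrow> complex mat \<Rightarrow> bool" where
  "psd n M \<longleftrightarrow> M \<in> carrier_mat n n \<and>
     (\<forall>v \<in> carrier_vec n. let z = conjugate v \<bullet> (M *\<^sub>v v) in Im z = 0 \<and> Re z \<ge> 0)"

definition density :: "nat \<Rightarrow> complex mat \<Rightarrow> bool" where
  "density n M \<longleftrightarrow> psd n M \<and> mtrace M = 1"

definition msum :: "nat \<Rightarrow> nat \<Rightarrow> ('b \<Rightarrow> complex mat) \<Rightarrow> 'b set \<Rightarrow> complex mat" where
  "msum r c f Y = mat r c (\<lambda>ij. \<Sum>y\<in>Y. f y $$ ij)"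

definition eta :: "real \<Rightarrow> real" where
  "eta t = (if t \<le> 0 then 0 else - t * log 2 t)"

definition vN :: "complex mat \<Rightarrow> real" where
  "vN M = sum_mset (image_mset (\<lambda>z. eta (Re z)) (proots (char_poly M)))"

text \<open>A channel A' \<rightarrow> B is given by an isometric extension U from A' (dim dA) to
  B \<otimes> E (dims dB, dE).\<close>
definition isometry :: "nat \<Rightarrow> nat \<Rightarrow> nat \<Rightarrow> complex mat \<Rightarrow> bool" where
  "isometry dA dB dE U \<longleftrightarrow> U \<in> carrier_mat (dB * dE) dA \<and> adj U * U = 1\<^sub>m dA"

definition complementary :: "nat \<Rightarrow> nat \<Rightarrow> complex mat \<Rightarrow> complex mat \<Rightarrow> complex mat" where
  "complementary dB dE U \<sigma> = ptrace_left dB dE (U * \<sigma> * adj U)"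

definition entanglement_breaking ::
  "nat \<Rightarrow> nat \<Rightarrow> (complex mat \<Rightarrow> complex mat) \<Rightarrow> bool" where
  "entanglement_breaking din dout \<Phi> \<longleftrightarrow>
     (\<exists>(Y::nat set) \<Lambda> \<omega>. finite Y \<and> (\<forall>y\<in>Y. psd din (\<Lambda> y) \<and> density dout (\<omega> y)) \<and>
        msum din din \<Lambda> Y = 1\<^sub>m din \<and>
        (\<forall>\<sigma> \<in> carrier_mat din din. \<Phi> \<sigma> = msum dout dout (\<lambda>y. mtrace (\<Lambda> y * \<sigma>) \<cdot>\<^sub>m \<omega> y) Y))"

definition hadamard :: "nat \<Rightarrow> nat \<Rightarrow> nat \<Rightarrow> complex mat \<Rightarrow> bool" where
  "hadamard dA dB dE U \<longleftrightarrow> entanglement_breaking dA dE (complementary dB dE U)"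

text \<open>Parameters (n, p, dR, phi): alphabet {0..<n}, distribution p, reference
  dimension dR, pure states phi x on A \<otimes> A' (A = reference).\<close>
type_synonym params = "nat \<times> (nat \<Rightarrow> real) \<times> nat \<times> (nat \<Rightarrow> complex vec)"

definition admissible :: "nat \<Rightarrow> params set" where
  "admissible dA = {(n, p, dR, \<phi>). 0 < n \<and> 0 < dR \<and> (\<forall>x<n. 0 \<le> p x) \<and> (\<Sum>x<n. p x) = 1 \<and>
      (\<forall>x<n. \<phi> x \<in> carrier_vec (dR * dA) \<and> vnorm2 (\<phi> x) = 1)}"

definition state_XABE :: "nat \<Rightarrow> nat \<Rightarrow> complex mat \<Rightarrow> params \<Rightarrow> complex mat" where
  "state_XABE dB dE U P = (case P of (n, p, dR, \<phi>) \<Rightarrow>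
     msum (n * (dR * (dB * dE))) (n * (dR * (dB * dE))) (\<lambda>x. complex_of_real (p x) \<cdot>\<^sub>m
        kron (proj (ket n x))
          (kron (1\<^sub>m dR) U * proj (\<phi> x) * adj (kron (1\<^sub>m dR) U))) {..<n})"

definition mutual_XB :: "nat \<Rightarrow> nat \<Rightarrow> complex mat \<Rightarrow> params \<Rightarrow> real" where
  "mutual_XB dB dE U P = (case P of (n, p, dR, \<phi>) \<Rightarrow>
     let rXAB = ptrace_right (n * dR * dB) dE (state_XABE dB dE U P);
         rXB = ptrace_mid n dR dB rXAB;
         rX = ptrace_right n dB rXB;
         rB = ptrace_left n dB rXB
     in vN rX + vN rB - vN rXB)"

definition coh_info :: "nat \<Rightarrow> nat \<Rightarrow> complex mat \<Rightarrow> params \<Rightarrow> real" where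
  "coh_info dB dE U P = (case P of (n, p, dR, \<phi>) \<Rightarrow>
     let rXAB = ptrace_right (n * dR * dB) dE (state_XABE dB dE U P);
         rXB = ptrace_mid n dR dB rXAB
     in vN rXB - vN rXAB)"

definition f_lambda :: "nat \<Rightarrow> nat \<Rightarrow> nat \<Rightarrow> complex mat \<Rightarrow> real \<Rightarrow> real" where
  "f_lambda dA dB dE U lam =
     (SUP P \<in> admissible dA. mutual_XB dB dE U P + lam * coh_info dB dE U P)"

definition one_shot_region :: "nat \<Rightarrow> nat \<Rightarrow> nat \<Rightarrow> complex mat \<Rightarrow> (real \<times> real) set" where
  "one_shot_region dA dB dE U = (\<Union>P \<in> admissible dA.
     {(C, Q). 0 \<le> C \<and> C \<le> mutual_XB dB dE U P \<and> 0 \<le> Q \<and> Q \<le> coh_info dB dE U P})"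

definition digit :: "nat \<Rightarrow> nat \<Rightarrow> nat \<Rightarrow> nat" where
  "digit d i m = (m div d ^ i) mod d"

text \<open>Isometric extension of N^{\<otimes>k}: U^{\<otimes>k} with output reordered as B^k \<otimes> E^k.\<close>
definition tensor_pow_iso :: "nat \<Rightarrow> nat \<Rightarrow> nat \<Rightarrow> complex mat \<Rightarrow> nat \<Rightarrow> complex mat" where
  "tensor_pow_iso dA dB dE U k = mat (dB ^ k * dE ^ k) (dA ^ k)
     (\<lambda>(r, c). \<Prod>i<k. U $$ (digit dB i (r div dE ^ k) * dE + digit dE i (r mod dE ^ k),
                               digit dA i c))"

definition CQ_region :: "nat \<Rightarrow> nat \<Rightarrow> nat \<Rightarrow> complex mat \<Rightarrow> (real \<times> real) set" where
  "CQ_region dA dB dE U = closure (\<Union>k \<in> {1..}.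
     (\<lambda>z. (1 / real k) *\<^sub>R z) ` one_shot_region (dA ^ k) (dB ^ k) (dE ^ k) (tensor_pow_iso dA dB dE U k))"

definition pareto_optimal :: "(real \<times> real) set \<Rightarrow> real \<times> real \<Rightarrow> bool" where
  "pareto_optimal S z \<longleftrightarrow> z \<in> S \<and>
     \<not> (\<exists>z' \<in> S. fst z \<le> fst z' \<and> snd z \<le> snd z' \<and> z' \<noteq> z)"

end

theory Submission
  imports Defs
begin

text \<open>For an admissible state the objective \<open>I(X;B) + \<lambda> I(A\<rangle>BX)\<close> depends only on the subnormalised inputs
  \<open>\<tau>\<^sub>x = p\<^sub>x Tr\<^sub>A \<phi>\<^sub>x\<close>, and equals \<open>H(B)\<close> plus a sum over \<open>x\<close> of \<open>(\<lambda> - 1) H(B) - \<lambda> H(E)\<close>, suitably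
  homogenised. If the first of two parallel channels is Hadamard, its environment \<open>E\<^sub>1\<close> is prepared from
  a classical outcome \<open>y\<close>, and concavity of the conditional entropy gives
  \<open>H(B\<^sub>1B\<^sub>2) - H(B\<^sub>1) \<le> H(B\<^sub>2|Y)\<close> (after passing to the purifying system) and
  \<open>H(E\<^sub>1E\<^sub>2) - H(E\<^sub>1) \<ge> H(E\<^sub>2|Y)\<close>. As \<open>\<lambda> \<ge> 1\<close>, the objective of the joint channel is at most the
  sum of the two objectives, the second one for the refined alphabet \<open>XY\<close>. Hence \<open>f\<^sub>\<lambda>(N\<^bsup>\<otimes>k\<^esup>) \<le> k f\<^sub>\<lambda>(N)\<close>,
  so the whole region lies in the half-plane \<open>C + \<lambda> Q \<le> f\<^sub>\<lambda>(N)\<close>.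

  Concavity of the conditional entropy is joint convexity of the relative entropy, which follows from
  \<open>r ln (r / s) - r + s = \<integral>\<^sub>0\<^sup>1 u (r - s)\<^sup>2 / ((1 - u) r + u s) du\<close>: for each \<open>u\<close> the quantum version of the
  integrand is a supremum of functionals that are linear in the pair of operators.

  Operators are functions of two indices from a finite set, so tensor products are indexed by pairs.\<close>

section \<open>Spectral decomposition over finite index sets\<close>

text \<open>The obstacle is that the refined ensemble over \<open>X \<times> Y\<close> consists of
  post-measurement states of different, possibly zero, weights. Everything is therefore stated for
  subnormalised operators, and normalisation enters only when an ensemble is turned into an
  admissible state. Because \<open>eta (s * t) = t * eta s + s * eta t\<close>, a letter term with
  coefficients \<open>lam - 1\<close>, \<open>- lam\<close> and \<open>1\<close> on H(B), H(E) and
  \<open>eta\<close> of the trace is homogeneous of degree one: the coefficients add up to 0. The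
  same cancellation absorbs the weights of the outcomes y. Only one of two parallel channels has to
  be Hadamard. The induction over tensor powers pairs the single channel with its power, so it is
  never shown that a power is Hadamard again; only the bound and the isometry property travel along.
  Each step enlarges the alphabet, so the bound has to cover all finite ensembles; hence every
  ensemble is realised by an admissible state. Membership of the optimal point in the region also
  requires nonnegative coordinates: concavity of the entropy gives this for I(X;B), degradability
  for the coherent information.\<close>

lemma sum_delta_simps:
  fixes f :: "'i \<Rightarrow> 'a::semiring_1"
  assumes "finite I" "j \<in> I"
  shows "(\<Sum>i\<in>I. f i * of_bool (i = j)) = f j" "(\<Sum>i\<in>I. f i * of_bool (j = i)) = f j"
    "(\<Sum>i\<in>I. of_bool (i = j) * f i) = f j" "(\<Sum>i\<in>I. of_bool (j = i) * f i) = f j"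
proof -
  have "(\<Sum>i\<in>I. f i * of_bool (i = j)) = (\<Sum>i\<in>I. if i = j then f i else 0)"
    by (rule sum.cong) auto
  then show 1: "(\<Sum>i\<in>I. f i * of_bool (i = j)) = f j" using assms by simp
  show "(\<Sum>i\<in>I. f i * of_bool (j = i)) = f j"
    using 1 by (simp add: eq_commute[of j])
  have "(\<Sum>i\<in>I. of_bool (i = j) * f i) = (\<Sum>i\<in>I. if i = j then f i else 0)"
    by (rule sum.cong) auto
  then show 2: "(\<Sum>i\<in>I. of_bool (i = j) * f i) = f j" using assms by simp
  show "(\<Sum>i\<in>I. of_bool (j = i) * f i) = f j"
    using 2 by (simp add: eq_commute[of j])
qed

lemma sum_swap3:
  "(\<Sum>k\<in>K. \<Sum>a\<in>A. \<Sum>b\<in>B. F k a b) = (\<Sum>a\<in>A. \<Sum>b\<in>B. \<Sum>k\<in>K. F k a b)"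
  by (subst sum.swap) (intro sum.cong refl sum.swap)

lemma sum_swap3':
  "(\<Sum>k\<in>K. \<Sum>a\<in>A. \<Sum>b\<in>B. F k a b) = (\<Sum>b\<in>B. \<Sum>a\<in>A. \<Sum>k\<in>K. F k a b)"
  by (subst sum_swap3) (rule sum.swap)

type_synonym 'i op = "'i \<Rightarrow> 'i \<Rightarrow> complex"

text \<open>The columns of \<open>V\<close> are the basis vectors. Both unitarity relations are
  demanded, so neither has to be derived from the other by a dimension count.\<close>

definition onb :: "'i set \<Rightarrow> 'i op \<Rightarrow> bool" where
  "onb I V \<longleftrightarrow> (\<forall>i\<in>I. \<forall>j\<in>I. (\<Sum>k\<in>I. V i k * cnj (V j k)) = of_bool (i = j)) \<and>
     (\<forall>k\<in>I. \<forall>l\<in>I. (\<Sum>i\<in>I. cnj (V i k) * V i l) = of_bool (k = l))"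

definition spec :: "'i set \<Rightarrow> 'i op \<Rightarrow> ('i \<Rightarrow> real) \<Rightarrow> 'i op \<Rightarrow> bool" where
  "spec I f e V \<longleftrightarrow> onb I V \<and>
     (\<forall>i\<in>I. \<forall>j\<in>I. f i j = (\<Sum>k\<in>I. of_real (e k) * V i k * cnj (V j k)))"

definition mmul :: "'k set \<Rightarrow> ('i \<Rightarrow> 'k \<Rightarrow> complex) \<Rightarrow> ('k \<Rightarrow> 'j \<Rightarrow> complex) \<Rightarrow> 'i \<Rightarrow> 'j \<Rightarrow> complex" where
  "mmul K A B i j = (\<Sum>k\<in>K. A i k * B k j)"

definition hermitian_on :: "'i set \<Rightarrow> 'i op \<Rightarrow> bool" where
  "hermitian_on I f \<longleftrightarrow> (\<forall>i\<in>I. \<forall>j\<in>I. f j i = cnj (f i j))"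

lemma onb_rows: "onb I V \<Longrightarrow> i \<in> I \<Longrightarrow> j \<in> I \<Longrightarrow> (\<Sum>k\<in>I. V i k * cnj (V j k)) = of_bool (i = j)"
  and onb_cols: "onb I V \<Longrightarrow> i \<in> I \<Longrightarrow> j \<in> I \<Longrightarrow> (\<Sum>k\<in>I. cnj (V k i) * V k j) = of_bool (i = j)"
  by (auto simp: onb_def)

lemma onb_rows': "onb I V \<Longrightarrow> i \<in> I \<Longrightarrow> j \<in> I \<Longrightarrow> (\<Sum>k\<in>I. cnj (V i k) * V j k) = of_bool (i = j)"
  and onb_cols': "onb I V \<Longrightarrow> i \<in> I \<Longrightarrow> j \<in> I \<Longrightarrow> (\<Sum>k\<in>I. V k i * cnj (V k j)) = of_bool (i = j)"
  using onb_rows[of I V j i] onb_cols[of I V j i] by (auto simp: mult.commute eq_commute)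

lemma spec_onb: "spec I f e V \<Longrightarrow> onb I V"
  and spec_eq: "spec I f e V \<Longrightarrow> i \<in> I \<Longrightarrow> j \<in> I \<Longrightarrow> f i j = (\<Sum>k\<in>I. of_real (e k) * V i k * cnj (V j k))"
  by (auto simp: spec_def)

lemma onb_mmul:
  assumes fin: "finite I" and V: "onb I V" and W: "onb I W"
  shows "onb I (mmul I V W)"
  unfolding onb_def
proof (intro conjI ballI)
  fix i j assume ij: "i \<in> I" "j \<in> I"
  have "(\<Sum>k\<in>I. mmul I V W i k * cnj (mmul I V W j k))
      = (\<Sum>k\<in>I. \<Sum>a\<in>I. \<Sum>b\<in>I. V i a * cnj (V j b) * (W a k * cnj (W b k)))"
    unfolding mmul_def cnj_sum sum_product complex_cnj_mult complex_cnj_cnj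
    by (intro sum.cong refl) (simp only: mult_ac)
  also have "\<dots> = (\<Sum>a\<in>I. \<Sum>b\<in>I. V i a * cnj (V j b) * (\<Sum>k\<in>I. W a k * cnj (W b k)))"
    unfolding sum_distrib_left by (rule sum_swap3)
  also have "\<dots> = (\<Sum>a\<in>I. \<Sum>b\<in>I. V i a * cnj (V j b) * of_bool (a = b))"
    using W by (intro sum.cong) (auto simp: onb_rows)
  also have "\<dots> = (\<Sum>a\<in>I. V i a * cnj (V j a))"
    using fin by (intro sum.cong) (auto simp: sum_delta_simps simp del: sum_mult_of_bool_eq)
  finally show "(\<Sum>k\<in>I. mmul I V W i k * cnj (mmul I V W j k)) = of_bool (i = j)"
    using V ij by (simp add: onb_rows)
next
  fix i j assume ij: "i \<in> I" "j \<in> I"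
  have "(\<Sum>k\<in>I. cnj (mmul I V W k i) * mmul I V W k j)
      = (\<Sum>k\<in>I. \<Sum>a\<in>I. \<Sum>b\<in>I. cnj (W a i) * W b j * (cnj (V k a) * V k b))"
    unfolding mmul_def cnj_sum sum_product complex_cnj_mult complex_cnj_cnj
    by (intro sum.cong refl) (simp only: mult_ac)
  also have "\<dots> = (\<Sum>a\<in>I. \<Sum>b\<in>I. cnj (W a i) * W b j * (\<Sum>k\<in>I. cnj (V k a) * V k b))"
    unfolding sum_distrib_left by (rule sum_swap3)
  also have "\<dots> = (\<Sum>a\<in>I. \<Sum>b\<in>I. cnj (W a i) * W b j * of_bool (a = b))"
    using V by (intro sum.cong) (auto simp: onb_cols)
  also have "\<dots> = (\<Sum>a\<in>I. cnj (W a i) * W a j)"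
    using fin by (intro sum.cong) (auto simp: sum_delta_simps simp del: sum_mult_of_bool_eq)
  finally show "(\<Sum>k\<in>I. cnj (mmul I V W k i) * mmul I V W k j) = of_bool (i = j)"
    using W ij by (simp add: onb_cols)
qed

lemma parseval:
  assumes fin: "finite I" and V: "onb I V"
  shows "(\<Sum>k\<in>I. cnj (\<Sum>i\<in>I. cnj (V i k) * x i) * (\<Sum>j\<in>I. cnj (V j k) * y j)) = (\<Sum>i\<in>I. cnj (x i) * y i)"
proof -
  have "(\<Sum>k\<in>I. cnj (\<Sum>i\<in>I. cnj (V i k) * x i) * (\<Sum>j\<in>I. cnj (V j k) * y j))
     = (\<Sum>k\<in>I. \<Sum>i\<in>I. \<Sum>j\<in>I. cnj (x i) * y j * (V i k * cnj (V j k)))"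
    unfolding cnj_sum sum_product complex_cnj_mult complex_cnj_cnj
    by (intro sum.cong refl) (simp only: mult_ac)
  also have "\<dots> = (\<Sum>i\<in>I. \<Sum>j\<in>I. \<Sum>k\<in>I. cnj (x i) * y j * (V i k * cnj (V j k)))"
    by (rule sum_swap3)
  also have "\<dots> = (\<Sum>i\<in>I. \<Sum>j\<in>I. cnj (x i) * y j * of_bool (i = j))"
    using V by (intro sum.cong refl) (auto simp: sum_distrib_left[symmetric] onb_rows)
  also have "\<dots> = (\<Sum>i\<in>I. cnj (x i) * y i)"
    using fin by (intro sum.cong refl) (auto simp: sum_delta_simps simp del: sum_mult_of_bool_eq)
  finally show ?thesis .
qed

lemma spec_conjugate:
  assumes fin: "finite I" and V: "onb I V" and g: "spec I g d W"
    and f: "\<And>i j. i \<in> I \<Longrightarrow> j \<in> I \<Longrightarrow> f i j = (\<Sum>a\<in>I. \<Sum>b\<in>I. V i a * g a b * cnj (V j b))"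
  shows "spec I f d (mmul I V W)"
  unfolding spec_def
proof (intro conjI ballI)
  show "onb I (mmul I V W)" using onb_mmul[OF fin V spec_onb[OF g]] .
  fix i j assume ij: "i \<in> I" "j \<in> I"
  have "f i j = (\<Sum>a\<in>I. \<Sum>b\<in>I. \<Sum>k\<in>I. V i a * (of_real (d k) * W a k * cnj (W b k)) * cnj (V j b))"
    unfolding f[OF ij] by (intro sum.cong refl) (simp add: spec_eq[OF g] sum_distrib_left sum_distrib_right)
  also have "\<dots> = (\<Sum>a\<in>I. \<Sum>k\<in>I. \<Sum>b\<in>I. V i a * (of_real (d k) * W a k * cnj (W b k)) * cnj (V j b))"
    by (intro sum.cong refl sum.swap)
  also have "\<dots> = (\<Sum>k\<in>I. \<Sum>a\<in>I. \<Sum>b\<in>I. V i a * (of_real (d k) * W a k * cnj (W b k)) * cnj (V j b))"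
    by (rule sum.swap)
  also have "\<dots> = (\<Sum>k\<in>I. of_real (d k) * mmul I V W i k * cnj (mmul I V W j k))"
    unfolding mmul_def cnj_sum mult.assoc[of "of_real _"] sum_product unfolding sum_distrib_left
    by (intro sum.cong refl) (simp add: mult_ac)
  finally show "f i j = (\<Sum>k\<in>I. of_real (d k) * mmul I V W i k * cnj (mmul I V W j k))" .
qed

text \<open>Householder reflection: with \<open>x a\<close> real, reflecting along \<open>x\<close> minus the \<open>a\<close>-th basis
  vector sends that basis vector to \<open>x\<close>.\<close>

lemma onb_extend_real:
  assumes fin: "finite I" and a: "a \<in> I" and n: "(\<Sum>i\<in>I. cnj (x i) * x i) = 1" and r: "x a \<in> \<real>"
  obtains V where "onb I V" "\<And>i. i \<in> I \<Longrightarrow> V i a = x i"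
proof -
  define u where "u i = x i - of_bool (i = a)" for i
  define c where "c = (\<Sum>i\<in>I. cnj (u i) * u i)"
  have xa: "cnj (x a) = x a" using r by (simp add: Reals_cnj_iff)
  have "c = (\<Sum>i\<in>I. cnj (x i) * x i - cnj (x i) * of_bool (i = a) - of_bool (i = a) * x i + of_bool (i = a) * of_bool (i = a))"
    unfolding c_def u_def by (intro sum.cong refl) (simp add: algebra_simps)
  also have "\<dots> = 2 - 2 * x a"
    using fin a n xa
    by (simp add: sum.distrib sum_subtractf sum_delta_simps del: sum_mult_of_bool_eq sum_of_bool_mult_eq)
  finally have c: "c = 2 - 2 * x a" .
  show thesis
  \<comment> \<open>\<open>c\<close> is the squared length of \<open>u\<close>; it vanishes exactly
    when \<open>x\<close> already is the basis vector, and then the identity serves.\<close>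
  proof (cases "c = 0")
    case True
    have "of_real (\<Sum>i\<in>I. (cmod (u i))\<^sup>2) = (0::complex)"
      using True unfolding c_def of_real_sum complex_norm_square by (simp only: mult.commute)
    then have "(\<Sum>i\<in>I. (cmod (u i))\<^sup>2) = 0" using of_real_eq_0_iff by blast
    then have "\<forall>i\<in>I. u i = 0" using fin by (simp add: sum_nonneg_eq_0_iff)
    then have "\<forall>i\<in>I. x i = of_bool (i = a)" by (simp add: u_def)
    moreover have "onb I (\<lambda>i j. of_bool (i = j))"
      using fin by (auto simp: onb_def sum_delta_simps simp del: sum_mult_of_bool_eq sum_of_bool_mult_eq)
    ultimately show thesis using that[of "\<lambda>i j. of_bool (i = j)"] by auto
  next
    case False
    define V where "V i j = of_bool (i = j) - (2 / c) * u i * cnj (u j)" for i j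
    have cr: "cnj c = c" by (simp add: c_def mult.commute)
    have Vh: "cnj (V i j) = V j i" for i j
      by (simp add: V_def cr eq_commute mult_ac)
    have VV: "(\<Sum>k\<in>I. V i k * V k j) = of_bool (i = j)" if "i \<in> I" "j \<in> I" for i j
    proof -
      define p where "p = (2 / c) * u i * cnj (u j)"
      have "(\<Sum>k\<in>I. V i k * V k j) = (\<Sum>k\<in>I. of_bool (i = k) * (of_bool (k = j) - (2 / c) * u k * cnj (u j))
          - ((2 / c) * u i * cnj (u k)) * of_bool (k = j) + (2 / c) * p * (cnj (u k) * u k))"
        unfolding V_def p_def by (intro sum.cong refl) (simp add: algebra_simps)
      also have "\<dots> = of_bool (i = j) - p - p + (2 / c) * p * c"
        unfolding sum.distrib sum_subtractf sum_distrib_left[symmetric] c_def[symmetric]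
        using fin that by (simp only: sum_delta_simps p_def)
      also have "\<dots> = of_bool (i = j)" using False by simp
      finally show ?thesis .
    qed
    have "onb I V" unfolding onb_def Vh using VV by auto
    moreover have "V i a = x i" for i
    proof -
      have "cnj (u a) = - c / 2" using c xa by (simp add: u_def)
      then have "V i a = of_bool (i = a) + u i" unfolding V_def using False by simp
      then show ?thesis by (simp add: u_def)
    qed
    ultimately show thesis using that by blast
  qed
qed

text \<open>A complex characteristic polynomial of positive degree has a root. The bijection
  \<open>h\<close> carries the index set to \<open>{..<n}\<close>, where characteristic polynomials
  are available.\<close>

lemma eigenvector_exists:
  fixes f :: "'i \<Rightarrow> 'i \<Rightarrow> complex"
  assumes fin: "finite I" and ne: "I \<noteq> {}"
  obtains c x where "\<exists>i\<in>I. x i \<noteq> 0" "\<And>i. i \<in> I \<Longrightarrow> (\<Sum>j\<in>I. f i j * x j) = c * x i"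
proof -
  define n where "n = card I"
  obtain h where h: "bij_betw h {..<n} I"
    using ex_bij_betw_nat_finite[OF fin] by (auto simp: n_def atLeast0LessThan)
  define A where "A = mat n n (\<lambda>(i,j). f (h i) (h j))"
  have A: "A \<in> carrier_mat n n" by (simp add: A_def)
  have "n > 0" using fin ne by (simp add: n_def card_gt_0_iff)
  then have "degree (char_poly A) \<noteq> 0" using degree_monic_char_poly[OF A] by simp
  then obtain c where "poly (char_poly A) c = 0"
    using fundamental_theorem_of_algebra[of "char_poly A"] by (auto simp: constant_degree)
  then have "eigenvalue A c" using eigenvalue_root_char_poly[OF A] by simp
  then obtain v where v: "v \<in> carrier_vec n" "v \<noteq> 0\<^sub>v n" "A *\<^sub>v v = c \<cdot>\<^sub>v v"
    using A by (auto simp: eigenvalue_def eigenvector_def)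
  define g where "g = inv_into {..<n} h"
  have gh: "g (h k) = k" if "k < n" for k
    using h that by (simp add: g_def bij_betw_inv_into_left)
  define x where "x i = v $ (g i)" for i
  obtain k where k: "k < n" "v $ k \<noteq> 0"
    using v(1,2) by (metis carrier_vecD eq_vecI index_zero_vec)
  have "h k \<in> I" using h k by (auto simp: bij_betw_def)
  then have "\<exists>i\<in>I. x i \<noteq> 0" using k gh[OF k(1)] unfolding x_def by (metis (no_types))
  moreover have "(\<Sum>j\<in>I. f i j * x j) = c * x i" if "i \<in> I" for i
  proof -
    have "i \<in> h ` {..<n}" using h that by (simp add: bij_betw_def)
    then obtain k where k: "k < n" "i = h k" by blast
    have "(\<Sum>j\<in>I. f i j * x j) = (\<Sum>l<n. f i (h l) * x (h l))"
      by (rule sum.reindex_bij_betw[OF h, symmetric])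
    also have "\<dots> = (A *\<^sub>v v) $ k"
      using k v(1) gh by (simp add: A_def scalar_prod_def x_def atLeast0LessThan)
    also have "\<dots> = c * x i" using k v gh by (simp add: x_def)
    finally show ?thesis .
  qed
  ultimately show thesis using that by blast
qed

text \<open>Deflation, by induction on the index set. A unit eigenvector becomes column
  \<open>a\<close> of a unitary \<open>V\<close>; in that basis the operator is block diagonal, with
  the eigenvalue at \<open>a\<close> and a Hermitian remainder on \<open>F\<close>.\<close>

theorem spectral_theorem:
  assumes "finite I" "hermitian_on I f"
  obtains e V where "spec I f e V"
  using assms
proof (induction I arbitrary: f thesis rule: finite_induct)
  case empty
  then show ?case by (auto simp: spec_def onb_def)
next
  case (insert a F)
  let ?I = "insert a F"
  have fin: "finite ?I" using insert by simp
  obtain c x0 where x0: "\<exists>i\<in>?I. x0 i \<noteq> 0" "\<And>i. i \<in> ?I \<Longrightarrow> (\<Sum>j\<in>?I. f i j * x0 j) = c * x0 i"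
    by (rule eigenvector_exists[OF fin, of f]) auto
  define s where "s = (\<Sum>i\<in>?I. (cmod (x0 i))\<^sup>2)"
  obtain i0 where i0: "i0 \<in> ?I" "x0 i0 \<noteq> 0" using x0(1) by blast
  have s: "s > 0" unfolding s_def by (rule sum_pos2[OF fin i0(1)]) (use i0(2) in auto)
  \<comment> \<open>Scales \<open>x0\<close> to a unit vector and turns its phase so that entry
    \<open>a\<close> is real, as the reflection in \<open>onb_extend_real\<close> requires.\<close>
  define z where "z = (if x0 a = 0 then 1 else cnj (x0 a) / cmod (x0 a)) / sqrt s"
  define x where "x i = z * x0 i" for i
  have zz: "cnj z * z = 1 / s"
  proof -
    have "cnj z * z = (cmod z)\<^sup>2" by (metis complex_norm_square mult.commute)
    moreover have "cmod z = 1 / sqrt s" using s by (simp add: z_def norm_divide)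
    ultimately show ?thesis using s by (simp add: power_divide)
  qed
  have xn: "(\<Sum>i\<in>?I. cnj (x i) * x i) = 1"
  proof -
    have *: "cnj (x i) * x i = of_real (1 / s) * of_real ((cmod (x0 i))\<^sup>2)" for i
    proof -
      have "cnj (x i) * x i = (cnj z * z) * (x0 i * cnj (x0 i))" by (simp add: x_def mult_ac)
      then show ?thesis by (simp only: zz complex_norm_square)
    qed
    have "(\<Sum>i\<in>?I. cnj (x i) * x i) = of_real (1 / s) * of_real s"
      unfolding * s_def of_real_sum by (simp only: sum_distrib_left)
    then show ?thesis using s by simp
  qed
  have xr: "x a \<in> \<real>"
  proof (cases "x0 a = 0")
    case False
    have "cnj (x0 a) * x0 a = of_real ((cmod (x0 a))\<^sup>2)"
      by (simp only: complex_norm_square mult.commute)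
    then have "x a = of_real ((cmod (x0 a))\<^sup>2 / cmod (x0 a) / sqrt s)"
      using False by (simp add: x_def z_def)
    then show ?thesis by (simp only: Reals_of_real)
  qed (simp add: x_def)
  have xe: "(\<Sum>j\<in>?I. f i j * x j) = c * x i" if "i \<in> ?I" for i
  proof -
    have "(\<Sum>j\<in>?I. f i j * x j) = z * (\<Sum>j\<in>?I. f i j * x0 j)"
      unfolding x_def sum_distrib_left by (intro sum.cong refl) (simp only: mult_ac)
    then show ?thesis using x0(2)[OF that] by (simp only: x_def mult_ac)
  qed
  obtain V where V: "onb ?I V" "\<And>i. i \<in> ?I \<Longrightarrow> V i a = x i"
    using onb_extend_real[OF fin _ xn xr] by blast
  define g where "g k l = (\<Sum>i\<in>?I. \<Sum>j\<in>?I. cnj (V i k) * f i j * V j l)" for k l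
  have gh: "g l k = cnj (g k l)" for k l
  proof -
    have fh: "cnj (f i j) = f j i" if "i \<in> ?I" "j \<in> ?I" for i j
      using insert.prems(2) that unfolding hermitian_on_def by metis
    have "cnj (g k l) = (\<Sum>i\<in>?I. \<Sum>j\<in>?I. cnj (V j l) * f j i * V i k)"
      unfolding g_def cnj_sum complex_cnj_mult complex_cnj_cnj
      by (intro sum.cong refl) (simp only: fh mult_ac)
    also have "\<dots> = g l k" unfolding g_def by (rule sum.swap)
    finally show ?thesis by simp
  qed
  \<comment> \<open>Column \<open>a\<close> of \<open>V\<close> is an eigenvector, so column
    \<open>a\<close> of \<open>g\<close> vanishes off the diagonal; by Hermiticity so does row
    \<open>a\<close>.\<close>
  have ga: "g k a = c * of_bool (k = a)" if "k \<in> ?I" for k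
  proof -
    have "g k a = (\<Sum>i\<in>?I. cnj (V i k) * (\<Sum>j\<in>?I. f i j * x j))"
      unfolding g_def sum_distrib_left by (intro sum.cong refl) (auto simp: V mult_ac)
    also have "\<dots> = (\<Sum>i\<in>?I. c * (cnj (V i k) * V i a))"
      by (intro sum.cong refl) (auto simp only: V xe mult.left_commute)
    also have "\<dots> = c * of_bool (k = a)" using onb_cols[OF V(1) that, of a] by (simp only: sum_distrib_left[symmetric] insertI1)
    finally show ?thesis .
  qed
  have cr: "cnj c = c" using gh[of a a] ga[of a] by simp
  have "hermitian_on F g" unfolding hermitian_on_def using gh by blast
  then obtain d W' where W': "spec F g d W'" by (rule insert.IH[rotated])
  \<comment> \<open>Direct sum of the eigenbasis for \<open>F\<close> with the one-dimensional block
    at \<open>a\<close>.\<close>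
  define W where "W j k = (if k = a then of_bool (j = a) else if j = a then 0 else W' j k)" for j k
  have neq: "j \<noteq> a" if "j \<in> F" for j using insert.hyps that by auto
  have WF: "W j k = W' j k" if "j \<in> F" "k \<in> F" for j k using that neq by (auto simp: W_def)
  have Wa: "W a k = of_bool (k = a)" "W k a = of_bool (k = a)" for k by (auto simp: W_def)
  have aF: "a \<notin> F" using insert.hyps by simp
  have W: "onb ?I W"
    unfolding onb_def using insert.hyps onb_rows[OF spec_onb[OF W']] onb_cols[OF spec_onb[OF W']]
    by (auto simp: WF Wa neq aF intro!: sum.neutral cong: sum.cong)
  define e where "e = d(a := Re c)"
  have "of_real (Re c) = c" using cr by (simp add: complex_eq_iff)
  have "spec ?I g e W"
    unfolding spec_def
  proof (intro conjI ballI W)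
    fix i j assume ij: "i \<in> ?I" "j \<in> ?I"
    have *: "(\<Sum>k\<in>?I. of_real (e k) * W i k * cnj (W j k)) = c * (W i a * cnj (W j a)) + (\<Sum>k\<in>F. of_real (d k) * W i k * cnj (W j k))"
      using insert.hyps neq \<open>of_real (Re c) = c\<close> by (simp add: e_def)
    consider "i = a" "j = a" | "i = a" "j \<in> F" | "j = a" "i \<in> F" | "i \<in> F" "j \<in> F" using ij by auto
    then show "g i j = (\<Sum>k\<in>?I. of_real (e k) * W i k * cnj (W j k))"
    proof cases
      case 1 then show ?thesis unfolding * using ga neq by (simp add: Wa)
    next
      case 2 then show ?thesis unfolding * using ga[of j] gh[of a j] neq by (simp add: Wa)
    next
      case 3 then show ?thesis unfolding * using ga[of i] neq by (simp add: Wa)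
    next
      case 4 then show ?thesis unfolding * using spec_eq[OF W' 4] neq by (simp add: Wa WF)
    qed
  qed
  moreover have "f i j = (\<Sum>k\<in>?I. \<Sum>l\<in>?I. V i k * g k l * cnj (V j l))" if "i \<in> ?I" "j \<in> ?I" for i j
  proof -
    have "(\<Sum>l\<in>?I. g k l * cnj (V j l)) = (\<Sum>m\<in>?I. cnj (V m k) * f m j)" if "k \<in> ?I" for k
    proof -
      have "(\<Sum>l\<in>?I. g k l * cnj (V j l)) = (\<Sum>l\<in>?I. \<Sum>m\<in>?I. \<Sum>n\<in>?I. cnj (V m k) * f m n * (V n l * cnj (V j l)))"
        unfolding g_def sum_distrib_right by (intro sum.cong refl) (simp only: mult_ac)
      also have "\<dots> = (\<Sum>m\<in>?I. \<Sum>l\<in>?I. \<Sum>n\<in>?I. cnj (V m k) * f m n * (V n l * cnj (V j l)))"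
        by (rule sum.swap)
      also have "\<dots> = (\<Sum>m\<in>?I. \<Sum>n\<in>?I. \<Sum>l\<in>?I. cnj (V m k) * f m n * (V n l * cnj (V j l)))"
        by (intro sum.cong refl sum.swap)
      also have "\<dots> = (\<Sum>m\<in>?I. \<Sum>n\<in>?I. cnj (V m k) * f m n * of_bool (n = j))"
        using onb_rows[OF V(1)] \<open>j \<in> ?I\<close> by (intro sum.cong refl) (simp only: sum_distrib_left[symmetric])
      also have "\<dots> = (\<Sum>m\<in>?I. cnj (V m k) * f m j)"
        using fin \<open>j \<in> ?I\<close> by (intro sum.cong refl) (simp only: sum_delta_simps)
      finally show ?thesis .
    qed
    then have "(\<Sum>k\<in>?I. \<Sum>l\<in>?I. V i k * g k l * cnj (V j l)) = (\<Sum>k\<in>?I. V i k * (\<Sum>m\<in>?I. cnj (V m k) * f m j))"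
      by (intro sum.cong refl) (simp only: sum_distrib_left[symmetric] mult.assoc)
    also have "\<dots> = (\<Sum>m\<in>?I. \<Sum>k\<in>?I. f m j * (V i k * cnj (V m k)))"
      unfolding sum_distrib_left by (subst sum.swap) (simp only: mult_ac)
    also have "\<dots> = (\<Sum>m\<in>?I. f m j * of_bool (i = m))"
      using onb_rows[OF V(1) \<open>i \<in> ?I\<close>] by (intro sum.cong refl) (simp only: sum_distrib_left[symmetric])
    also have "\<dots> = f i j" using fin that by (simp only: sum_delta_simps)
    finally show ?thesis by simp
  qed
  ultimately have "spec ?I f e (mmul ?I V W)" using spec_conjugate[OF fin V(1)] by blast
  then show ?case using insert.prems by blast
qed

section \<open>Entropy as a function of the spectrum\<close>

text \<open>Entropy in bits, without normalisation. For a Hermitian operator on a finite set the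
  description denotes one value: a diagonalisation exists, and all of them give the same sum by
  \<open>spec_sum_unique\<close>.\<close>

definition Ent :: "'i set \<Rightarrow> 'i op \<Rightarrow> real" where
  "Ent I f = (THE s. \<exists>e V. spec I f e V \<and> s = (\<Sum>k\<in>I. eta (e k)))"

text \<open>If \<open>M\<close> intertwines two operators, its matrix entries in their eigenbases vanish unless the
  eigenvalues agree. This yields both uniqueness of the spectrum and the equality of the nonzero
  spectra of \<open>M M\<^sup>*\<close> and \<open>M\<^sup>* M\<close>.\<close>

lemma spec_eigen_left:
  assumes fin: "finite I" and s: "spec I f e V" and "i \<in> I" "k \<in> I"
  shows "(\<Sum>i'\<in>I. cnj (V i' k) * f i' i) = of_real (e k) * cnj (V i k)"
proof -
  have "(\<Sum>i'\<in>I. cnj (V i' k) * f i' i) = (\<Sum>i'\<in>I. \<Sum>l\<in>I. of_real (e l) * cnj (V i l) * (cnj (V i' k) * V i' l))"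
    using assms(3)
    by (intro sum.cong refl) (simp only: spec_eq[OF s] sum_distrib_left mult_ac)
  also have "\<dots> = (\<Sum>l\<in>I. \<Sum>i'\<in>I. of_real (e l) * cnj (V i l) * (cnj (V i' k) * V i' l))"
    by (rule sum.swap)
  also have "\<dots> = (\<Sum>l\<in>I. of_real (e l) * cnj (V i l) * of_bool (k = l))"
    using onb_cols[OF spec_onb[OF s] assms(4)]
    by (intro sum.cong refl) (simp only: sum_distrib_left[symmetric])
  also have "\<dots> = of_real (e k) * cnj (V i k)" using fin assms(4) by (simp only: sum_delta_simps)
  finally show ?thesis .
qed

lemma spec_eigen_right:
  assumes fin: "finite I" and s: "spec I f e V" and "i \<in> I" "k \<in> I"
  shows "(\<Sum>j\<in>I. f i j * V j k) = of_real (e k) * V i k"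
proof -
  have "(\<Sum>j\<in>I. f i j * V j k) = (\<Sum>j\<in>I. \<Sum>l\<in>I. of_real (e l) * V i l * (cnj (V j l) * V j k))"
    using assms(3)
    by (intro sum.cong refl) (simp only: spec_eq[OF s] sum_distrib_right mult.assoc)
  also have "\<dots> = (\<Sum>l\<in>I. \<Sum>j\<in>I. of_real (e l) * V i l * (cnj (V j l) * V j k))"
    by (rule sum.swap)
  also have "\<dots> = (\<Sum>l\<in>I. of_real (e l) * V i l * of_bool (l = k))"
    using onb_cols[OF spec_onb[OF s] _ assms(4)]
    by (intro sum.cong refl) (simp only: sum_distrib_left[symmetric])
  also have "\<dots> = of_real (e k) * V i k" using fin assms(4) by (simp only: sum_delta_simps)
  finally show ?thesis .
qed

lemma intertwiner_eigenvalues: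
  assumes fin: "finite I" "finite J" and f: "spec I f e V" and g: "spec J g d W"
    and tw: "\<And>i j. i \<in> I \<Longrightarrow> j \<in> J \<Longrightarrow> (\<Sum>i'\<in>I. f i i' * M i' j) = (\<Sum>j'\<in>J. M i j' * g j' j)"
    and k: "k \<in> I" and l: "l \<in> J"
    and nz: "(\<Sum>i\<in>I. \<Sum>j\<in>J. cnj (V i k) * M i j * W j l) \<noteq> 0" (is "?c \<noteq> 0")
  shows "e k = d l"
proof -
  have "of_real (e k) * ?c = (\<Sum>i\<in>I. \<Sum>j\<in>J. (\<Sum>i'\<in>I. cnj (V i' k) * f i' i) * M i j * W j l)"
    unfolding sum_distrib_left using spec_eigen_left[OF fin(1) f _ k]
    by (intro sum.cong refl) (simp only: mult_ac)
  also have "\<dots> = (\<Sum>i\<in>I. \<Sum>j\<in>J. \<Sum>i'\<in>I. cnj (V i' k) * (f i' i * M i j) * W j l)"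
    unfolding sum_distrib_right by (simp only: mult_ac)
  also have "\<dots> = (\<Sum>i'\<in>I. \<Sum>i\<in>I. \<Sum>j\<in>J. cnj (V i' k) * (f i' i * M i j) * W j l)"
    by (rule sum_swap3[symmetric])
  also have "\<dots> = (\<Sum>i'\<in>I. \<Sum>j\<in>J. \<Sum>i\<in>I. cnj (V i' k) * (f i' i * M i j) * W j l)"
    by (intro sum.cong refl sum.swap)
  also have "\<dots> = (\<Sum>i'\<in>I. \<Sum>j\<in>J. cnj (V i' k) * (\<Sum>i\<in>I. f i' i * M i j) * W j l)"
    unfolding sum_distrib_right sum_distrib_left ..
  also have "\<dots> = (\<Sum>i'\<in>I. \<Sum>j\<in>J. cnj (V i' k) * (\<Sum>j'\<in>J. M i' j' * g j' j) * W j l)"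
    by (intro sum.cong refl) (simp only: tw)
  also have "\<dots> = (\<Sum>i'\<in>I. \<Sum>j\<in>J. \<Sum>j'\<in>J. cnj (V i' k) * M i' j' * (g j' j * W j l))"
    unfolding sum_distrib_right sum_distrib_left by (simp only: mult_ac)
  also have "\<dots> = (\<Sum>i'\<in>I. \<Sum>j'\<in>J. \<Sum>j\<in>J. cnj (V i' k) * M i' j' * (g j' j * W j l))"
    by (intro sum.cong refl sum.swap)
  also have "\<dots> = (\<Sum>i'\<in>I. \<Sum>j'\<in>J. cnj (V i' k) * M i' j' * (of_real (d l) * W j' l))"
    by (intro sum.cong refl) (simp only: sum_distrib_left[symmetric] spec_eigen_right[OF fin(2) g _ l])
  also have "\<dots> = of_real (d l) * ?c"
    unfolding sum_distrib_left by (intro sum.cong refl) (simp only: mult_ac)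
  finally show ?thesis using nz by simp
qed

lemma sum_cmod2_onb:
  assumes "finite I" "onb I V"
  shows "(\<Sum>k\<in>I. (cmod (\<Sum>i\<in>I. cnj (V i k) * x i))\<^sup>2) = (\<Sum>i\<in>I. (cmod (x i))\<^sup>2)"
proof -
  have "complex_of_real (\<Sum>k\<in>I. (cmod (\<Sum>i\<in>I. cnj (V i k) * x i))\<^sup>2) = of_real (\<Sum>i\<in>I. (cmod (x i))\<^sup>2)"
    unfolding of_real_sum complex_norm_square
    using parseval[OF assms, of x x] by (simp only: mult.commute)
  then show ?thesis by (simp only: of_real_eq_iff)
qed

lemma onb_cnj: "onb I V \<Longrightarrow> onb I (\<lambda>i k. cnj (V i k))"
  using onb_rows'[of I V] onb_cols'[of I V] unfolding onb_def[of I "\<lambda>i k. cnj (V i k)"] complex_cnj_cnj by blast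

text \<open>With \<open>c\<close> the overlaps of the two eigenbases, the weights
  \<open>(cmod (c k l))\<^sup>2\<close> are doubly stochastic and vanish unless
  \<open>e k = d l\<close>. Inserting them moves \<open>h\<close> from one spectrum to the
  other.\<close>

lemma spec_sum_unique:
  fixes h :: "real \<Rightarrow> real"
  assumes fin: "finite I" and f: "spec I f e V" and g: "spec I f d W"
  shows "(\<Sum>k\<in>I. h (e k)) = (\<Sum>k\<in>I. h (d k))"
proof -
  define c where "c k l = (\<Sum>i\<in>I. cnj (V i k) * W i l)" for k l
  \<comment> \<open>The identity intertwines \<open>f\<close> with itself.\<close>
  have tw: "(\<Sum>i'\<in>I. f i i' * of_bool (i' = j)) = (\<Sum>j'\<in>I. of_bool (i = j') * f j' j)" if "i \<in> I" "j \<in> I" for i j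
    using fin that by (simp only: sum_delta_simps)
  have "(\<Sum>i\<in>I. \<Sum>j\<in>I. cnj (V i k) * of_bool (i = j) * W j l) = c k l" for k l
    unfolding c_def using fin
    by (intro sum.cong refl) (simp only: mult.assoc sum_distrib_left[symmetric] sum_delta_simps)
  then have ed: "e k = d l" if "c k l \<noteq> 0" "k \<in> I" "l \<in> I" for k l
    using intertwiner_eigenvalues[OF fin fin f g tw that(2,3)] that(1) by simp
  have 1: "(\<Sum>k\<in>I. (cmod (c k l))\<^sup>2) = 1" if "l \<in> I" for l
  proof -
    have "complex_of_real (\<Sum>i\<in>I. (cmod (W i l))\<^sup>2) = 1"
      unfolding of_real_sum complex_norm_square using onb_cols'[OF spec_onb[OF g] that that] by simp
    then have "(\<Sum>i\<in>I. (cmod (W i l))\<^sup>2) = 1" by (simp only: of_real_eq_1_iff)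
    then show ?thesis unfolding c_def using sum_cmod2_onb[OF fin spec_onb[OF f], of "\<lambda>i. W i l"] by simp
  qed
  have 2: "(\<Sum>l\<in>I. (cmod (c k l))\<^sup>2) = 1" if "k \<in> I" for k
  proof -
    have "complex_of_real (\<Sum>i\<in>I. (cmod (cnj (V i k)))\<^sup>2) = 1"
      unfolding of_real_sum complex_norm_square using onb_cols[OF spec_onb[OF f] that that] by simp
    then have "(\<Sum>i\<in>I. (cmod (cnj (V i k)))\<^sup>2) = 1" by (simp only: of_real_eq_1_iff)
    then show ?thesis unfolding c_def
      using sum_cmod2_onb[OF fin onb_cnj[OF spec_onb[OF g]], of "\<lambda>i. cnj (V i k)"] by (simp add: mult.commute)
  qed
  have "(\<Sum>k\<in>I. h (e k)) = (\<Sum>k\<in>I. \<Sum>l\<in>I. (cmod (c k l))\<^sup>2 * h (e k))"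
    by (intro sum.cong refl) (simp add: sum_distrib_right[symmetric] 2)
  also have "\<dots> = (\<Sum>k\<in>I. \<Sum>l\<in>I. (cmod (c k l))\<^sup>2 * h (d l))"
    using ed by (intro sum.cong refl) fastforce
  also have "\<dots> = (\<Sum>l\<in>I. \<Sum>k\<in>I. (cmod (c k l))\<^sup>2 * h (d l))" by (rule sum.swap)
  also have "\<dots> = (\<Sum>l\<in>I. h (d l))"
    by (intro sum.cong refl) (simp add: sum_distrib_right[symmetric] 1)
  finally show ?thesis .
qed

lemma Ent_eq:
  assumes "finite I" "spec I f e V"
  shows "Ent I f = (\<Sum>k\<in>I. eta (e k))"
  unfolding Ent_def using assms spec_sum_unique[OF assms(1)] by (intro the_equality) blast+

lemma spec_cong:
  assumes "\<And>i j. i \<in> I \<Longrightarrow> j \<in> I \<Longrightarrow> f i j = g i j" "spec I f e V"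
  shows "spec I g e V"
  using assms unfolding spec_def by simp

lemma Ent_cong:
  assumes "\<And>i j. i \<in> I \<Longrightarrow> j \<in> I \<Longrightarrow> f i j = g i j"
  shows "Ent I f = Ent I g"
proof -
  have "spec I f e V \<longleftrightarrow> spec I g e V" for e V
    using spec_cong[of I f g] spec_cong[of I g f] assms by auto
  then show ?thesis unfolding Ent_def by simp
qed

section \<open>Positive operators and their purifications\<close>

definition psd_on :: "'i set \<Rightarrow> 'i op \<Rightarrow> bool" where
  "psd_on I f \<longleftrightarrow> hermitian_on I f \<and> (\<forall>x. 0 \<le> Re (\<Sum>i\<in>I. \<Sum>j\<in>I. cnj (x i) * f i j * x j))"

lemma spec_form:
  assumes fin: "finite I" and s: "spec I f e V"
  shows "(\<Sum>i\<in>I. \<Sum>j\<in>I. cnj (x i) * f i j * x j)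
    = of_real (\<Sum>k\<in>I. e k * (cmod (\<Sum>i\<in>I. cnj (V i k) * x i))\<^sup>2)"
proof -
  have "(\<Sum>i\<in>I. \<Sum>j\<in>I. cnj (x i) * f i j * x j)
     = (\<Sum>i\<in>I. \<Sum>j\<in>I. \<Sum>k\<in>I. of_real (e k) * ((cnj (V j k) * x j) * (V i k * cnj (x i))))"
    by (intro sum.cong refl) (simp only: spec_eq[OF s] sum_distrib_left sum_distrib_right mult_ac)
  also have "\<dots> = (\<Sum>k\<in>I. \<Sum>i\<in>I. \<Sum>j\<in>I. of_real (e k) * ((cnj (V j k) * x j) * (V i k * cnj (x i))))"
    by (rule sum_swap3[symmetric])
  also have "\<dots> = (\<Sum>k\<in>I. \<Sum>j\<in>I. \<Sum>i\<in>I. of_real (e k) * ((cnj (V j k) * x j) * (V i k * cnj (x i))))"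
    by (intro sum.cong refl sum.swap)
  also have "\<dots> = of_real (\<Sum>k\<in>I. e k * (cmod (\<Sum>i\<in>I. cnj (V i k) * x i))\<^sup>2)"
    unfolding of_real_sum of_real_mult complex_norm_square cnj_sum complex_cnj_mult complex_cnj_cnj sum_product
    unfolding sum_distrib_left ..
  finally show ?thesis .
qed

lemma spec_eigenvalue:
  assumes fin: "finite I" and s: "spec I f e V" and k: "k \<in> I"
  shows "(\<Sum>i\<in>I. \<Sum>j\<in>I. cnj (V i k) * f i j * V j k) = of_real (e k)"
proof -
  have "(\<Sum>l\<in>I. e l * (cmod (\<Sum>i\<in>I. cnj (V i l) * V i k))\<^sup>2) = (\<Sum>l\<in>I. e l * of_bool (l = k))"
    using onb_cols[OF spec_onb[OF s] _ k] by (intro sum.cong refl) (simp add: of_bool_def)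
  also have "\<dots> = e k" using fin k by (simp only: sum_delta_simps)
  finally show ?thesis using spec_form[OF fin s, of "\<lambda>i. V i k"] by simp
qed

lemma spec_nonneg:
  assumes fin: "finite I" and p: "psd_on I f" and s: "spec I f e V" and k: "k \<in> I"
  shows "0 \<le> e k"
proof -
  have "\<forall>x. 0 \<le> Re (\<Sum>i\<in>I. \<Sum>j\<in>I. cnj (x i) * f i j * x j)"
    using p unfolding psd_on_def ..
  from this[THEN HOL.spec, of "\<lambda>i. V i k"] show ?thesis
    by (simp only: spec_eigenvalue[OF fin s k] Re_complex_of_real)
qed

lemma psd_on_spec:
  assumes fin: "finite I" and p: "psd_on I f"
  obtains e V where "spec I f e V" "\<And>k. k \<in> I \<Longrightarrow> 0 \<le> e k"
proof -
  have "hermitian_on I f" using p by (simp add: psd_on_def)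
  from spectral_theorem[OF fin this] obtain e V where "spec I f e V" .
  then show thesis using spec_nonneg[OF fin p] that[of e V] by simp
qed

text \<open>Factorisation of \<open>f\<close> as \<Phi> times its adjoint. Read as a vector on
  \<open>I \<times> R\<close>, \<Phi> is a purification of \<open>f\<close> with reference
  \<open>R\<close>.\<close>

abbreviation gram_on :: "'i set \<Rightarrow> 'r set \<Rightarrow> 'i op \<Rightarrow> ('i \<Rightarrow> 'r \<Rightarrow> complex) \<Rightarrow> bool" where
  "gram_on I R f \<Phi> \<equiv> \<forall>i\<in>I. \<forall>j\<in>I. f i j = (\<Sum>k\<in>R. \<Phi> i k * cnj (\<Phi> j k))"

lemma psd_on_gram:
  assumes "\<And>i j. i \<in> I \<Longrightarrow> j \<in> I \<Longrightarrow> f i j = (\<Sum>r\<in>R. \<Phi> i r * cnj (\<Phi> j r))"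
  shows "psd_on I f"
  unfolding psd_on_def
proof (intro conjI allI)
  show "hermitian_on I f" unfolding hermitian_on_def
    by (intro ballI) (simp add: assms mult.commute)
  fix x
  have "(\<Sum>i\<in>I. \<Sum>j\<in>I. cnj (x i) * f i j * x j) = (\<Sum>i\<in>I. \<Sum>j\<in>I. \<Sum>r\<in>R. (\<Phi> i r * cnj (x i)) * (cnj (\<Phi> j r) * x j))"
    by (intro sum.cong refl) (simp only: assms sum_distrib_left sum_distrib_right mult_ac)
  also have "\<dots> = (\<Sum>r\<in>R. \<Sum>i\<in>I. \<Sum>j\<in>I. (\<Phi> i r * cnj (x i)) * (cnj (\<Phi> j r) * x j))"
    by (rule sum_swap3[symmetric])
  also have "\<dots> = (\<Sum>r\<in>R. (\<Sum>i\<in>I. \<Phi> i r * cnj (x i)) * cnj (\<Sum>i\<in>I. \<Phi> i r * cnj (x i)))"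
    unfolding cnj_sum sum_product complex_cnj_mult complex_cnj_cnj ..
  also have "\<dots> = of_real (\<Sum>r\<in>R. (cmod (\<Sum>i\<in>I. \<Phi> i r * cnj (x i)))\<^sup>2)"
    unfolding of_real_sum complex_norm_square ..
  finally show "0 \<le> Re (\<Sum>i\<in>I. \<Sum>j\<in>I. cnj (x i) * f i j * x j)" by (simp add: sum_nonneg)
qed

lemma psd_on_imp_gram:
  assumes fin: "finite I" and p: "psd_on I f"
  shows "\<exists>\<Phi>. gram_on I I f \<Phi>"
proof -
  obtain e V where s: "spec I f e V" and e: "\<And>k. k \<in> I \<Longrightarrow> 0 \<le> e k"
    by (rule psd_on_spec[OF fin p]) simp
  have *: "f i j = (\<Sum>k\<in>I. (of_real (sqrt (e k)) * V i k) * cnj (of_real (sqrt (e k)) * V j k))" if "i \<in> I" "j \<in> I" for i j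
    unfolding spec_eq[OF s that]
  proof (intro sum.cong refl)
    fix k assume "k \<in> I"
    then have "complex_of_real (e k) = of_real (sqrt (e k)) * of_real (sqrt (e k))"
      using e[of k] by (simp flip: of_real_mult)
    then show "of_real (e k) * V i k * cnj (V j k) = (of_real (sqrt (e k)) * V i k) * cnj (of_real (sqrt (e k)) * V j k)"
      by simp
  qed
  show ?thesis by (intro exI ballI) (rule *)
qed

lemma psd_on_cong:
  assumes "\<And>i j. i \<in> I \<Longrightarrow> j \<in> I \<Longrightarrow> f i j = g i j" "psd_on I f"
  shows "psd_on I g"
proof -
  have "(\<Sum>i\<in>I. \<Sum>j\<in>I. cnj (x i) * g i j * x j) = (\<Sum>i\<in>I. \<Sum>j\<in>I. cnj (x i) * f i j * x j)" for x
    by (intro sum.cong refl) (simp only: assms(1))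
  moreover have "hermitian_on I g"
    using assms unfolding psd_on_def hermitian_on_def by metis
  ultimately show ?thesis using assms(2) unfolding psd_on_def by simp
qed

lemma psd_on_sum:
  assumes "\<And>y. y \<in> Y \<Longrightarrow> psd_on I (f y)"
  shows "psd_on I (\<lambda>i j. \<Sum>y\<in>Y. f y i j)"
  unfolding psd_on_def
proof (intro conjI allI)
  show "hermitian_on I (\<lambda>i j. \<Sum>y\<in>Y. f y i j)"
    unfolding hermitian_on_def cnj_sum
  proof (intro ballI sum.cong refl)
    fix i j y assume "i \<in> I" "j \<in> I" "y \<in> Y"
    then show "f y j i = cnj (f y i j)" using assms[of y] unfolding psd_on_def hermitian_on_def by blast
  qed
  fix x
  have "(\<Sum>i\<in>I. \<Sum>j\<in>I. cnj (x i) * (\<Sum>y\<in>Y. f y i j) * x j) = (\<Sum>y\<in>Y. \<Sum>i\<in>I. \<Sum>j\<in>I. cnj (x i) * f y i j * x j)"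
    unfolding sum_distrib_left sum_distrib_right by (rule sum_swap3[symmetric])
  then have "Re (\<Sum>i\<in>I. \<Sum>j\<in>I. cnj (x i) * (\<Sum>y\<in>Y. f y i j) * x j) = (\<Sum>y\<in>Y. Re (\<Sum>i\<in>I. \<Sum>j\<in>I. cnj (x i) * f y i j * x j))"
    by (simp only: Re_sum)
  also have "\<dots> \<ge> 0" using assms unfolding psd_on_def by (intro sum_nonneg) blast
  finally show "0 \<le> Re (\<Sum>i\<in>I. \<Sum>j\<in>I. cnj (x i) * (\<Sum>y\<in>Y. f y i j) * x j)" .
qed

text \<open>Both operators are marginals of the vector \<open>M\<close> on
  \<open>I \<times> J\<close>, so this is the equality of the two entropies of a bipartite pure
  state, the device for passing to a purifying system. The weights
  \<open>(cmod (c k l))\<^sup>2\<close> have row sums \<open>e k\<close> and column sums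
  \<open>d l\<close> and live on equal eigenvalues.\<close>

lemma Ent_gram_swap:
  assumes fin: "finite I" "finite J"
  shows "Ent I (\<lambda>i i'. \<Sum>j\<in>J. M i j * cnj (M i' j)) = Ent J (\<lambda>j j'. \<Sum>i\<in>I. M i j * cnj (M i j'))"
proof -
  let ?f = "\<lambda>i i'. \<Sum>j\<in>J. M i j * cnj (M i' j)" and ?g = "\<lambda>j j'. \<Sum>i\<in>I. M i j * cnj (M i j')"
  have p: "psd_on I ?f" by (rule psd_on_gram) simp
  have q: "psd_on J ?g" by (rule psd_on_gram[where R = I and \<Phi> = "\<lambda>j i. M i j"]) simp
  obtain e V where f: "spec I ?f e V" and e: "\<And>k. k \<in> I \<Longrightarrow> 0 \<le> e k" by (rule psd_on_spec[OF fin(1) p]) simp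
  obtain d W0 where g0: "spec J ?g d W0" and d: "\<And>k. k \<in> J \<Longrightarrow> 0 \<le> d k" by (rule psd_on_spec[OF fin(2) q]) simp
  \<comment> \<open>\<open>?g\<close> is the complex conjugate of the adjoint of \<open>M\<close>
    times \<open>M\<close>; conjugating the eigenbasis compensates for this.\<close>
  define W where "W j l = cnj (W0 j l)" for j l
  have g: "spec J (\<lambda>j j'. \<Sum>i\<in>I. cnj (M i j) * M i j') d W"
    unfolding spec_def
  proof (intro conjI ballI)
    show "onb J W" unfolding W_def by (rule onb_cnj[OF spec_onb[OF g0]])
    fix j j' assume "j \<in> J" "j' \<in> J"
    from arg_cong[OF spec_eq[OF g0 this], of cnj]
    show "(\<Sum>i\<in>I. cnj (M i j) * M i j') = (\<Sum>k\<in>J. of_real (d k) * W j k * cnj (W j' k))"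
      unfolding W_def by simp
  qed
  have tw: "(\<Sum>i'\<in>I. ?f i i' * M i' j) = (\<Sum>j'\<in>J. M i j' * (\<Sum>i'\<in>I. cnj (M i' j') * M i' j))" for i j
    unfolding sum_distrib_left sum_distrib_right by (subst sum.swap) (simp only: mult_ac)
  define c where "c k l = (\<Sum>i\<in>I. \<Sum>j\<in>J. cnj (V i k) * M i j * W j l)" for k l
  have ed: "e k = d l" if "c k l \<noteq> 0" "k \<in> I" "l \<in> J" for k l
    using intertwiner_eigenvalues[OF fin f g tw that(2,3)] that(1) unfolding c_def by simp
  have 1: "(\<Sum>l\<in>J. (cmod (c k l))\<^sup>2) = e k" if "k \<in> I" for k
  proof -
    define x where "x j = (\<Sum>i\<in>I. cnj (V i k) * M i j)" for j
    have "c k l = (\<Sum>j\<in>J. cnj (cnj (W j l)) * x j)" for l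
      unfolding c_def x_def sum_distrib_left by (subst sum.swap) (simp add: mult_ac)
    then have "(\<Sum>l\<in>J. (cmod (c k l))\<^sup>2) = (\<Sum>j\<in>J. (cmod (x j))\<^sup>2)"
      using sum_cmod2_onb[OF fin(2) onb_cnj[OF spec_onb[OF g]], of x] by simp
    moreover have "complex_of_real (\<Sum>j\<in>J. (cmod (x j))\<^sup>2) = (\<Sum>i\<in>I. \<Sum>i'\<in>I. cnj (V i k) * ?f i i' * V i' k)"
      unfolding of_real_sum complex_norm_square x_def cnj_sum sum_product sum_distrib_left sum_distrib_right
      by (subst sum_swap3') (simp add: mult_ac)
    ultimately show ?thesis unfolding spec_eigenvalue[OF fin(1) f that] of_real_eq_iff by simp
  qed
  have 2: "(\<Sum>k\<in>I. (cmod (c k l))\<^sup>2) = d l" if "l \<in> J" for l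
  proof -
    define x where "x i = (\<Sum>j\<in>J. M i j * W j l)" for i
    have "c k l = (\<Sum>i\<in>I. cnj (V i k) * x i)" for k
      unfolding c_def x_def sum_distrib_left by (simp only: mult_ac)
    then have "(\<Sum>k\<in>I. (cmod (c k l))\<^sup>2) = (\<Sum>i\<in>I. (cmod (x i))\<^sup>2)"
      using sum_cmod2_onb[OF fin(1) spec_onb[OF f], of x] by simp
    moreover have "complex_of_real (\<Sum>i\<in>I. (cmod (x i))\<^sup>2) = (\<Sum>j'\<in>J. \<Sum>j\<in>J. cnj (W j' l) * (\<Sum>i\<in>I. cnj (M i j') * M i j) * W j l)"
      unfolding of_real_sum complex_norm_square x_def cnj_sum sum_product sum_distrib_left sum_distrib_right
      by (subst sum_swap3) (simp add: mult_ac)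
    ultimately show ?thesis unfolding spec_eigenvalue[OF fin(2) g that] of_real_eq_iff by simp
  qed
  \<comment> \<open>Writing \<open>eta t = t * h t\<close> lets the weights absorb the factor
    \<open>t\<close>, so zero eigenvalues are no exception.\<close>
  define h where "h t = - log 2 t" for t :: real
  have eta: "eta t = t * h t" if "0 \<le> t" for t using that by (auto simp: eta_def h_def)
  have "Ent I ?f = (\<Sum>k\<in>I. \<Sum>l\<in>J. (cmod (c k l))\<^sup>2 * h (e k))"
    unfolding Ent_eq[OF fin(1) f]
    by (intro sum.cong refl) (simp add: sum_distrib_right[symmetric] 1 eta e)
  also have "\<dots> = (\<Sum>k\<in>I. \<Sum>l\<in>J. (cmod (c k l))\<^sup>2 * h (d l))"
    using ed by (intro sum.cong refl) fastforce
  also have "\<dots> = (\<Sum>l\<in>J. \<Sum>k\<in>I. (cmod (c k l))\<^sup>2 * h (d l))" by (rule sum.swap)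
  also have "\<dots> = Ent J ?g"
    unfolding Ent_eq[OF fin(2) g0]
    by (intro sum.cong refl) (simp add: sum_distrib_right[symmetric] 2 eta d)
  finally show ?thesis .
qed

lemma sum_Times: "(\<Sum>p\<in>A \<times> B. F p) = (\<Sum>a\<in>A. \<Sum>b\<in>B. F (a, b))"
  by (simp add: sum.cartesian_product)

lemma Ent_reindex:
  assumes h: "bij_betw h J I" and fin: "finite I" and f: "hermitian_on I f"
  shows "Ent J (\<lambda>i j. f (h i) (h j)) = Ent I f"
proof -
  obtain e V where s: "spec I f e V" by (rule spectral_theorem[OF fin f])
  have hI: "h j \<in> I" if "j \<in> J" for j using h that by (auto simp: bij_betw_def)
  have inj: "h i = h j \<longleftrightarrow> i = j" if "i \<in> J" "j \<in> J" for i j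
    using h that by (auto simp: bij_betw_def inj_on_def)
  have finJ: "finite J" using bij_betw_finite[OF h] fin by simp
  have sum_h: "(\<Sum>k\<in>J. F (h k)) = (\<Sum>k\<in>I. F k)" for F :: "_ \<Rightarrow> 'c::comm_monoid_add"
    by (rule sum.reindex_bij_betw[OF h])
  have "spec J (\<lambda>i j. f (h i) (h j)) (\<lambda>k. e (h k)) (\<lambda>i k. V (h i) (h k))"
    unfolding spec_def onb_def
  proof (intro conjI ballI)
    fix i j assume ij: "i \<in> J" "j \<in> J"
    show "(\<Sum>k\<in>J. V (h i) (h k) * cnj (V (h j) (h k))) = of_bool (i = j)"
      using onb_rows[OF spec_onb[OF s] hI[OF ij(1)] hI[OF ij(2)]] sum_h[of "\<lambda>k. V (h i) k * cnj (V (h j) k)"] inj[OF ij]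
      by simp
    show "(\<Sum>k\<in>J. cnj (V (h k) (h i)) * V (h k) (h j)) = of_bool (i = j)"
      using onb_cols[OF spec_onb[OF s] hI[OF ij(1)] hI[OF ij(2)]] sum_h[of "\<lambda>k. cnj (V k (h i)) * V k (h j)"] inj[OF ij]
      by simp
    show "f (h i) (h j) = (\<Sum>k\<in>J. of_real (e (h k)) * V (h i) (h k) * cnj (V (h j) (h k)))"
      using spec_eq[OF s hI[OF ij(1)] hI[OF ij(2)]] sum_h[of "\<lambda>k. of_real (e k) * V (h i) k * cnj (V (h j) k)"]
      by simp
  qed
  then show ?thesis using Ent_eq[OF finJ] Ent_eq[OF fin s] sum_h[of "\<lambda>k. eta (e k)"] by simp
qed

text \<open>Diagonalisation makes \<open>A\<close> similar to a diagonal matrix, whose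
  characteristic polynomial has the eigenvalues as roots with the right multiplicity.\<close>

lemma vN_eq_Ent:
  assumes A: "A \<in> carrier_mat n n" and h: "hermitian_on {..<n} (\<lambda>i j. A $$ (i,j))"
  shows "vN A = Ent {..<n} (\<lambda>i j. A $$ (i,j))"
proof -
  obtain e V where s: "spec {..<n} (\<lambda>i j. A $$ (i,j)) e V" by (rule spectral_theorem[OF finite_lessThan h])
  define P where "P = mat n n (\<lambda>(i,j). V i j)"
  define Q where "Q = mat n n (\<lambda>(i,j). cnj (V j i))"
  define D where "D = mat n n (\<lambda>(i,j). if i = j then complex_of_real (e i) else 0)"
  have c: "P \<in> carrier_mat n n" "Q \<in> carrier_mat n n" "D \<in> carrier_mat n n"
    by (auto simp: P_def Q_def D_def)
  have PQ: "P * Q = 1\<^sub>m n"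
    by (rule eq_matI) (use onb_rows[OF spec_onb[OF s]] in \<open>auto simp: P_def Q_def scalar_prod_def atLeast0LessThan\<close>)
  have QP: "Q * P = 1\<^sub>m n"
    by (rule eq_matI) (use onb_cols[OF spec_onb[OF s]] in \<open>auto simp: P_def Q_def scalar_prod_def atLeast0LessThan\<close>)
  have PD: "P * D = mat n n (\<lambda>(i,k). of_real (e k) * V i k)"
  proof (rule eq_matI)
    fix i k assume "i < dim_row (mat n n (\<lambda>(i,k). of_real (e k) * V i k))" "k < dim_col (mat n n (\<lambda>(i,k). of_real (e k) * V i k))"
    then have ik: "i < n" "k < n" by auto
    then have "(P * D) $$ (i,k) = (\<Sum>j<n. V i j * (if j = k then complex_of_real (e j) else 0))"
      by (simp add: P_def D_def scalar_prod_def atLeast0LessThan)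
    also have "\<dots> = (\<Sum>j<n. if j = k then V i j * complex_of_real (e j) else 0)"
      by (intro sum.cong) auto
    also have "\<dots> = of_real (e k) * V i k" using ik by simp
    finally show "(P * D) $$ (i,k) = mat n n (\<lambda>(i,k). of_real (e k) * V i k) $$ (i,k)" using ik by simp
  qed (auto simp: P_def D_def)
  have "A = P * D * Q"
    unfolding PD by (rule eq_matI)
      (use A spec_eq[OF s] in \<open>auto simp: Q_def scalar_prod_def atLeast0LessThan\<close>)
  then have "similar_mat A D"
    unfolding similar_mat_def similar_mat_wit_def Let_def using A c PQ QP
    by (intro exI[of _ P] exI[of _ Q]) auto
  then have "char_poly A = char_poly D" by (rule char_poly_similar)
  also have "\<dots> = (\<Prod>a\<leftarrow>diag_mat D. [:- a, 1:])"
    by (rule char_poly_upper_triangular[OF c(3)]) (auto simp: D_def)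
  also have "diag_mat D = map (\<lambda>i. complex_of_real (e i)) [0..<n]"
    by (auto simp: diag_mat_def D_def)
  finally have "char_poly A = (\<Prod>i<n. [:- complex_of_real (e i), 1:])"
    by (simp add: o_def interv_sum_list_conv_sum_set_nat prod.distinct_set_conv_list[symmetric] atLeast0LessThan)
  then have "proots (char_poly A) = (\<Sum>i<n. {#complex_of_real (e i)#})"
    by (simp add: proots_prod)
  moreover have *: "(\<Sum>z\<in>#(\<Sum>i<m. {#complex_of_real (e i)#}). eta (Re z)) = (\<Sum>i<m. eta (Re (complex_of_real (e i))))" for m
    by (induct m) auto
  ultimately have "vN A = (\<Sum>i<n. eta (e i))"
    unfolding vN_def by simp
  then show ?thesis using Ent_eq[OF finite_lessThan s] by simp
qed

section \<open>Traces, and entropies of rank-one, product and block-diagonal operators\<close>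

definition tr_on :: "'i set \<Rightarrow> 'i op \<Rightarrow> real" where
  "tr_on I f = Re (\<Sum>i\<in>I. f i i)"

lemma spec_trace:
  assumes fin: "finite I" and s: "spec I f e V"
  shows "(\<Sum>i\<in>I. f i i) = of_real (\<Sum>k\<in>I. e k)"
proof -
  have "(\<Sum>i\<in>I. f i i) = (\<Sum>i\<in>I. \<Sum>k\<in>I. of_real (e k) * (V i k * cnj (V i k)))"
    by (intro sum.cong refl) (simp only: spec_eq[OF s] mult.assoc)
  also have "\<dots> = (\<Sum>k\<in>I. of_real (e k) * (\<Sum>i\<in>I. V i k * cnj (V i k)))"
    unfolding sum_distrib_left by (rule sum.swap)
  also have "\<dots> = of_real (\<Sum>k\<in>I. e k)"
    unfolding of_real_sum by (intro sum.cong refl) (simp add: onb_cols'[OF spec_onb[OF s]])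
  finally show ?thesis .
qed

lemma tr_on_spec: "finite I \<Longrightarrow> spec I f e V \<Longrightarrow> tr_on I f = (\<Sum>k\<in>I. e k)"
  unfolding tr_on_def by (simp only: spec_trace Re_complex_of_real)

lemma tr_on_nonneg: "finite I \<Longrightarrow> psd_on I f \<Longrightarrow> 0 \<le> tr_on I f"
  by (metis psd_on_spec sum_nonneg tr_on_spec)

lemma Ent_singleton:
  assumes "hermitian_on {a} f"
  shows "Ent {a} f = eta (Re (f a a))"
proof -
  have "cnj (f a a) = f a a" using assms by (simp add: hermitian_on_def)
  then have "of_real (Re (f a a)) = f a a" by (simp add: complex_eq_iff)
  then have "spec {a} f (\<lambda>_. Re (f a a)) (\<lambda>_ _. 1)" by (simp add: spec_def onb_def)
  from Ent_eq[OF _ this] show ?thesis by simp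
qed

text \<open>A vector is a Gram factor with a one-point reference, so swapping leaves a single
  number. The vector is not normalised, hence \<open>eta\<close> of its squared norm instead of
  0.\<close>

lemma Ent_pure:
  assumes fin: "finite I"
  shows "Ent I (\<lambda>i j. \<xi> i * cnj (\<xi> j)) = eta (\<Sum>i\<in>I. (cmod (\<xi> i))\<^sup>2)"
proof -
  have h: "hermitian_on {()} (\<lambda>j j'. \<Sum>i\<in>I. \<xi> i * cnj (\<xi> i))"
    unfolding hermitian_on_def by (simp add: mult.commute)
  have "Re (\<Sum>i\<in>I. \<xi> i * cnj (\<xi> i)) = (\<Sum>i\<in>I. (cmod (\<xi> i))\<^sup>2)"
    unfolding complex_norm_square[symmetric] by simp
  then show ?thesis
    using Ent_gram_swap[OF fin, of "{()}" "\<lambda>i j. \<xi> i"] Ent_singleton[OF h] by simp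
qed

lemma eta_mult: "0 \<le> s \<Longrightarrow> 0 \<le> t \<Longrightarrow> eta (s * t) = t * eta s + s * eta t"
  by (auto simp: eta_def log_mult algebra_simps mult_le_0_iff)

lemma spec_tensor:
  assumes fin: "finite I" "finite J" and f: "spec I f e V" and g: "spec J g d W"
  shows "spec (I \<times> J) (\<lambda>p q. f (fst p) (fst q) * g (snd p) (snd q)) (\<lambda>k. e (fst k) * d (snd k))
     (\<lambda>p k. V (fst p) (fst k) * W (snd p) (snd k))"
  unfolding spec_def onb_def
proof (intro conjI ballI)
  fix p q assume pq: "p \<in> I \<times> J" "q \<in> I \<times> J"
  have "(\<Sum>k\<in>I \<times> J. V (fst p) (fst k) * W (snd p) (snd k) * cnj (V (fst q) (fst k) * W (snd q) (snd k)))
     = (\<Sum>k\<in>I. V (fst p) k * cnj (V (fst q) k)) * (\<Sum>l\<in>J. W (snd p) l * cnj (W (snd q) l))"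
    unfolding sum_Times sum_product by (simp add: mult_ac)
  then show "(\<Sum>k\<in>I \<times> J. V (fst p) (fst k) * W (snd p) (snd k) * cnj (V (fst q) (fst k) * W (snd q) (snd k))) = of_bool (p = q)"
    using pq onb_rows[OF spec_onb[OF f]] onb_rows[OF spec_onb[OF g]] by (auto simp: prod_eq_iff)
  have "(\<Sum>k\<in>I \<times> J. cnj (V (fst k) (fst p) * W (snd k) (snd p)) * (V (fst k) (fst q) * W (snd k) (snd q)))
     = (\<Sum>k\<in>I. cnj (V k (fst p)) * V k (fst q)) * (\<Sum>l\<in>J. cnj (W l (snd p)) * W l (snd q))"
    unfolding sum_Times sum_product by (simp add: mult_ac)
  then show "(\<Sum>k\<in>I \<times> J. cnj (V (fst k) (fst p) * W (snd k) (snd p)) * (V (fst k) (fst q) * W (snd k) (snd q))) = of_bool (p = q)"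
    using pq onb_cols[OF spec_onb[OF f]] onb_cols[OF spec_onb[OF g]] by (auto simp: prod_eq_iff)
  have "f (fst p) (fst q) = (\<Sum>k\<in>I. of_real (e k) * V (fst p) k * cnj (V (fst q) k))"
    "g (snd p) (snd q) = (\<Sum>l\<in>J. of_real (d l) * W (snd p) l * cnj (W (snd q) l))"
    using pq by (auto intro!: spec_eq[OF f] spec_eq[OF g])
  then show "f (fst p) (fst q) * g (snd p) (snd q) = (\<Sum>k\<in>I \<times> J. of_real (e (fst k) * d (snd k)) *
      (V (fst p) (fst k) * W (snd p) (snd k)) * cnj (V (fst q) (fst k) * W (snd q) (snd k)))"
    unfolding sum_Times by (simp add: sum_product mult_ac)
qed

text \<open>Additivity of the entropy; the traces appear because neither factor is
  normalised.\<close>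

lemma Ent_tensor:
  assumes fin: "finite I" "finite J" and f: "psd_on I f" and g: "psd_on J g"
  shows "Ent (I \<times> J) (\<lambda>p q. f (fst p) (fst q) * g (snd p) (snd q)) = tr_on J g * Ent I f + tr_on I f * Ent J g"
proof -
  obtain e V where s: "spec I f e V" and e: "\<And>k. k \<in> I \<Longrightarrow> 0 \<le> e k"
    by (rule psd_on_spec[OF fin(1) f]) simp
  obtain d W where t: "spec J g d W" and d: "\<And>k. k \<in> J \<Longrightarrow> 0 \<le> d k"
    by (rule psd_on_spec[OF fin(2) g]) simp
  have "Ent (I \<times> J) (\<lambda>p q. f (fst p) (fst q) * g (snd p) (snd q)) = (\<Sum>k\<in>I. \<Sum>l\<in>J. eta (e k * d l))"
    using Ent_eq[OF _ spec_tensor[OF fin s t]] fin by (simp add: sum_Times)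
  also have "\<dots> = (\<Sum>k\<in>I. \<Sum>l\<in>J. eta (e k) * d l + e k * eta (d l))"
    by (intro sum.cong refl) (simp add: eta_mult e d)
  also have "\<dots> = (\<Sum>k\<in>I. eta (e k)) * (\<Sum>l\<in>J. d l) + (\<Sum>k\<in>I. e k) * (\<Sum>l\<in>J. eta (d l))"
    by (simp only: sum.distrib sum_product)
  finally show ?thesis
    by (simp add: Ent_eq[OF fin(1) s] Ent_eq[OF fin(2) t] tr_on_spec[OF fin(1) s] tr_on_spec[OF fin(2) t])
qed

lemma cnj_of_bool: "cnj (of_bool b) = of_bool b"
  by (cases b) auto

text \<open>Eigenbases of the blocks together form one of the whole. Entropies of classical-quantum
  states thus become sums over letters, with the probabilities kept inside the blocks.\<close>

lemma Ent_block_diagonal: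
  assumes fin: "finite X" "finite J" and f: "\<And>x. x \<in> X \<Longrightarrow> hermitian_on J (f x)"
  shows "Ent (X \<times> J) (\<lambda>p q. if fst p = fst q then f (fst p) (snd p) (snd q) else 0) = (\<Sum>x\<in>X. Ent J (f x))"
proof -
  have "\<forall>x\<in>X. \<exists>e V. spec J (f x) e V"
    using spectral_theorem[OF fin(2) f] by metis
  then obtain e V where s: "\<And>x. x \<in> X \<Longrightarrow> spec J (f x) (e x) (V x)" by metis
  let ?V = "\<lambda>p k. of_bool (fst p = fst k) * V (fst p) (snd p) (snd k)"
  have "spec (X \<times> J) (\<lambda>p q. if fst p = fst q then f (fst p) (snd p) (snd q) else 0) (\<lambda>k. e (fst k) (snd k)) ?V"
    unfolding spec_def onb_def
  proof (intro conjI ballI)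
    fix p q assume "p \<in> X \<times> J" "q \<in> X \<times> J"
    then obtain x j y l where p: "p = (x, j)" and q: "q = (y, l)" and pq: "x \<in> X" "j \<in> J" "y \<in> X" "l \<in> J"
      by auto
    have "(\<Sum>k\<in>X \<times> J. ?V p k * cnj (?V q k)) = (\<Sum>z\<in>X. of_bool (x = z) * (of_bool (y = z) * (\<Sum>k\<in>J. V x j k * cnj (V y l k))))"
      unfolding sum_Times p q by (simp add: sum_distrib_left cnj_of_bool mult_ac)
    also have "\<dots> = of_bool (y = x) * (\<Sum>k\<in>J. V x j k * cnj (V y l k))"
      using fin pq by (simp only: sum_delta_simps)
    also have "\<dots> = of_bool (p = q)"
      using pq onb_rows[OF spec_onb[OF s]] by (auto simp: p q)
    finally show "(\<Sum>k\<in>X \<times> J. ?V p k * cnj (?V q k)) = of_bool (p = q)" .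
    have "(\<Sum>k\<in>X \<times> J. cnj (?V k p) * ?V k q) = (\<Sum>z\<in>X. of_bool (z = x) * (of_bool (z = y) * (\<Sum>k\<in>J. cnj (V z k j) * V z k l)))"
      unfolding sum_Times p q by (simp add: sum_distrib_left cnj_of_bool mult_ac)
    also have "\<dots> = of_bool (x = y) * (\<Sum>k\<in>J. cnj (V x k j) * V x k l)"
      using fin pq by (simp only: sum_delta_simps)
    also have "\<dots> = of_bool (p = q)"
      using pq onb_cols[OF spec_onb[OF s]] by (auto simp: p q)
    finally show "(\<Sum>k\<in>X \<times> J. cnj (?V k p) * ?V k q) = of_bool (p = q)" .
    have "(\<Sum>k\<in>X \<times> J. of_real (e (fst k) (snd k)) * ?V p k * cnj (?V q k))
        = (\<Sum>z\<in>X. of_bool (x = z) * (of_bool (y = z) * (\<Sum>k\<in>J. of_real (e z k) * V x j k * cnj (V y l k))))"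
      unfolding sum_Times p q by (simp add: sum_distrib_left cnj_of_bool mult_ac)
    also have "\<dots> = of_bool (y = x) * (\<Sum>k\<in>J. of_real (e x k) * V x j k * cnj (V y l k))"
      using fin pq by (simp only: sum_delta_simps)
    also have "\<dots> = (if fst p = fst q then f (fst p) (snd p) (snd q) else 0)"
      using pq spec_eq[OF s] by (auto simp: p q)
    finally show "(if fst p = fst q then f (fst p) (snd p) (snd q) else 0)
        = (\<Sum>k\<in>X \<times> J. of_real (e (fst k) (snd k)) * ?V p k * cnj (?V q k))" by simp
  qed
  from Ent_eq[OF _ this] fin have "Ent (X \<times> J) (\<lambda>p q. if fst p = fst q then f (fst p) (snd p) (snd q) else 0)
      = (\<Sum>x\<in>X. \<Sum>k\<in>J. eta (e x k))" by (simp add: sum_Times)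
  also have "\<dots> = (\<Sum>x\<in>X. Ent J (f x))"
    by (intro sum.cong refl) (simp add: Ent_eq[OF fin(2) s])
  finally show ?thesis .
qed

section \<open>Joint convexity of the relative entropy\<close>

text \<open>Matrix of \<open>A\<close> with rows in the basis \<open>V\<close> and columns in the
  basis \<open>W\<close>. For eigenbases of \<open>f\<close> and \<open>g\<close>, left
  multiplication by \<open>f\<close> and right multiplication by \<open>g\<close> become diagonal
  simultaneously.\<close>

definition mixed :: "'i set \<Rightarrow> 'i op \<Rightarrow> 'i op \<Rightarrow> 'i op \<Rightarrow> 'i \<Rightarrow> 'i \<Rightarrow> complex" where
  "mixed I V W A k l = (\<Sum>i\<in>I. \<Sum>j\<in>I. cnj (V i k) * A i j * W j l)"

definition overlap :: "'i set \<Rightarrow> 'i op \<Rightarrow> 'i op \<Rightarrow> 'i \<Rightarrow> 'i \<Rightarrow> complex" where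
  "overlap I V W k l = (\<Sum>i\<in>I. cnj (V i k) * W i l)"

lemma parseval_mixed:
  assumes fin: "finite I" and V: "onb I V" and W: "onb I W"
  shows "(\<Sum>k\<in>I. \<Sum>l\<in>I. cnj (mixed I V W Z k l) * mixed I V W A k l) = (\<Sum>i\<in>I. \<Sum>j\<in>I. cnj (Z i j) * A i j)"
proof -
  have m: "mixed I V W B k l = (\<Sum>i\<in>I. cnj (V i k) * (\<Sum>j\<in>I. cnj (cnj (W j l)) * B i j))" for B k l
    unfolding mixed_def sum_distrib_left by (simp only: mult_ac complex_cnj_cnj)
  have "(\<Sum>k\<in>I. \<Sum>l\<in>I. cnj (mixed I V W Z k l) * mixed I V W A k l)
      = (\<Sum>l\<in>I. \<Sum>k\<in>I. cnj (mixed I V W Z k l) * mixed I V W A k l)" by (rule sum.swap)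
  also have "\<dots> = (\<Sum>l\<in>I. \<Sum>i\<in>I. cnj (\<Sum>j\<in>I. cnj (cnj (W j l)) * Z i j) * (\<Sum>j\<in>I. cnj (cnj (W j l)) * A i j))"
    unfolding m parseval[OF fin V] ..
  also have "\<dots> = (\<Sum>i\<in>I. \<Sum>l\<in>I. cnj (\<Sum>j\<in>I. cnj (cnj (W j l)) * Z i j) * (\<Sum>j\<in>I. cnj (cnj (W j l)) * A i j))"
    by (rule sum.swap)
  also have "\<dots> = (\<Sum>i\<in>I. \<Sum>j\<in>I. cnj (Z i j) * A i j)"
    unfolding parseval[OF fin onb_cnj[OF W]] ..
  finally show ?thesis .
qed

lemma mixed_left:
  assumes fin: "finite I" and s: "spec I f r V" and k: "k \<in> I"
  shows "mixed I V W (\<lambda>i j. \<Sum>m\<in>I. f i m * Z m j) k l = of_real (r k) * mixed I V W Z k l"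
proof -
  have "mixed I V W (\<lambda>i j. \<Sum>m\<in>I. f i m * Z m j) k l
     = (\<Sum>i\<in>I. \<Sum>j\<in>I. \<Sum>m\<in>I. (cnj (V i k) * f i m) * (Z m j * W j l))"
    unfolding mixed_def sum_distrib_left sum_distrib_right by (simp only: mult_ac)
  also have "\<dots> = (\<Sum>j\<in>I. \<Sum>m\<in>I. \<Sum>i\<in>I. (cnj (V i k) * f i m) * (Z m j * W j l))"
    by (rule sum_swap3)
  also have "\<dots> = (\<Sum>j\<in>I. \<Sum>m\<in>I. of_real (r k) * cnj (V m k) * (Z m j * W j l))"
    by (intro sum.cong refl) (simp only: sum_distrib_right[symmetric] spec_eigen_left[OF fin s _ k])
  also have "\<dots> = (\<Sum>m\<in>I. \<Sum>j\<in>I. of_real (r k) * cnj (V m k) * (Z m j * W j l))"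
    by (rule sum.swap)
  finally show ?thesis unfolding mixed_def sum_distrib_left by (simp only: mult_ac)
qed

lemma mixed_right:
  assumes fin: "finite I" and s: "spec I g s W" and l: "l \<in> I"
  shows "mixed I V W (\<lambda>i j. \<Sum>m\<in>I. Z i m * g m j) k l = of_real (s l) * mixed I V W Z k l"
proof -
  have "mixed I V W (\<lambda>i j. \<Sum>m\<in>I. Z i m * g m j) k l
     = (\<Sum>i\<in>I. \<Sum>j\<in>I. \<Sum>m\<in>I. (cnj (V i k) * Z i m) * (g m j * W j l))"
    unfolding mixed_def sum_distrib_left sum_distrib_right by (simp only: mult_ac)
  also have "\<dots> = (\<Sum>i\<in>I. \<Sum>m\<in>I. \<Sum>j\<in>I. (cnj (V i k) * Z i m) * (g m j * W j l))"
    by (intro sum.cong refl sum.swap)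
  also have "\<dots> = (\<Sum>i\<in>I. \<Sum>m\<in>I. (cnj (V i k) * Z i m) * (of_real (s l) * W m l))"
    by (intro sum.cong refl) (simp only: sum_distrib_left[symmetric] spec_eigen_right[OF fin s _ l])
  finally show ?thesis unfolding mixed_def sum_distrib_left by (simp only: mult_ac)
qed

lemma mixed_spec:
  assumes fin: "finite I" and f: "spec I f r V" and g: "spec I g s W" and k: "k \<in> I" and l: "l \<in> I"
  shows "mixed I V W f k l = of_real (r k) * overlap I V W k l"
    and "mixed I V W g k l = of_real (s l) * overlap I V W k l"
proof -
  have "mixed I V W f k l = (\<Sum>j\<in>I. (\<Sum>i\<in>I. cnj (V i k) * f i j) * W j l)"
    unfolding mixed_def sum_distrib_right by (rule sum.swap)
  also have "\<dots> = (\<Sum>j\<in>I. of_real (r k) * cnj (V j k) * W j l)"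
    by (intro sum.cong refl) (simp only: spec_eigen_left[OF fin f _ k])
  finally show "mixed I V W f k l = of_real (r k) * overlap I V W k l"
    unfolding overlap_def sum_distrib_left by (simp only: mult_ac)
  have "mixed I V W g k l = (\<Sum>i\<in>I. cnj (V i k) * (\<Sum>j\<in>I. g i j * W j l))"
    unfolding mixed_def sum_distrib_left by (simp only: mult_ac)
  also have "\<dots> = (\<Sum>i\<in>I. cnj (V i k) * (of_real (s l) * W i l))"
    by (intro sum.cong refl) (simp only: spec_eigen_right[OF fin g _ l])
  finally show "mixed I V W g k l = of_real (s l) * overlap I V W k l"
    unfolding overlap_def sum_distrib_left by (simp only: mult_ac)
qed

text \<open>For fixed \<open>u\<close> and \<open>Z\<close> this is linear in the pair \<open>(f, g)\<close>; its supremum over \<open>Z\<close> is the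
  quadratic form whose integral over \<open>u\<close> is the relative entropy. Joint convexity follows.\<close>

definition var_form :: "'i set \<Rightarrow> real \<Rightarrow> 'i op \<Rightarrow> 'i op \<Rightarrow> 'i op \<Rightarrow> real" where
  "var_form I u f g Z = Re (\<Sum>i\<in>I. \<Sum>j\<in>I. cnj (Z i j) * (2 * f i j - 2 * g i j
      - of_real (1 - u) * (\<Sum>m\<in>I. f i m * Z m j) - of_real u * (\<Sum>m\<in>I. Z i m * g m j)))"

text \<open>In operator terms, the Hilbert-Schmidt pairing of \<open>f - g\<close> with the inverse
  of \<open>(1 - u) L + u R\<close> applied to \<open>f - g\<close>, where L is left multiplication
  by \<open>f\<close> and R right multiplication by \<open>g\<close>. A pair of zero eigenvalues
  contributes \<open>0 / 0 = 0\<close>.\<close>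

definition rel_quad :: "'i set \<Rightarrow> ('i \<Rightarrow> real) \<Rightarrow> 'i op \<Rightarrow> ('i \<Rightarrow> real) \<Rightarrow> 'i op \<Rightarrow> real \<Rightarrow> real" where
  "rel_quad I r V s W u = (\<Sum>k\<in>I. \<Sum>l\<in>I. (cmod (overlap I V W k l))\<^sup>2 * ((r k - s l)\<^sup>2 / ((1 - u) * r k + u * s l)))"

text \<open>Both multiplications are diagonal in the mixed basis, so the functional splits into
  independent parabolas, one for each pair of eigenvalues.\<close>

lemma var_form_spec:
  assumes fin: "finite I" and f: "spec I f r V" and g: "spec I g s W"
  shows "var_form I u f g Z = (\<Sum>k\<in>I. \<Sum>l\<in>I.
     2 * (r k - s l) * Re (cnj (mixed I V W Z k l) * overlap I V W k l)
      - ((1 - u) * r k + u * s l) * (cmod (mixed I V W Z k l))\<^sup>2)"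
proof -
  let ?A = "\<lambda>i j. 2 * f i j - 2 * g i j - of_real (1 - u) * (\<Sum>m\<in>I. f i m * Z m j) - of_real u * (\<Sum>m\<in>I. Z i m * g m j)"
  have lin: "mixed I V W ?A k l = 2 * mixed I V W f k l - 2 * mixed I V W g k l
     - of_real (1 - u) * mixed I V W (\<lambda>i j. \<Sum>m\<in>I. f i m * Z m j) k l - of_real u * mixed I V W (\<lambda>i j. \<Sum>m\<in>I. Z i m * g m j) k l" for k l
  proof -
    have "cnj (V i k) * ?A i j * W j l = 2 * (cnj (V i k) * f i j * W j l) - 2 * (cnj (V i k) * g i j * W j l)
      - of_real (1 - u) * (cnj (V i k) * (\<Sum>m\<in>I. f i m * Z m j) * W j l) - of_real u * (cnj (V i k) * (\<Sum>m\<in>I. Z i m * g m j) * W j l)" for i j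
      by (simp only: right_diff_distrib left_diff_distrib mult_ac)
    then show ?thesis unfolding mixed_def by (simp only: sum_subtractf sum_distrib_left)
  qed
  have "var_form I u f g Z = Re (\<Sum>k\<in>I. \<Sum>l\<in>I. cnj (mixed I V W Z k l) * mixed I V W ?A k l)"
    unfolding var_form_def parseval_mixed[OF fin spec_onb[OF f] spec_onb[OF g]] ..
  also have "\<dots> = (\<Sum>k\<in>I. \<Sum>l\<in>I. Re (cnj (mixed I V W Z k l) * mixed I V W ?A k l))" by simp
  also have "\<dots> = (\<Sum>k\<in>I. \<Sum>l\<in>I. 2 * (r k - s l) * Re (cnj (mixed I V W Z k l) * overlap I V W k l)
      - ((1 - u) * r k + u * s l) * (cmod (mixed I V W Z k l))\<^sup>2)"
  proof (intro sum.cong refl)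
    fix k l assume kl: "k \<in> I" "l \<in> I"
    show "Re (cnj (mixed I V W Z k l) * mixed I V W ?A k l) = 2 * (r k - s l) * Re (cnj (mixed I V W Z k l) * overlap I V W k l)
      - ((1 - u) * r k + u * s l) * (cmod (mixed I V W Z k l))\<^sup>2"
      unfolding lin mixed_left[OF fin f kl(1)] mixed_right[OF fin g kl(2)] mixed_spec[OF fin f g kl] cmod_power2
      by (simp add: power2_eq_square algebra_simps)
  qed
  finally show ?thesis .
qed

lemma quad_bound:
  fixes A B g :: real
  assumes "0 < g"
  shows "2 * (A * B) - g * A\<^sup>2 \<le> B\<^sup>2 / g"
proof -
  have "g * (2 * (A * B) - g * A\<^sup>2) \<le> B\<^sup>2"
    using zero_le_power2[of "g * A - B"] by (simp add: power2_eq_square algebra_simps)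
  then show ?thesis using assms by (simp add: field_simps)
qed

lemma convex_comb_pos:
  fixes u :: real
  assumes "0 < u" "u < 1" "0 \<le> a" "0 \<le> b"
  shows "(1 - u) * a + u * b > 0 \<or> a = 0 \<and> b = 0"
  using assms by (metis add_nonneg_pos add_pos_nonneg diff_gt_0_iff_gt less_eq_real_def mult_nonneg_nonneg mult_pos_pos)

lemma var_form_le:
  assumes fin: "finite I" and f: "spec I f r V" and g: "spec I g s W"
    and r: "\<And>k. k \<in> I \<Longrightarrow> 0 \<le> r k" and s: "\<And>k. k \<in> I \<Longrightarrow> 0 \<le> s k" and u: "0 < u" "u < 1"
  shows "var_form I u f g Z \<le> rel_quad I r V s W u"
  unfolding var_form_spec[OF fin f g] rel_quad_def
proof (intro sum_mono)
  fix k l assume kl: "k \<in> I" "l \<in> I"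
  let ?g = "(1 - u) * r k + u * s l" and ?z = "mixed I V W Z k l" and ?x = "overlap I V W k l"
  consider "?g > 0" | "r k = 0" "s l = 0" using convex_comb_pos[OF u r[OF kl(1)] s[OF kl(2)]] by auto
  then show "2 * (r k - s l) * Re (cnj ?z * ?x) - ?g * (cmod ?z)\<^sup>2 \<le> (cmod ?x)\<^sup>2 * ((r k - s l)\<^sup>2 / ?g)"
  proof cases
    case 1
    have "(r k - s l) * Re (cnj ?z * ?x) \<le> \<bar>r k - s l\<bar> * \<bar>Re (cnj ?z * ?x)\<bar>"
      by (metis abs_ge_self abs_mult)
    also have "\<dots> \<le> \<bar>r k - s l\<bar> * (cmod ?z * cmod ?x)"
      using abs_Re_le_cmod[of "cnj ?z * ?x"] by (intro mult_left_mono) (simp_all add: norm_mult)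
    finally have "2 * ((r k - s l) * Re (cnj ?z * ?x)) \<le> 2 * (cmod ?z * (\<bar>r k - s l\<bar> * cmod ?x))"
      by (simp only: mult.left_commute)
    then have "2 * (r k - s l) * Re (cnj ?z * ?x) - ?g * (cmod ?z)\<^sup>2
        \<le> 2 * (cmod ?z * (\<bar>r k - s l\<bar> * cmod ?x)) - ?g * (cmod ?z)\<^sup>2"
      by (simp only: mult.assoc diff_right_mono)
    also have "\<dots> \<le> (\<bar>r k - s l\<bar> * cmod ?x)\<^sup>2 / ?g" by (rule quad_bound[OF 1])
    finally show ?thesis by (simp add: power_mult_distrib mult.commute)
  qed simp
qed

lemma var_form_attained:
  assumes fin: "finite I" and f: "spec I f r V" and g: "spec I g s W"
    and r: "\<And>k. k \<in> I \<Longrightarrow> 0 \<le> r k" and s: "\<And>k. k \<in> I \<Longrightarrow> 0 \<le> s k" and u: "0 < u" "u < 1"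
  obtains Z where "var_form I u f g Z = rel_quad I r V s W u"
proof -
  \<comment> \<open>The vertex of every parabola; \<open>Z\<close> is the operator with these
    entries in the mixed basis.\<close>
  define z where "z k l = of_real ((r k - s l) / ((1 - u) * r k + u * s l)) * overlap I V W k l" for k l
  define Z where "Z i j = (\<Sum>k\<in>I. \<Sum>l\<in>I. V i k * z k l * cnj (W j l))" for i j
  have mz: "mixed I V W Z k l = z k l" if kl: "k \<in> I" "l \<in> I" for k l
  proof -
    have "(\<Sum>j\<in>I. Z i j * W j l) = (\<Sum>k\<in>I. V i k * z k l)" for i
    proof -
      have "(\<Sum>j\<in>I. Z i j * W j l) = (\<Sum>j\<in>I. \<Sum>k'\<in>I. \<Sum>l'\<in>I. V i k' * z k' l' * (cnj (W j l') * W j l))"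
        unfolding Z_def sum_distrib_right by (simp only: mult_ac)
      also have "\<dots> = (\<Sum>k'\<in>I. \<Sum>l'\<in>I. \<Sum>j\<in>I. V i k' * z k' l' * (cnj (W j l') * W j l))"
        by (rule sum_swap3)
      also have "\<dots> = (\<Sum>k'\<in>I. \<Sum>l'\<in>I. V i k' * z k' l' * of_bool (l' = l))"
        by (intro sum.cong refl) (simp only: sum_distrib_left[symmetric] onb_cols[OF spec_onb[OF g] _ kl(2)])
      also have "\<dots> = (\<Sum>k'\<in>I. V i k' * z k' l)" using fin kl by (simp only: sum_delta_simps)
      finally show ?thesis .
    qed
    then have "mixed I V W Z k l = (\<Sum>i\<in>I. \<Sum>k'\<in>I. z k' l * (cnj (V i k) * V i k'))"
      unfolding mixed_def mult.assoc sum_distrib_left[symmetric] by (simp only: sum_distrib_left mult_ac)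
    also have "\<dots> = (\<Sum>k'\<in>I. \<Sum>i\<in>I. z k' l * (cnj (V i k) * V i k'))" by (rule sum.swap)
    also have "\<dots> = (\<Sum>k'\<in>I. z k' l * of_bool (k = k'))"
      by (intro sum.cong refl) (simp only: sum_distrib_left[symmetric] onb_cols[OF spec_onb[OF f] kl(1)])
    also have "\<dots> = z k l" using fin kl by (simp only: sum_delta_simps)
    finally show ?thesis .
  qed
  have "var_form I u f g Z = rel_quad I r V s W u"
    unfolding var_form_spec[OF fin f g] rel_quad_def
  proof (intro sum.cong refl)
    fix k l assume kl: "k \<in> I" "l \<in> I"
    let ?g = "(1 - u) * r k + u * s l" and ?x = "overlap I V W k l"
    consider "?g > 0" | "r k = 0" "s l = 0" using convex_comb_pos[OF u r[OF kl(1)] s[OF kl(2)]] by auto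
    then show "2 * (r k - s l) * Re (cnj (mixed I V W Z k l) * ?x) - ?g * (cmod (mixed I V W Z k l))\<^sup>2
       = (cmod ?x)\<^sup>2 * ((r k - s l)\<^sup>2 / ?g)"
    proof cases
      case 1
      define t where "t = (r k - s l) / ?g"
      have t: "r k - s l = t * ?g" using 1 by (simp add: t_def)
      have "Re (cnj (z k l) * ?x) = t * (cmod ?x)\<^sup>2" "(cmod (z k l))\<^sup>2 = t\<^sup>2 * (cmod ?x)\<^sup>2"
        unfolding z_def t_def[symmetric] cmod_power2 by (simp_all add: power2_eq_square algebra_simps norm_mult)
      then show ?thesis unfolding mz[OF kl] t using 1 by (simp add: power2_eq_square)
    qed simp
  qed
  then show thesis by (rule that)
qed

text \<open>Take the \<open>Z\<close> that is optimal for the sums: at it the functional is additive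
  over \<open>Y\<close>, and each summand is at most its own supremum.\<close>

lemma rel_quad_convex:
  assumes fin: "finite I" and fY: "finite Y"
    and f: "spec I f r V" and g: "spec I g s W"
    and fy: "\<And>y. y \<in> Y \<Longrightarrow> spec I (f' y) (r' y) (V' y)" and gy: "\<And>y. y \<in> Y \<Longrightarrow> spec I (g' y) (s' y) (W' y)"
    and fs: "\<And>i j. i \<in> I \<Longrightarrow> j \<in> I \<Longrightarrow> f i j = (\<Sum>y\<in>Y. f' y i j)"
    and gs: "\<And>i j. i \<in> I \<Longrightarrow> j \<in> I \<Longrightarrow> g i j = (\<Sum>y\<in>Y. g' y i j)"
    and r: "\<And>k. k \<in> I \<Longrightarrow> 0 \<le> r k" and s: "\<And>k. k \<in> I \<Longrightarrow> 0 \<le> s k"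
    and r': "\<And>y k. y \<in> Y \<Longrightarrow> k \<in> I \<Longrightarrow> 0 \<le> r' y k" and s': "\<And>y k. y \<in> Y \<Longrightarrow> k \<in> I \<Longrightarrow> 0 \<le> s' y k"
    and u: "0 < u" "u < 1"
  shows "rel_quad I r V s W u \<le> (\<Sum>y\<in>Y. rel_quad I (r' y) (V' y) (s' y) (W' y) u)"
proof -
  obtain Z where Z: "var_form I u f g Z = rel_quad I r V s W u"
    by (rule var_form_attained[OF fin f g r s u])
  have "var_form I u f g Z = (\<Sum>y\<in>Y. var_form I u (f' y) (g' y) Z)"
  proof -
    have "cnj (Z i j) * (2 * f i j - 2 * g i j - of_real (1 - u) * (\<Sum>m\<in>I. f i m * Z m j) - of_real u * (\<Sum>m\<in>I. Z i m * g m j))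
       = (\<Sum>y\<in>Y. cnj (Z i j) * (2 * f' y i j - 2 * g' y i j - of_real (1 - u) * (\<Sum>m\<in>I. f' y i m * Z m j) - of_real u * (\<Sum>m\<in>I. Z i m * g' y m j)))"
      if ij: "i \<in> I" "j \<in> I" for i j
    proof -
      have "(\<Sum>m\<in>I. f i m * Z m j) = (\<Sum>m\<in>I. \<Sum>y\<in>Y. f' y i m * Z m j)"
        by (intro sum.cong refl) (simp only: fs ij sum_distrib_right)
      also have "\<dots> = (\<Sum>y\<in>Y. \<Sum>m\<in>I. f' y i m * Z m j)" by (rule sum.swap)
      finally have 1: "(\<Sum>m\<in>I. f i m * Z m j) = (\<Sum>y\<in>Y. \<Sum>m\<in>I. f' y i m * Z m j)" .
      have "(\<Sum>m\<in>I. Z i m * g m j) = (\<Sum>m\<in>I. \<Sum>y\<in>Y. Z i m * g' y m j)"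
        by (intro sum.cong refl) (simp only: gs ij sum_distrib_left)
      also have "\<dots> = (\<Sum>y\<in>Y. \<Sum>m\<in>I. Z i m * g' y m j)" by (rule sum.swap)
      finally have 2: "(\<Sum>m\<in>I. Z i m * g m j) = (\<Sum>y\<in>Y. \<Sum>m\<in>I. Z i m * g' y m j)" .
      show ?thesis unfolding 1 2 fs[OF ij] gs[OF ij]
        by (simp only: sum_distrib_left[symmetric] sum_subtractf)
    qed
    then have "(\<Sum>i\<in>I. \<Sum>j\<in>I. cnj (Z i j) * (2 * f i j - 2 * g i j - of_real (1 - u) * (\<Sum>m\<in>I. f i m * Z m j) - of_real u * (\<Sum>m\<in>I. Z i m * g m j)))
       = (\<Sum>i\<in>I. \<Sum>j\<in>I. \<Sum>y\<in>Y. cnj (Z i j) * (2 * f' y i j - 2 * g' y i j - of_real (1 - u) * (\<Sum>m\<in>I. f' y i m * Z m j) - of_real u * (\<Sum>m\<in>I. Z i m * g' y m j)))"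
      by (intro sum.cong refl) blast
    then show ?thesis unfolding var_form_def Re_sum[of _ Y, symmetric] sum_swap3[of _ _ _ Y] by (simp only:)
  qed
  also have "\<dots> \<le> (\<Sum>y\<in>Y. rel_quad I (r' y) (V' y) (s' y) (W' y) u)"
    by (intro sum_mono var_form_le[OF fin fy gy r' s' u])
  finally show ?thesis unfolding Z .
qed

section \<open>The integral representation of the relative entropy\<close>

definition rel_term :: "real \<Rightarrow> real \<Rightarrow> real" where
  "rel_term r s = r * ln r - r * ln s - r + s"

text \<open>The linear terms \<open>- r + s\<close> are what turns the scalar relative entropy into
  an integral of squares with nonnegative weights. The last assumption excludes
  \<open>s = 0 < r\<close>, where the true value is infinite.\<close>

lemma rel_term_integral:
  assumes "0 \<le> r" "0 \<le> s" "s = 0 \<Longrightarrow> r = 0"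
  shows "((\<lambda>u. u * ((r - s)\<^sup>2 / ((1 - u) * r + u * s))) has_integral rel_term r s) {0..1}"
proof -
  consider "r = 0" "s = 0" | "r = 0" "s > 0" | "r > 0" "s > 0" using assms by linarith
  then show ?thesis
  proof cases
    case 2
    \<comment> \<open>For \<open>r = 0\<close> the integrand is the constant \<open>s\<close>,
      except at the single point \<open>u = 0\<close>, where it is 0.\<close>
    have "((\<lambda>u::real. s) has_integral s) {0..1}" using has_integral_const_real[of s 0 1] by simp
    then have "((\<lambda>u. u * ((r - s)\<^sup>2 / ((1 - u) * r + u * s))) has_integral s) {0..1}"
      by (rule has_integral_spike_finite[of "{0}", rotated 2]) (use 2 in \<open>auto simp: power2_eq_square\<close>)
    then show ?thesis using 2 by (simp add: rel_term_def)
  next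
    case 3
    \<comment> \<open>With \<open>g\<close> the denominator, \<open>g - r = u * (s - r)\<close>, so
      the integrand equals \<open>(s - r) - r * ((s - r) / g)\<close>; \<open>G\<close> is its
      antiderivative.\<close>
    define G where "G u = u * (s - r) - r * ln ((1 - u) * r + u * s)" for u
    have "((\<lambda>u. u * ((r - s)\<^sup>2 / ((1 - u) * r + u * s))) has_integral G 1 - G 0) {0..1}"
    proof (rule fundamental_theorem_of_calculus)
      fix u :: real assume u: "u \<in> {0..1}"
      have p: "(1 - u) * r + u * s > 0"
      proof (cases "u = 0")
        case False
        then have "u * s > 0" "(1 - u) * r \<ge> 0" using u 3 by auto
        then show ?thesis by linarith
      qed (use 3 in simp)
      have "(G has_real_derivative (s - r) - r * ((s - r) / ((1 - u) * r + u * s))) (at u)"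
        unfolding G_def using p by (auto intro!: derivative_eq_intros simp: field_simps)
      also have "(s - r) - r * ((s - r) / ((1 - u) * r + u * s)) = u * ((r - s)\<^sup>2 / ((1 - u) * r + u * s))"
      proof -
        define g where "g = (1 - u) * r + u * s"
        have "g > 0" "g - r = u * (s - r)" using p by (auto simp: g_def algebra_simps)
        then have "(s - r) - r * ((s - r) / g) = (s - r) * (g - r) / g" by (simp add: field_simps)
        also have "\<dots> = u * ((r - s)\<^sup>2 / g)" unfolding \<open>g - r = _\<close> by (simp add: power2_eq_square algebra_simps)
        finally show ?thesis unfolding g_def .
      qed
      finally show "(G has_vector_derivative u * ((r - s)\<^sup>2 / ((1 - u) * r + u * s))) (at u within {0..1})"
        by (simp add: has_real_derivative_iff_has_vector_derivative has_vector_derivative_at_within)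
    qed simp
    then show ?thesis by (simp add: G_def rel_term_def algebra_simps)
  qed (simp add: rel_term_def)
qed

text \<open>Umegaki relative entropy in nats, \<open>Tr f (ln f - ln g) - Tr f + Tr g\<close>,
  written through the overlaps of the two eigenbases.\<close>

definition rel_ent :: "'i set \<Rightarrow> ('i \<Rightarrow> real) \<Rightarrow> 'i op \<Rightarrow> ('i \<Rightarrow> real) \<Rightarrow> 'i op \<Rightarrow> real" where
  "rel_ent I r V s W = (\<Sum>k\<in>I. \<Sum>l\<in>I. (cmod (overlap I V W k l))\<^sup>2 * rel_term (r k) (s l))"

text \<open>Besides positivity, the inclusion of the support of \<open>f\<close> in that of
  \<open>g\<close>, read off the eigenvectors; it rules out the pairs that make the relative entropy
  infinite.\<close>

definition supp_le :: "'i set \<Rightarrow> ('i \<Rightarrow> real) \<Rightarrow> 'i op \<Rightarrow> ('i \<Rightarrow> real) \<Rightarrow> 'i op \<Rightarrow> bool" where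
  "supp_le I r V s W \<longleftrightarrow> (\<forall>k\<in>I. 0 \<le> r k \<and> 0 \<le> s k) \<and>
     (\<forall>k\<in>I. \<forall>l\<in>I. s l = 0 \<longrightarrow> r k = 0 \<or> overlap I V W k l = 0)"

lemma rel_ent_integral:
  assumes fin: "finite I" and sp: "supp_le I r V s W"
  shows "((\<lambda>u. u * rel_quad I r V s W u) has_integral rel_ent I r V s W) {0..1}"
proof -
  have "((\<lambda>u. (cmod (overlap I V W k l))\<^sup>2 * (u * ((r k - s l)\<^sup>2 / ((1 - u) * r k + u * s l))))
      has_integral (cmod (overlap I V W k l))\<^sup>2 * rel_term (r k) (s l)) {0..1}" if "k \<in> I" "l \<in> I" for k l
  proof (cases "overlap I V W k l = 0")
    case False
    show ?thesis
      by (intro has_integral_mult_right rel_term_integral) (use sp that False in \<open>auto simp: supp_le_def\<close>)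
  qed simp
  then have "((\<lambda>u. \<Sum>k\<in>I. \<Sum>l\<in>I. (cmod (overlap I V W k l))\<^sup>2 * (u * ((r k - s l)\<^sup>2 / ((1 - u) * r k + u * s l))))
      has_integral rel_ent I r V s W) {0..1}"
    unfolding rel_ent_def by (intro has_integral_sum fin)
  then show ?thesis unfolding rel_quad_def sum_distrib_left by (simp only: mult.left_commute)
qed

text \<open>The pointwise inequality is integrated against the weight \<open>u\<close>. Plain sums
  replace convex combinations, since the relative entropy is homogeneous.\<close>

lemma rel_ent_convex:
  assumes fin: "finite I" and fY: "finite Y"
    and f: "spec I f r V" and g: "spec I g s W"
    and fy: "\<And>y. y \<in> Y \<Longrightarrow> spec I (f' y) (r' y) (V' y)" and gy: "\<And>y. y \<in> Y \<Longrightarrow> spec I (g' y) (s' y) (W' y)"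
    and fs: "\<And>i j. i \<in> I \<Longrightarrow> j \<in> I \<Longrightarrow> f i j = (\<Sum>y\<in>Y. f' y i j)"
    and gs: "\<And>i j. i \<in> I \<Longrightarrow> j \<in> I \<Longrightarrow> g i j = (\<Sum>y\<in>Y. g' y i j)"
    and sp: "supp_le I r V s W" and sp': "\<And>y. y \<in> Y \<Longrightarrow> supp_le I (r' y) (V' y) (s' y) (W' y)"
  shows "rel_ent I r V s W \<le> (\<Sum>y\<in>Y. rel_ent I (r' y) (V' y) (s' y) (W' y))"
proof -
  \<comment> \<open>At an endpoint a denominator can vanish for one zero eigenvalue alone, so the
    comparison is made only in the interior; the endpoints do not affect the integral.\<close>
  have 1: "((\<lambda>u. u * rel_quad I r V s W u) has_integral rel_ent I r V s W) {0<..<1}"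
    using rel_ent_integral[OF fin sp] by (simp add: has_integral_Icc_iff_Ioo)
  have "((\<lambda>u. \<Sum>y\<in>Y. u * rel_quad I (r' y) (V' y) (s' y) (W' y) u) has_integral (\<Sum>y\<in>Y. rel_ent I (r' y) (V' y) (s' y) (W' y))) {0..1}"
    using sp' by (intro has_integral_sum fY rel_ent_integral[OF fin])
  then have 2: "((\<lambda>u. \<Sum>y\<in>Y. u * rel_quad I (r' y) (V' y) (s' y) (W' y) u) has_integral (\<Sum>y\<in>Y. rel_ent I (r' y) (V' y) (s' y) (W' y))) {0<..<1}"
    by (simp add: has_integral_Icc_iff_Ioo)
  show ?thesis
  proof (rule has_integral_le[OF 1 2])
    fix u :: real assume u: "u \<in> {0<..<1}"
    have "rel_quad I r V s W u \<le> (\<Sum>y\<in>Y. rel_quad I (r' y) (V' y) (s' y) (W' y) u)"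
      using sp sp' u by (intro rel_quad_convex[OF fin fY f g fy gy fs gs]) (auto simp: supp_le_def)
    then show "u * rel_quad I r V s W u \<le> (\<Sum>y\<in>Y. u * rel_quad I (r' y) (V' y) (s' y) (W' y) u)"
      unfolding sum_distrib_left[symmetric] using u by (intro mult_left_mono) auto
  qed
qed

lemma rel_ent_nonneg:
  assumes fin: "finite I" and sp: "supp_le I r V s W"
  shows "0 \<le> rel_ent I r V s W"
proof (rule has_integral_nonneg[OF rel_ent_integral[OF fin sp]])
  fix u :: real assume "u \<in> {0..1}"
  then show "0 \<le> u * rel_quad I r V s W u"
    using sp unfolding rel_quad_def by (intro mult_nonneg_nonneg sum_nonneg) (auto simp: supp_le_def)
qed

lemma overlap_sums:
  assumes fin: "finite I" and V: "onb I V" and W: "onb I W"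
  shows "k \<in> I \<Longrightarrow> (\<Sum>l\<in>I. (cmod (overlap I V W k l))\<^sup>2) = 1"
    and "l \<in> I \<Longrightarrow> (\<Sum>k\<in>I. (cmod (overlap I V W k l))\<^sup>2) = 1"
proof -
  assume k: "k \<in> I"
  have "complex_of_real (\<Sum>i\<in>I. (cmod (cnj (V i k)))\<^sup>2) = 1"
    unfolding of_real_sum complex_norm_square using onb_cols[OF V k k] by simp
  then have "(\<Sum>i\<in>I. (cmod (cnj (V i k)))\<^sup>2) = 1" by (simp only: of_real_eq_1_iff)
  then show "(\<Sum>l\<in>I. (cmod (overlap I V W k l))\<^sup>2) = 1" unfolding overlap_def
    using sum_cmod2_onb[OF fin onb_cnj[OF W], of "\<lambda>i. cnj (V i k)"] by (simp add: mult.commute)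
next
  assume l: "l \<in> I"
  have "complex_of_real (\<Sum>i\<in>I. (cmod (W i l))\<^sup>2) = 1"
    unfolding of_real_sum complex_norm_square using onb_cols'[OF W l l] by simp
  then have "(\<Sum>i\<in>I. (cmod (W i l))\<^sup>2) = 1" by (simp only: of_real_eq_1_iff)
  then show "(\<Sum>k\<in>I. (cmod (overlap I V W k l))\<^sup>2) = 1" unfolding overlap_def
    using sum_cmod2_onb[OF fin V, of "\<lambda>i. W i l"] by simp
qed

definition diag_in :: "'i set \<Rightarrow> 'i op \<Rightarrow> 'i op \<Rightarrow> 'i \<Rightarrow> real" where
  "diag_in I f W l = Re (\<Sum>i\<in>I. \<Sum>j\<in>I. cnj (W i l) * f i j * W j l)"

lemma diag_in_spec:
  assumes "finite I" "spec I f r V"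
  shows "diag_in I f W l = (\<Sum>k\<in>I. r k * (cmod (overlap I V W k l))\<^sup>2)"
  unfolding diag_in_def overlap_def by (simp only: spec_form[OF assms] Re_complex_of_real)

lemma supp_leI:
  assumes fin: "finite I" and f: "spec I f r V"
    and r: "\<And>k. k \<in> I \<Longrightarrow> 0 \<le> r k" and s: "\<And>k. k \<in> I \<Longrightarrow> 0 \<le> s k"
    and z: "\<And>l. l \<in> I \<Longrightarrow> s l = 0 \<Longrightarrow> diag_in I f W l = 0"
  shows "supp_le I r V s W"
  unfolding supp_le_def
proof (intro conjI ballI impI r s)
  fix k l assume kl: "k \<in> I" "l \<in> I" "s l = 0"
  then have "(\<Sum>k\<in>I. r k * (cmod (overlap I V W k l))\<^sup>2) = 0"
    using z[OF kl(2,3)] by (simp only: diag_in_spec[OF fin f])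
  then have "r k * (cmod (overlap I V W k l))\<^sup>2 = 0"
    using fin r kl(1) by (subst (asm) sum_nonneg_eq_0_iff) auto
  then show "r k = 0 \<or> overlap I V W k l = 0" by simp
qed

text \<open>\<open>Tr f ln g\<close> sees only the diagonal of \<open>f\<close> in the eigenbasis of
  \<open>g\<close>; the remaining terms simplify because the squared overlaps are doubly
  stochastic.\<close>

lemma rel_ent_formula:
  assumes fin: "finite I" and f: "spec I f r V" and g: "spec I g s W"
  shows "rel_ent I r V s W = (\<Sum>k\<in>I. r k * ln (r k)) - (\<Sum>l\<in>I. diag_in I f W l * ln (s l)) - (\<Sum>k\<in>I. r k) + (\<Sum>l\<in>I. s l)"
proof -
  note os = overlap_sums[OF fin spec_onb[OF f] spec_onb[OF g]]
  let ?m = "\<lambda>k l. (cmod (overlap I V W k l))\<^sup>2"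
  have "rel_ent I r V s W = (\<Sum>k\<in>I. \<Sum>l\<in>I. ?m k l * (r k * ln (r k)) - r k * ?m k l * ln (s l) - ?m k l * r k + ?m k l * s l)"
    unfolding rel_ent_def rel_term_def by (simp add: algebra_simps)
  also have "\<dots> = (\<Sum>k\<in>I. \<Sum>l\<in>I. ?m k l * (r k * ln (r k))) - (\<Sum>k\<in>I. \<Sum>l\<in>I. r k * ?m k l * ln (s l))
     - (\<Sum>k\<in>I. \<Sum>l\<in>I. ?m k l * r k) + (\<Sum>k\<in>I. \<Sum>l\<in>I. ?m k l * s l)"
    by (simp only: sum.distrib sum_subtractf)
  also have "(\<Sum>k\<in>I. \<Sum>l\<in>I. r k * ?m k l * ln (s l)) = (\<Sum>l\<in>I. diag_in I f W l * ln (s l))"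
    unfolding diag_in_spec[OF fin f] sum_distrib_right by (rule sum.swap)
  also have "(\<Sum>k\<in>I. \<Sum>l\<in>I. ?m k l * s l) = (\<Sum>l\<in>I. \<Sum>k\<in>I. ?m k l * s l)" by (rule sum.swap)
  finally show ?thesis by (simp add: sum_distrib_right[symmetric] os)
qed

section \<open>Concavity of the conditional entropy\<close>

definition ptrace1 :: "'a set \<Rightarrow> (('a \<times> 'b) op) \<Rightarrow> 'b \<Rightarrow> 'b \<Rightarrow> complex" where
  "ptrace1 A f b b' = (\<Sum>a\<in>A. f (a, b) (a, b'))"

definition ptrace2 :: "'b set \<Rightarrow> (('a \<times> 'b) op) \<Rightarrow> 'a \<Rightarrow> 'a \<Rightarrow> complex" where
  "ptrace2 B f a a' = (\<Sum>b\<in>B. f (a, b) (a', b))"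

lemma Ent_ln:
  assumes fin: "finite I" and s: "spec I f e V" and e: "\<And>k. k \<in> I \<Longrightarrow> 0 \<le> e k"
  shows "(\<Sum>k\<in>I. e k * ln (e k)) = - ln 2 * Ent I f"
proof -
  have "ln 2 * eta (e k) = - (e k * ln (e k))" if "k \<in> I" for k
    using e[OF that] by (auto simp: eta_def log_def)
  then show ?thesis unfolding Ent_eq[OF fin s] by (simp add: sum_distrib_left sum_negf[symmetric])
qed

lemma psd_on_ptrace1:
  assumes fin: "finite A" "finite B" and f: "psd_on (A \<times> B) f"
  shows "psd_on B (ptrace1 A f)"
proof -
  obtain \<Phi> where \<Phi>: "gram_on (A \<times> B) (A \<times> B) f \<Phi>"
    using psd_on_imp_gram[OF finite_cartesian_product[OF fin] f] ..
  show ?thesis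
    by (rule psd_on_gram[where R = "A \<times> (A \<times> B)" and \<Phi> = "\<lambda>b p. \<Phi> (fst p, b) (snd p)"])
       (simp add: ptrace1_def \<Phi> sum_Times[of _ A])
qed

lemma psd_on_ptrace2:
  assumes fin: "finite A" "finite B" and f: "psd_on (A \<times> B) f"
  shows "psd_on A (ptrace2 B f)"
proof -
  obtain \<Phi> where \<Phi>: "gram_on (A \<times> B) (A \<times> B) f \<Phi>"
    using psd_on_imp_gram[OF finite_cartesian_product[OF fin] f] ..
  show ?thesis
    by (rule psd_on_gram[where R = "B \<times> (A \<times> B)" and \<Phi> = "\<lambda>a p. \<Phi> (a, fst p) (snd p)"])
       (simp add: ptrace2_def \<Phi> sum_Times[of _ B])
qed

lemma trace_onb:
  assumes fin: "finite I" and V: "onb I V"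
  shows "(\<Sum>k\<in>I. \<Sum>i\<in>I. \<Sum>j\<in>I. cnj (V i k) * G i j * V j k) = (\<Sum>i\<in>I. G i i)"
proof -
  have "(\<Sum>k\<in>I. \<Sum>i\<in>I. \<Sum>j\<in>I. cnj (V i k) * G i j * V j k) = (\<Sum>i\<in>I. \<Sum>j\<in>I. \<Sum>k\<in>I. cnj (V i k) * G i j * V j k)"
    by (rule sum_swap3)
  also have "\<dots> = (\<Sum>i\<in>I. \<Sum>j\<in>I. G i j * (\<Sum>k\<in>I. cnj (V i k) * V j k))"
    unfolding sum_distrib_left by (simp only: mult_ac)
  also have "\<dots> = (\<Sum>i\<in>I. \<Sum>j\<in>I. G i j * of_bool (i = j))"
    by (intro sum.cong refl) (simp only: onb_rows'[OF V])
  also have "\<dots> = (\<Sum>i\<in>I. G i i)"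
    using fin by (intro sum.cong refl) (simp only: sum_delta_simps)
  finally show ?thesis .
qed

text \<open>Summing over a complete basis of one factor traces that factor out. This is how
  entropies of marginals are recognised inside \<open>Tr f ln g\<close> when \<open>g\<close> is a
  product.\<close>

lemma diag_in_tensor_sum:
  fixes f :: "('a \<times> 'b) op"
  assumes fin: "finite A" "finite B"
  defines "W \<equiv> \<lambda>Wa Wb (p :: 'a \<times> 'b) (k :: 'a \<times> 'b). Wa (fst p) (fst k) * Wb (snd p) (snd k)"
  shows "onb A Wa \<Longrightarrow> (\<Sum>k\<in>A. diag_in (A \<times> B) f (W Wa Wb) (k, l)) = diag_in B (ptrace1 A f) Wb l"
    and "onb B Wb \<Longrightarrow> (\<Sum>l\<in>B. diag_in (A \<times> B) f (W Wa Wb) (k, l)) = diag_in A (ptrace2 B f) Wa k"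
proof -
  assume Wa: "onb A Wa"
  define G where "G a a' = (\<Sum>b\<in>B. \<Sum>b'\<in>B. cnj (Wb b l) * f (a, b) (a', b') * Wb b' l)" for a a'
  have "(\<Sum>p\<in>A \<times> B. \<Sum>q\<in>A \<times> B. cnj (W Wa Wb p (k, l)) * f p q * W Wa Wb q (k, l))
     = (\<Sum>a\<in>A. \<Sum>a'\<in>A. cnj (Wa a k) * G a a' * Wa a' k)" for k
  proof -
    have "(\<Sum>p\<in>A \<times> B. \<Sum>q\<in>A \<times> B. cnj (W Wa Wb p (k, l)) * f p q * W Wa Wb q (k, l))
      = (\<Sum>a\<in>A. \<Sum>b\<in>B. \<Sum>a'\<in>A. \<Sum>b'\<in>B. cnj (Wa a k) * (cnj (Wb b l) * f (a, b) (a', b') * Wb b' l) * Wa a' k)"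
      unfolding sum_Times W_def by (simp add: mult_ac)
    also have "\<dots> = (\<Sum>a\<in>A. \<Sum>a'\<in>A. \<Sum>b\<in>B. \<Sum>b'\<in>B. cnj (Wa a k) * (cnj (Wb b l) * f (a, b) (a', b') * Wb b' l) * Wa a' k)"
      by (intro sum.cong refl sum.swap)
    finally show ?thesis unfolding G_def sum_distrib_left sum_distrib_right .
  qed
  then have "(\<Sum>k\<in>A. diag_in (A \<times> B) f (W Wa Wb) (k, l)) = Re (\<Sum>a\<in>A. G a a)"
    unfolding diag_in_def Re_sum[of _ A, symmetric] by (simp only: trace_onb[OF fin(1) Wa])
  also have "(\<Sum>a\<in>A. G a a) = (\<Sum>b\<in>B. \<Sum>b'\<in>B. cnj (Wb b l) * ptrace1 A f b b' * Wb b' l)"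
    unfolding G_def ptrace1_def sum_distrib_left sum_distrib_right by (rule sum_swap3)
  finally show "(\<Sum>k\<in>A. diag_in (A \<times> B) f (W Wa Wb) (k, l)) = diag_in B (ptrace1 A f) Wb l"
    unfolding diag_in_def .
next
  assume Wb: "onb B Wb"
  define G where "G b b' = (\<Sum>a\<in>A. \<Sum>a'\<in>A. cnj (Wa a k) * f (a, b) (a', b') * Wa a' k)" for b b'
  have "(\<Sum>p\<in>A \<times> B. \<Sum>q\<in>A \<times> B. cnj (W Wa Wb p (k, l)) * f p q * W Wa Wb q (k, l))
     = (\<Sum>b\<in>B. \<Sum>b'\<in>B. cnj (Wb b l) * G b b' * Wb b' l)" for l
  proof -
    have "(\<Sum>p\<in>A \<times> B. \<Sum>q\<in>A \<times> B. cnj (W Wa Wb p (k, l)) * f p q * W Wa Wb q (k, l))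
      = (\<Sum>a\<in>A. \<Sum>b\<in>B. \<Sum>a'\<in>A. \<Sum>b'\<in>B. cnj (Wb b l) * (cnj (Wa a k) * f (a, b) (a', b') * Wa a' k) * Wb b' l)"
      unfolding sum_Times W_def by (simp add: mult_ac)
    also have "\<dots> = (\<Sum>a\<in>A. \<Sum>b\<in>B. \<Sum>b'\<in>B. \<Sum>a'\<in>A. cnj (Wb b l) * (cnj (Wa a k) * f (a, b) (a', b') * Wa a' k) * Wb b' l)"
      by (intro sum.cong refl sum.swap)
    also have "\<dots> = (\<Sum>b\<in>B. \<Sum>b'\<in>B. \<Sum>a\<in>A. \<Sum>a'\<in>A. cnj (Wb b l) * (cnj (Wa a k) * f (a, b) (a', b') * Wa a' k) * Wb b' l)"
      by (rule sum_swap3)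
    finally show ?thesis unfolding G_def sum_distrib_left sum_distrib_right .
  qed
  then have "(\<Sum>l\<in>B. diag_in (A \<times> B) f (W Wa Wb) (k, l)) = Re (\<Sum>b\<in>B. G b b)"
    unfolding diag_in_def Re_sum[of _ B, symmetric] by (simp only: trace_onb[OF fin(2) Wb])
  also have "(\<Sum>b\<in>B. G b b) = (\<Sum>a\<in>A. \<Sum>a'\<in>A. cnj (Wa a k) * ptrace2 B f a a' * Wa a' k)"
    unfolding G_def ptrace2_def sum_distrib_left sum_distrib_right by (rule sum_swap3)
  finally show "(\<Sum>l\<in>B. diag_in (A \<times> B) f (W Wa Wb) (k, l)) = diag_in A (ptrace2 B f) Wa k"
    unfolding diag_in_def .
qed

lemma diag_in_nonneg: "psd_on I f \<Longrightarrow> 0 \<le> diag_in I f W l"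
  unfolding psd_on_def diag_in_def by (elim conjE allE[of _ "\<lambda>i. W i l"])

lemma diag_in_eigen: "finite I \<Longrightarrow> spec I f e V \<Longrightarrow> l \<in> I \<Longrightarrow> diag_in I f V l = e l"
  unfolding diag_in_def by (simp only: spec_eigenvalue Re_complex_of_real)

lemma tr_on_ptrace:
  "tr_on B (ptrace1 A f) = tr_on (A \<times> B) f" "tr_on A (ptrace2 B f) = tr_on (A \<times> B) f"
proof -
  show "tr_on B (ptrace1 A f) = tr_on (A \<times> B) f"
    unfolding tr_on_def ptrace1_def sum_Times by (subst sum.swap) (rule refl)
  show "tr_on A (ptrace2 B f) = tr_on (A \<times> B) f"
    unfolding tr_on_def ptrace2_def sum_Times ..
qed

lemma spec_id: "finite I \<Longrightarrow> spec I (\<lambda>i j. of_bool (i = j)) (\<lambda>_. 1) (\<lambda>i j. of_bool (i = j))"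
  unfolding spec_def onb_def by (simp add: cnj_of_bool sum_delta_simps del: sum_mult_of_bool_eq sum_of_bool_mult_eq)

text \<open>Up to the factor \<open>ln 2\<close>, minus H(C|D) is the relative entropy of
  \<open>f\<close> to the identity on \<open>C\<close> tensored with the marginal on
  \<open>D\<close>. The linear terms leave \<open>card C - 1\<close> times the trace, because the
  identity has trace \<open>card C\<close>.\<close>

lemma cond_entropy_rel_ent:
  fixes f :: "('c \<times> 'd) op"
  assumes fin: "finite C" "finite D" and f: "psd_on (C \<times> D) f"
  obtains r V s W where "spec (C \<times> D) f r V"
    "spec (C \<times> D) (\<lambda>p q. of_bool (fst p = fst q) * ptrace1 C f (snd p) (snd q)) s W"
    "supp_le (C \<times> D) r V s W"
    "rel_ent (C \<times> D) r V s W = ln 2 * (Ent D (ptrace1 C f) - Ent (C \<times> D) f) + (real (card C) - 1) * tr_on (C \<times> D) f"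
proof -
  have finCD: "finite (C \<times> D)" using fin by simp
  note pt = psd_on_ptrace1[OF fin f]
  obtain r V where f': "spec (C \<times> D) f r V" and r: "\<And>k. k \<in> C \<times> D \<Longrightarrow> 0 \<le> r k"
    by (rule psd_on_spec[OF finCD f]) simp
  obtain s W where g: "spec D (ptrace1 C f) s W" and s: "\<And>k. k \<in> D \<Longrightarrow> 0 \<le> s k"
    by (rule psd_on_spec[OF fin(2) pt]) simp
  \<comment> \<open>The factor 1 is the eigenvalue of the identity, in the shape that
    \<open>spec_tensor\<close> produces.\<close>
  define S where "S k = 1 * s (snd k)" for k :: "'c \<times> 'd"
  define W' :: "('c \<times> 'd) op"
    where "W' p k = of_bool (fst p = fst k) * W (snd p) (snd k)" for p k
  have g': "spec (C \<times> D) (\<lambda>p q. of_bool (fst p = fst q) * ptrace1 C f (snd p) (snd q)) S W'"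
    unfolding S_def W'_def by (rule spec_tensor[OF fin spec_id[OF fin(1)] g])
  have dsum: "(\<Sum>c\<in>C. diag_in (C \<times> D) f W' (c, l)) = s l" if "l \<in> D" for l
    using diag_in_tensor_sum(1)[OF fin spec_onb[OF spec_id[OF fin(1)]], of f W l] diag_in_eigen[OF fin(2) g that]
    unfolding W'_def by simp
  have sp: "supp_le (C \<times> D) r V S W'"
  proof (rule supp_leI[OF finCD f' r])
    fix p assume p: "p \<in> C \<times> D" "S p = 0"
    then obtain c l where cl: "p = (c, l)" "c \<in> C" "l \<in> D" by auto
    then have "(\<Sum>c\<in>C. diag_in (C \<times> D) f W' (c, l)) = 0" using p dsum[of l] by (simp add: S_def)
    then show "diag_in (C \<times> D) f W' p = 0"
      using cl fin diag_in_nonneg[OF f] by (simp add: sum_nonneg_eq_0_iff)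
  qed (use s in \<open>auto simp: S_def\<close>)
  have "(\<Sum>p\<in>C \<times> D. diag_in (C \<times> D) f W' p * ln (S p)) = (\<Sum>c\<in>C. \<Sum>l\<in>D. diag_in (C \<times> D) f W' (c, l) * ln (s l))"
    unfolding sum_Times S_def by simp
  also have "\<dots> = (\<Sum>l\<in>D. (\<Sum>c\<in>C. diag_in (C \<times> D) f W' (c, l)) * ln (s l))"
    unfolding sum_distrib_right by (rule sum.swap)
  also have "\<dots> = - ln 2 * Ent D (ptrace1 C f)"
    using Ent_ln[OF fin(2) g s] dsum by simp
  finally have 1: "(\<Sum>p\<in>C \<times> D. diag_in (C \<times> D) f W' p * ln (S p)) = - ln 2 * Ent D (ptrace1 C f)" .
  have 2: "(\<Sum>p\<in>C \<times> D. S p) = real (card C) * tr_on (C \<times> D) f"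
    unfolding sum_Times S_def using tr_on_spec[OF fin(2) g] by (simp add: tr_on_ptrace)
  have "rel_ent (C \<times> D) r V S W' = ln 2 * (Ent D (ptrace1 C f) - Ent (C \<times> D) f) + (real (card C) - 1) * tr_on (C \<times> D) f"
    unfolding rel_ent_formula[OF finCD f' g'] 1 2 tr_on_spec[OF finCD f', symmetric]
    using Ent_ln[OF finCD f' r] by (simp add: algebra_simps)
  then show thesis using that f' g' sp by blast
qed

text \<open>The second argument of the relative entropy in \<open>cond_entropy_rel_ent\<close>
  depends linearly on \<open>f\<close>, so joint convexity applies; the trace corrections are
  additive and cancel. For subnormalised summands this is concavity of H(C|D).\<close>

theorem cond_entropy_superadditive:
  fixes f :: "'y \<Rightarrow> ('c \<times> 'd) op"
  assumes fin: "finite C" "finite D" "finite Y" and f: "\<And>y. y \<in> Y \<Longrightarrow> psd_on (C \<times> D) (f y)"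
    and F: "\<And>p q. p \<in> C \<times> D \<Longrightarrow> q \<in> C \<times> D \<Longrightarrow> F p q = (\<Sum>y\<in>Y. f y p q)"
  shows "(\<Sum>y\<in>Y. Ent (C \<times> D) (f y) - Ent D (ptrace1 C (f y))) \<le> Ent (C \<times> D) F - Ent D (ptrace1 C F)"
proof -
  have finCD: "finite (C \<times> D)" using fin by simp
  have FP: "psd_on (C \<times> D) F" by (rule psd_on_cong[OF _ psd_on_sum[OF f]]) (simp_all add: F)
  let ?g = "\<lambda>f p q. of_bool (fst p = fst q) * ptrace1 C f (snd p) (snd q)"
  let ?P = "\<lambda>f (r, V, s, W). spec (C \<times> D) f r V \<and> spec (C \<times> D) (?g f) s W \<and> supp_le (C \<times> D) r V s W \<and>
     rel_ent (C \<times> D) r V s W = ln 2 * (Ent D (ptrace1 C f) - Ent (C \<times> D) f) + (real (card C) - 1) * tr_on (C \<times> D) f"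
  have ex: "\<exists>t. ?P h t" if "psd_on (C \<times> D) h" for h
  proof (rule cond_entropy_rel_ent[OF fin(1,2) that])
    fix r V s W
    assume "spec (C \<times> D) h r V" "spec (C \<times> D) (?g h) s W" "supp_le (C \<times> D) r V s W"
      "rel_ent (C \<times> D) r V s W = ln 2 * (Ent D (ptrace1 C h) - Ent (C \<times> D) h) + (real (card C) - 1) * tr_on (C \<times> D) h"
    then have "?P h (r, V, s, W)" by simp
    then show ?thesis ..
  qed
  obtain r V s W where T: "?P F (r, V, s, W)" using ex[OF FP] by auto
  have "\<forall>y\<in>Y. \<exists>t. ?P (f y) t" using ex f by blast
  from bchoice[OF this] obtain t where t: "\<forall>y\<in>Y. ?P (f y) (t y)" ..
  define r' V' s' W' where "r' y = fst (t y)" "V' y = fst (snd (t y))" "s' y = fst (snd (snd (t y)))" "W' y = snd (snd (snd (t y)))" for y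
  have t': "?P (f y) (r' y, V' y, s' y, W' y)" if "y \<in> Y" for y
    using bspec[OF t that] by (simp add: r'_V'_s'_W'_def case_prod_beta)
  have G: "?g F p q = (\<Sum>y\<in>Y. ?g (f y) p q)" if "p \<in> C \<times> D" "q \<in> C \<times> D" for p q
  proof -
    have "ptrace1 C F (snd p) (snd q) = (\<Sum>c\<in>C. \<Sum>y\<in>Y. f y (c, snd p) (c, snd q))"
      unfolding ptrace1_def using that by (intro sum.cong refl F) auto
    also have "\<dots> = (\<Sum>y\<in>Y. ptrace1 C (f y) (snd p) (snd q))" unfolding ptrace1_def by (rule sum.swap)
    finally show ?thesis by (simp only: sum_distrib_left)
  qed
  have "rel_ent (C \<times> D) r V s W \<le> (\<Sum>y\<in>Y. rel_ent (C \<times> D) (r' y) (V' y) (s' y) (W' y))"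
  proof (rule rel_ent_convex[OF finCD fin(3) _ _ _ _ F G])
    show "spec (C \<times> D) F r V" "spec (C \<times> D) (?g F) s W" "supp_le (C \<times> D) r V s W"
      using T by auto
    fix y assume "y \<in> Y"
    from t'[OF this] show "spec (C \<times> D) (f y) (r' y) (V' y)" "spec (C \<times> D) (?g (f y)) (s' y) (W' y)"
      "supp_le (C \<times> D) (r' y) (V' y) (s' y) (W' y)" by auto
  qed
  also have "\<dots> = (\<Sum>y\<in>Y. ln 2 * (Ent D (ptrace1 C (f y)) - Ent (C \<times> D) (f y)) + (real (card C) - 1) * tr_on (C \<times> D) (f y))"
    using t' by (intro sum.cong refl) auto
  also have "\<dots> = - ln 2 * (\<Sum>y\<in>Y. Ent (C \<times> D) (f y) - Ent D (ptrace1 C (f y))) + (real (card C) - 1) * tr_on (C \<times> D) F"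
  proof -
    have "(\<Sum>p\<in>C \<times> D. F p p) = (\<Sum>p\<in>C \<times> D. \<Sum>y\<in>Y. f y p p)" by (intro sum.cong refl F)
    also have "\<dots> = (\<Sum>y\<in>Y. \<Sum>p\<in>C \<times> D. f y p p)" by (rule sum.swap)
    finally have "tr_on (C \<times> D) F = (\<Sum>y\<in>Y. tr_on (C \<times> D) (f y))" unfolding tr_on_def Re_sum[of _ Y, symmetric] by simp
    then show ?thesis by (simp add: sum.distrib sum_subtractf sum_distrib_left[symmetric] algebra_simps)
  qed
  finally have "ln 2 * (\<Sum>y\<in>Y. Ent (C \<times> D) (f y) - Ent D (ptrace1 C (f y))) \<le> ln 2 * (Ent (C \<times> D) F - Ent D (ptrace1 C F))"
    using T by (simp add: algebra_simps)
  then show ?thesis by (rule mult_left_le_imp_le) simp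
qed

text \<open>Nonnegativity of the relative entropy to the product of the marginals; unit trace makes
  its linear terms cancel.\<close>

theorem Ent_subadditive:
  fixes f :: "('a \<times> 'b) op"
  assumes fin: "finite A" "finite B" and f: "psd_on (A \<times> B) f" and t: "tr_on (A \<times> B) f = 1"
  shows "Ent (A \<times> B) f \<le> Ent A (ptrace2 B f) + Ent B (ptrace1 A f)"
proof -
  have finAB: "finite (A \<times> B)" using fin by simp
  obtain r V where f': "spec (A \<times> B) f r V" and r: "\<And>k. k \<in> A \<times> B \<Longrightarrow> 0 \<le> r k"
    by (rule psd_on_spec[OF finAB f]) simp
  obtain a Wa where a': "spec A (ptrace2 B f) a Wa" and a: "\<And>k. k \<in> A \<Longrightarrow> 0 \<le> a k"
    by (rule psd_on_spec[OF fin(1) psd_on_ptrace2[OF fin f]]) simp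
  obtain b Wb where b': "spec B (ptrace1 A f) b Wb" and b: "\<And>k. k \<in> B \<Longrightarrow> 0 \<le> b k"
    by (rule psd_on_spec[OF fin(2) psd_on_ptrace1[OF fin f]]) simp
  define S where "S k = a (fst k) * b (snd k)" for k
  define W :: "('a \<times> 'b) op" where "W p k = Wa (fst p) (fst k) * Wb (snd p) (snd k)" for p k
  have g: "spec (A \<times> B) (\<lambda>p q. ptrace2 B f (fst p) (fst q) * ptrace1 A f (snd p) (snd q)) S W"
    unfolding S_def W_def by (rule spec_tensor[OF fin a' b'])
  let ?d = "\<lambda>k l. diag_in (A \<times> B) f W (k, l)"
  have da: "(\<Sum>l\<in>B. ?d k l) = a k" if "k \<in> A" for k
    using diag_in_tensor_sum(2)[OF fin spec_onb[OF b'], of f Wa k] diag_in_eigen[OF fin(1) a' that]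
    unfolding W_def by simp
  have db: "(\<Sum>k\<in>A. ?d k l) = b l" if "l \<in> B" for l
    using diag_in_tensor_sum(1)[OF fin spec_onb[OF a'], of f Wb l] diag_in_eigen[OF fin(2) b' that]
    unfolding W_def by simp
  have dn: "0 \<le> ?d k l" for k l by (rule diag_in_nonneg[OF f])
  \<comment> \<open>A diagonal entry is at most each of the two marginal eigenvalues. This gives the
    support condition and lets \<open>ln\<close> of the product split although a factor may be
    0.\<close>
  have z: "?d k l = 0" if "k \<in> A" "l \<in> B" "a k = 0 \<or> b l = 0" for k l
  proof -
    have "?d k l \<le> a k" using member_le_sum[of l B "?d k"] dn fin that by (simp add: da)
    moreover have "?d k l \<le> b l" using member_le_sum[of k A "\<lambda>k. ?d k l"] dn fin that by (simp add: db)
    ultimately show ?thesis using dn[of k l] that(3) by auto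
  qed
  have sp: "supp_le (A \<times> B) r V S W"
    by (rule supp_leI[OF finAB f' r]) (use a b z in \<open>auto simp: S_def\<close>)
  have "(\<Sum>p\<in>A \<times> B. diag_in (A \<times> B) f W p * ln (S p)) = (\<Sum>k\<in>A. \<Sum>l\<in>B. ?d k l * ln (a k) + ?d k l * ln (b l))"
    unfolding sum_Times
  proof (intro sum.cong refl)
    fix k l assume "k \<in> A" "l \<in> B"
    then show "?d k l * ln (S (k, l)) = ?d k l * ln (a k) + ?d k l * ln (b l)"
      using z[of k l] a[of k] b[of l] by (cases "a k = 0 \<or> b l = 0") (auto simp: S_def ln_mult algebra_simps)
  qed
  also have "\<dots> = (\<Sum>k\<in>A. \<Sum>l\<in>B. ?d k l * ln (a k)) + (\<Sum>l\<in>B. \<Sum>k\<in>A. ?d k l * ln (b l))"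
    unfolding sum.distrib by (simp only: sum.swap[of "\<lambda>l k. ?d k l * ln (b l)" A B])
  also have "\<dots> = - ln 2 * Ent A (ptrace2 B f) - ln 2 * Ent B (ptrace1 A f)"
    unfolding sum_distrib_right[symmetric] using Ent_ln[OF fin(1) a' a] Ent_ln[OF fin(2) b' b] da db by simp
  finally have 1: "(\<Sum>p\<in>A \<times> B. diag_in (A \<times> B) f W p * ln (S p)) = - ln 2 * Ent A (ptrace2 B f) - ln 2 * Ent B (ptrace1 A f)" .
  have 2: "(\<Sum>p\<in>A \<times> B. S p) = 1"
    unfolding sum_Times S_def fst_conv snd_conv sum_product[symmetric]
    using tr_on_spec[OF fin(1) a'] tr_on_spec[OF fin(2) b'] t by (simp add: tr_on_ptrace)
  have "0 \<le> rel_ent (A \<times> B) r V S W" by (rule rel_ent_nonneg[OF finAB sp])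
  also have "\<dots> = ln 2 * (Ent A (ptrace2 B f) + Ent B (ptrace1 A f) - Ent (A \<times> B) f)"
    unfolding rel_ent_formula[OF finAB f' g] 1 2 tr_on_spec[OF finAB f', symmetric] t
    using Ent_ln[OF finAB f' r] by (simp add: algebra_simps)
  finally show ?thesis by (simp add: zero_le_mult_iff)
qed

section \<open>Hadamard channels\<close>

lemma psd_on_hermitian: "psd_on I f \<Longrightarrow> hermitian_on I f"
  by (simp add: psd_on_def)

lemma psd_on_pullback:
  assumes fin: "finite I" and f: "psd_on I f" and h: "\<And>j. j \<in> J \<Longrightarrow> h j \<in> I"
  shows "psd_on J (\<lambda>i j. f (h i) (h j))"
proof -
  obtain \<Phi> where \<Phi>: "gram_on I I f \<Phi>"
    using psd_on_imp_gram[OF fin f] ..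
  show ?thesis
    by (rule psd_on_gram[where R = I and \<Phi> = "\<lambda>i k. \<Phi> (h i) k"]) (simp add: \<Phi> h)
qed

lemma psd_on_tensor:
  assumes fin: "finite I" "finite J" and f: "psd_on I f" and g: "psd_on J g"
  shows "psd_on (I \<times> J) (\<lambda>p q. f (fst p) (fst q) * g (snd p) (snd q))"
proof -
  obtain \<Phi> where \<Phi>: "gram_on I I f \<Phi>"
    using psd_on_imp_gram[OF fin(1) f] ..
  obtain \<Psi> where \<Psi>: "gram_on J J g \<Psi>"
    using psd_on_imp_gram[OF fin(2) g] ..
  show ?thesis
  proof (rule psd_on_gram[where R = "I \<times> J" and \<Phi> = "\<lambda>p k. \<Phi> (fst p) (fst k) * \<Psi> (snd p) (snd k)"])
    fix p q assume "p \<in> I \<times> J" "q \<in> I \<times> J"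
    then have "f (fst p) (fst q) * g (snd p) (snd q)
       = (\<Sum>k\<in>I. \<Phi> (fst p) k * cnj (\<Phi> (fst q) k)) * (\<Sum>k\<in>J. \<Psi> (snd p) k * cnj (\<Psi> (snd q) k))"
      using \<Phi> \<Psi> by auto
    then show "f (fst p) (fst q) * g (snd p) (snd q) = (\<Sum>k\<in>I \<times> J. \<Phi> (fst p) (fst k) * \<Psi> (snd p) (snd k) *
        cnj (\<Phi> (fst q) (fst k) * \<Psi> (snd q) (snd k)))"
      unfolding sum_Times sum_product by (simp add: mult_ac)
  qed
qed

text \<open>Data processing for a system \<open>E\<close> prepared from a classical outcome y:
  conditioning on \<open>E\<close> leaves at least the entropy left by conditioning on y. In each
  branch \<open>E\<close> is in a product state with the rest, so the entropy of \<omega> cancels in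
  the difference.\<close>

lemma cond_entropy_product:
  fixes F :: "'c \<times> ('d \<times> 'e) \<Rightarrow> 'c \<times> ('d \<times> 'e) \<Rightarrow> complex"
  assumes fin: "finite C" "finite D" "finite E" "finite Y"
    and \<rho>: "\<And>y. y \<in> Y \<Longrightarrow> psd_on (C \<times> D) (\<rho> y)"
    and \<omega>: "\<And>y. y \<in> Y \<Longrightarrow> psd_on E (\<omega> y)" "\<And>y. y \<in> Y \<Longrightarrow> tr_on E (\<omega> y) = 1"
    and F: "\<And>c d e c' d' e'. c \<in> C \<Longrightarrow> d \<in> D \<Longrightarrow> e \<in> E \<Longrightarrow> c' \<in> C \<Longrightarrow> d' \<in> D \<Longrightarrow> e' \<in> E \<Longrightarrow>
      F (c, (d, e)) (c', (d', e')) = (\<Sum>y\<in>Y. \<rho> y (c, d) (c', d') * \<omega> y e e')"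
  shows "(\<Sum>y\<in>Y. Ent (C \<times> D) (\<rho> y) - Ent D (ptrace1 C (\<rho> y))) \<le> Ent (C \<times> (D \<times> E)) F - Ent (D \<times> E) (ptrace1 C F)"
proof -
  define f where "f y p q = \<rho> y (fst p, fst (snd p)) (fst q, fst (snd q)) * \<omega> y (snd (snd p)) (snd (snd q))" for y p q
  let ?h = "\<lambda>p :: 'c \<times> ('d \<times> 'e). ((fst p, fst (snd p)), snd (snd p))"
  have h: "bij_betw ?h (C \<times> (D \<times> E)) ((C \<times> D) \<times> E)"
    by (rule bij_betw_byWitness[where f' = "\<lambda>p. (fst (fst p), (snd (fst p), snd p))"]) auto
  have fp: "psd_on ((C \<times> D) \<times> E) (\<lambda>p q. \<rho> y (fst p) (fst q) * \<omega> y (snd p) (snd q))"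
     and fq: "psd_on (C \<times> (D \<times> E)) (f y)" if y: "y \<in> Y" for y
  proof -
    show fp: "psd_on ((C \<times> D) \<times> E) (\<lambda>p q. \<rho> y (fst p) (fst q) * \<omega> y (snd p) (snd q))"
      using fin by (intro psd_on_tensor \<rho> \<omega> y) auto
    from psd_on_pullback[OF _ fp, of "C \<times> (D \<times> E)" ?h] show "psd_on (C \<times> (D \<times> E)) (f y)"
      unfolding f_def using fin by auto
  qed
  have "(\<Sum>y\<in>Y. Ent (C \<times> (D \<times> E)) (f y) - Ent (D \<times> E) (ptrace1 C (f y))) \<le> Ent (C \<times> (D \<times> E)) F - Ent (D \<times> E) (ptrace1 C F)"
    by (rule cond_entropy_superadditive) (use fin fq in \<open>auto simp: F f_def\<close>)
  moreover have "Ent (C \<times> (D \<times> E)) (f y) - Ent (D \<times> E) (ptrace1 C (f y)) = Ent (C \<times> D) (\<rho> y) - Ent D (ptrace1 C (\<rho> y))"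
    if y: "y \<in> Y" for y
  proof -
    have "Ent (C \<times> (D \<times> E)) (f y) = Ent ((C \<times> D) \<times> E) (\<lambda>p q. \<rho> y (fst p) (fst q) * \<omega> y (snd p) (snd q))"
      unfolding f_def using Ent_reindex[OF h _ psd_on_hermitian[OF fp[OF y]]] fin by simp
    also have "\<dots> = Ent (C \<times> D) (\<rho> y) + tr_on (C \<times> D) (\<rho> y) * Ent E (\<omega> y)"
      using Ent_tensor[OF _ fin(3) \<rho>[OF y] \<omega>(1)[OF y]] fin \<omega>(2)[OF y] by simp
    finally have 1: "Ent (C \<times> (D \<times> E)) (f y) = Ent (C \<times> D) (\<rho> y) + tr_on (C \<times> D) (\<rho> y) * Ent E (\<omega> y)" .
    have "ptrace1 C (f y) = (\<lambda>p q. ptrace1 C (\<rho> y) (fst p) (fst q) * \<omega> y (snd p) (snd q))"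
      unfolding f_def ptrace1_def by (simp add: sum_distrib_right)
    then have 2: "Ent (D \<times> E) (ptrace1 C (f y)) = Ent D (ptrace1 C (\<rho> y)) + tr_on (C \<times> D) (\<rho> y) * Ent E (\<omega> y)"
      using Ent_tensor[OF fin(2,3) psd_on_ptrace1[OF fin(1,2) \<rho>[OF y]] \<omega>(1)[OF y]] \<omega>(2)[OF y]
      by (simp add: tr_on_ptrace)
    show ?thesis using 1 2 by simp
  qed
  ultimately show ?thesis by simp
qed

lemma Ent_unit_right:
  assumes "finite C" "hermitian_on C f"
  shows "Ent (C \<times> {()}) (\<lambda>p q. f (fst p) (fst q)) = Ent C f"
  by (rule Ent_reindex[OF _ assms]) (rule bij_betw_byWitness[where f' = "\<lambda>c. (c, ())"]; auto)

lemma Ent_ptrace1_unit: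
  assumes "psd_on C \<rho>"
  shows "Ent {()} (ptrace1 C (\<lambda>p q. \<rho> (fst p) (fst q))) = eta (tr_on C \<rho>)"
proof -
  have h: "\<rho> a a = cnj (\<rho> a a)" if "a \<in> C" for a
    using assms that unfolding psd_on_def hermitian_on_def by blast
  have "hermitian_on {()} (ptrace1 C (\<lambda>p q. \<rho> (fst p) (fst q)))"
    unfolding hermitian_on_def ptrace1_def using h by (simp cong: sum.cong)
  from Ent_singleton[OF this] show ?thesis by (simp add: ptrace1_def tr_on_def)
qed

text \<open>The case of a one-point \<open>D\<close>: the marginal of a branch is then the number
  \<open>tr_on C (\<rho> y)\<close>, and its entropy is \<open>eta\<close> of it.\<close>

lemma cond_entropy_product_trivial:
  fixes F :: "'c \<times> 'e \<Rightarrow> 'c \<times> 'e \<Rightarrow> complex"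
  assumes fin: "finite C" "finite E" "finite Y"
    and \<rho>: "\<And>y. y \<in> Y \<Longrightarrow> psd_on C (\<rho> y)"
    and \<omega>: "\<And>y. y \<in> Y \<Longrightarrow> psd_on E (\<omega> y)" "\<And>y. y \<in> Y \<Longrightarrow> tr_on E (\<omega> y) = 1"
    and F: "\<And>c e c' e'. c \<in> C \<Longrightarrow> e \<in> E \<Longrightarrow> c' \<in> C \<Longrightarrow> e' \<in> E \<Longrightarrow>
      F (c, e) (c', e') = (\<Sum>y\<in>Y. \<rho> y c c' * \<omega> y e e')"
    and Fp: "psd_on (C \<times> E) F"
  shows "(\<Sum>y\<in>Y. Ent C (\<rho> y) - eta (tr_on C (\<rho> y))) \<le> Ent (C \<times> E) F - Ent E (ptrace1 C F)"
proof -
  have cu: "psd_on (C \<times> {()}) (\<lambda>p q. \<rho> y (fst p) (fst q))" if "y \<in> Y" for y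
    using psd_on_pullback[OF fin(1) \<rho>[OF that], of "C \<times> {()}" fst] by auto
  let ?F = "\<lambda>p q. F (fst p, snd (snd p)) (fst q, snd (snd q))"
  have "(\<Sum>y\<in>Y. Ent (C \<times> {()}) (\<lambda>p q. \<rho> y (fst p) (fst q)) - Ent {()} (ptrace1 C (\<lambda>p q. \<rho> y (fst p) (fst q))))
     \<le> Ent (C \<times> ({()} \<times> E)) ?F - Ent ({()} \<times> E) (ptrace1 C ?F)"
    by (rule cond_entropy_product[OF fin(1) _ fin(2,3)]) (use cu \<omega> F in auto)
  also have "Ent (C \<times> ({()} \<times> E)) ?F = Ent (C \<times> E) F"
    by (rule Ent_reindex) (use fin Fp in \<open>auto simp: psd_on_def intro!: bij_betw_byWitness[where f' = "\<lambda>p. (fst p, ((), snd p))"]\<close>)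
  also have "ptrace1 C ?F = (\<lambda>p q. ptrace1 C F (snd p) (snd q))"
    unfolding ptrace1_def by simp
  also have "Ent ({()} \<times> E) (\<lambda>p q. ptrace1 C F (snd p) (snd q)) = Ent E (ptrace1 C F)"
    by (rule Ent_reindex) (use fin psd_on_ptrace1[OF fin(1,2) Fp] in \<open>auto simp: psd_on_def intro!: bij_betw_byWitness[where f' = "\<lambda>p. ((), p)"]\<close>)
  also have "(\<Sum>y\<in>Y. Ent (C \<times> {()}) (\<lambda>p q. \<rho> y (fst p) (fst q)) - Ent {()} (ptrace1 C (\<lambda>p q. \<rho> y (fst p) (fst q))))
     = (\<Sum>y\<in>Y. Ent C (\<rho> y) - eta (tr_on C (\<rho> y)))"
    using \<rho> by (intro sum.cong refl) (simp add: Ent_unit_right[OF fin(1)] Ent_ptrace1_unit psd_on_def)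
  finally show ?thesis .
qed

text \<open>A one-point \<open>E\<close> as well. The \<open>eta\<close> terms account for the
  weights; with total trace 1 the inequality says that Holevo information is nonnegative.\<close>

lemma Ent_concave:
  assumes fin: "finite C" "finite Y" and \<rho>: "\<And>y. y \<in> Y \<Longrightarrow> psd_on C (\<rho> y)"
  shows "(\<Sum>y\<in>Y. Ent C (\<rho> y) - eta (tr_on C (\<rho> y))) \<le> Ent C (\<lambda>c c'. \<Sum>y\<in>Y. \<rho> y c c') - eta (\<Sum>y\<in>Y. tr_on C (\<rho> y))"
proof -
  let ?F = "\<lambda>c c'. \<Sum>y\<in>Y. \<rho> y c c'"
  have Fp: "psd_on C ?F" by (rule psd_on_sum[OF \<rho>])
  have Fu: "psd_on (C \<times> {()}) (\<lambda>p q. ?F (fst p) (fst q))"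
    using psd_on_pullback[OF fin(1) Fp, of "C \<times> {()}" fst] by auto
  have "(\<Sum>y\<in>Y. Ent C (\<rho> y) - eta (tr_on C (\<rho> y))) \<le> Ent (C \<times> {()}) (\<lambda>p q. ?F (fst p) (fst q)) - Ent {()} (ptrace1 C (\<lambda>p q. ?F (fst p) (fst q)))"
    by (rule cond_entropy_product_trivial[OF fin(1) _ fin(2) \<rho>, where \<omega> = "\<lambda>_ _ _. 1"])
       (use Fu psd_on_gram[of "{()}" "\<lambda>_ _. 1" "\<lambda>_ _. 1" "{()}"] in \<open>auto simp: tr_on_def\<close>)
  also have "\<dots> = Ent C ?F - eta (tr_on C ?F)"
    using Ent_unit_right[OF fin(1), of ?F] Ent_ptrace1_unit[OF Fp] Fp by (simp add: psd_on_def)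
  also have "tr_on C ?F = (\<Sum>y\<in>Y. tr_on C (\<rho> y))"
    unfolding tr_on_def by (subst sum.swap) simp
  finally show ?thesis .
qed

text \<open>A channel is given by its isometry with output \<open>b\<close>, environment \<open>e\<close> and input \<open>a\<close>.\<close>

type_synonym ('b, 'e, 'a) kraus = "'b \<Rightarrow> 'e \<Rightarrow> 'a \<Rightarrow> complex"

definition chB :: "'e set \<Rightarrow> 'a set \<Rightarrow> ('b, 'e, 'a) kraus \<Rightarrow> 'a op \<Rightarrow> 'b \<Rightarrow> 'b \<Rightarrow> complex" where
  "chB E A W \<tau> b b' = (\<Sum>e\<in>E. \<Sum>a\<in>A. \<Sum>a'\<in>A. W b e a * \<tau> a a' * cnj (W b' e a'))"

definition chE :: "'b set \<Rightarrow> 'a set \<Rightarrow> ('b, 'e, 'a) kraus \<Rightarrow> 'a op \<Rightarrow> 'e \<Rightarrow> 'e \<Rightarrow> complex" where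
  "chE B A W \<tau> e e' = (\<Sum>b\<in>B. \<Sum>a\<in>A. \<Sum>a'\<in>A. W b e a * \<tau> a a' * cnj (W b e' a'))"

text \<open>Output vector of the isometry on the purification \<Phi>, with components on output,
  environment and reference; \<open>chB\<close> and \<open>chE\<close> are its marginals by
  \<open>ch_gram\<close>.\<close>

definition amp :: "'a set \<Rightarrow> ('b, 'e, 'a) kraus \<Rightarrow> ('a \<Rightarrow> 'r \<Rightarrow> complex) \<Rightarrow> 'b \<Rightarrow> 'e \<Rightarrow> 'r \<Rightarrow> complex" where
  "amp A W \<Phi> b e r = (\<Sum>a\<in>A. W b e a * \<Phi> a r)"

lemma amp_gram:
  assumes "gram_on A R \<tau> \<Phi>"
  shows "(\<Sum>a\<in>A. \<Sum>a'\<in>A. W b e a * \<tau> a a' * cnj (W b' e' a')) = (\<Sum>r\<in>R. amp A W \<Phi> b e r * cnj (amp A W \<Phi> b' e' r))"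
proof -
  have "(\<Sum>a\<in>A. \<Sum>a'\<in>A. W b e a * \<tau> a a' * cnj (W b' e' a')) = (\<Sum>a\<in>A. \<Sum>a'\<in>A. \<Sum>r\<in>R. W b e a * \<Phi> a r * cnj (W b' e' a' * \<Phi> a' r))"
    by (intro sum.cong refl) (simp add: assms sum_distrib_left sum_distrib_right mult_ac)
  also have "\<dots> = (\<Sum>r\<in>R. \<Sum>a\<in>A. \<Sum>a'\<in>A. W b e a * \<Phi> a r * cnj (W b' e' a' * \<Phi> a' r))"
    by (rule sum_swap3[symmetric])
  finally show ?thesis unfolding amp_def cnj_sum sum_product .
qed

lemma ch_gram:
  assumes "gram_on A R \<tau> \<Phi>"
  shows "chB E A W \<tau> b b' = (\<Sum>e\<in>E. \<Sum>r\<in>R. amp A W \<Phi> b e r * cnj (amp A W \<Phi> b' e r))"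
    and "chE B A W \<tau> e e' = (\<Sum>b\<in>B. \<Sum>r\<in>R. amp A W \<Phi> b e r * cnj (amp A W \<Phi> b e' r))"
  unfolding chB_def chE_def by (simp_all only: amp_gram[OF assms, where W = W])

definition isoW :: "'b set \<Rightarrow> 'e set \<Rightarrow> 'a set \<Rightarrow> ('b, 'e, 'a) kraus \<Rightarrow> bool" where
  "isoW B E A W \<longleftrightarrow> (\<forall>a\<in>A. \<forall>a'\<in>A. (\<Sum>b\<in>B. \<Sum>e\<in>E. W b e a * cnj (W b e a')) = of_bool (a = a'))"

text \<open>The environment channel measures and prepares: it has effects \<open>v y\<close> (rank one) and outputs
  \<open>\<omega> y\<close>.\<close>

definition hadW :: "'b set \<Rightarrow> 'e set \<Rightarrow> 'a set \<Rightarrow> ('b, 'e, 'a) kraus \<Rightarrow> 'y set \<Rightarrow> ('y \<Rightarrow> 'a \<Rightarrow> complex) \<Rightarrow> ('y \<Rightarrow> 'e \<Rightarrow> 'e \<Rightarrow> complex) \<Rightarrow> bool" where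
  "hadW B E A W Y v \<omega> \<longleftrightarrow> finite Y \<and> (\<forall>y\<in>Y. psd_on E (\<omega> y) \<and> tr_on E (\<omega> y) = 1) \<and>
     (\<forall>a\<in>A. \<forall>a'\<in>A. \<forall>e\<in>E. \<forall>e'\<in>E. (\<Sum>b\<in>B. W b e a * cnj (W b e' a')) = (\<Sum>y\<in>Y. cnj (v y a) * v y a' * \<omega> y e e'))"

lemma isoW_inner:
  assumes "isoW B E A W" "finite A"
  shows "(\<Sum>b\<in>B. \<Sum>e\<in>E. (\<Sum>a\<in>A. W b e a * X a) * cnj (\<Sum>a\<in>A. W b e a * X' a)) = (\<Sum>a\<in>A. X a * cnj (X' a))"
proof -
  have "(\<Sum>b\<in>B. \<Sum>e\<in>E. (\<Sum>a\<in>A. W b e a * X a) * cnj (\<Sum>a\<in>A. W b e a * X' a))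
     = (\<Sum>b\<in>B. \<Sum>e\<in>E. \<Sum>a\<in>A. \<Sum>a'\<in>A. X a * cnj (X' a') * (W b e a * cnj (W b e a')))"
    unfolding cnj_sum sum_product by (simp add: mult_ac)
  also have "\<dots> = (\<Sum>b\<in>B. \<Sum>a\<in>A. \<Sum>a'\<in>A. \<Sum>e\<in>E. X a * cnj (X' a') * (W b e a * cnj (W b e a')))"
    by (intro sum.cong refl sum_swap3)
  also have "\<dots> = (\<Sum>a\<in>A. \<Sum>a'\<in>A. \<Sum>b\<in>B. \<Sum>e\<in>E. X a * cnj (X' a') * (W b e a * cnj (W b e a')))"
    by (rule sum_swap3)
  also have "\<dots> = (\<Sum>a\<in>A. \<Sum>a'\<in>A. X a * cnj (X' a') * of_bool (a = a'))"
    using assms(1) unfolding isoW_def by (intro sum.cong refl) (simp only: sum_distrib_left[symmetric])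
  also have "\<dots> = (\<Sum>a\<in>A. X a * cnj (X' a))"
    using assms(2) by (intro sum.cong refl) (simp only: sum_delta_simps)
  finally show ?thesis .
qed

text \<open>By sesquilinearity, discarding the output amounts to measuring and preparing also for
  vectors that carry further indices, that is, in the presence of a reference.\<close>

lemma hadW_inner:
  assumes h: "hadW B E A W Y v \<omega>" and e: "e \<in> E" "e' \<in> E"
  shows "(\<Sum>b\<in>B. (\<Sum>a\<in>A. W b e a * X a) * cnj (\<Sum>a\<in>A. W b e' a * X' a))
    = (\<Sum>y\<in>Y. (\<Sum>a\<in>A. cnj (v y a) * X a) * cnj (\<Sum>a\<in>A. cnj (v y a) * X' a) * \<omega> y e e')"
proof -
  have "(\<Sum>b\<in>B. (\<Sum>a\<in>A. W b e a * X a) * cnj (\<Sum>a\<in>A. W b e' a * X' a))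
     = (\<Sum>b\<in>B. \<Sum>a\<in>A. \<Sum>a'\<in>A. X a * cnj (X' a') * (W b e a * cnj (W b e' a')))"
    unfolding cnj_sum sum_product by (simp add: mult_ac)
  also have "\<dots> = (\<Sum>a\<in>A. \<Sum>a'\<in>A. \<Sum>b\<in>B. X a * cnj (X' a') * (W b e a * cnj (W b e' a')))"
    by (rule sum_swap3)
  also have "\<dots> = (\<Sum>a\<in>A. \<Sum>a'\<in>A. X a * cnj (X' a') * (\<Sum>y\<in>Y. cnj (v y a) * v y a' * \<omega> y e e'))"
    using h e unfolding hadW_def by (intro sum.cong refl) (simp only: sum_distrib_left[symmetric])
  also have "\<dots> = (\<Sum>a\<in>A. \<Sum>a'\<in>A. \<Sum>y\<in>Y. (cnj (v y a) * X a) * cnj (cnj (v y a') * X' a') * \<omega> y e e')"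
    unfolding sum_distrib_left by (simp add: mult_ac)
  also have "\<dots> = (\<Sum>y\<in>Y. \<Sum>a\<in>A. \<Sum>a'\<in>A. (cnj (v y a) * X a) * cnj (cnj (v y a') * X' a') * \<omega> y e e')"
    by (rule sum_swap3[symmetric])
  also have "\<dots> = (\<Sum>y\<in>Y. (\<Sum>a\<in>A. cnj (v y a) * X a) * cnj (\<Sum>a\<in>A. cnj (v y a) * X' a) * \<omega> y e e')"
    unfolding cnj_sum sum_product unfolding sum_distrib_right ..
  finally show ?thesis .
qed

lemma psd_on_ch:
  assumes fin: "finite A" and \<tau>: "psd_on A \<tau>"
  shows "psd_on B (chB E A W \<tau>)" "psd_on E (chE B A W \<tau>)"
proof -
  obtain \<Phi> where \<Phi>: "gram_on A A \<tau> \<Phi>"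
    using psd_on_imp_gram[OF fin \<tau>] by auto
  note g = ch_gram[OF \<Phi>, where W = W]
  show "psd_on B (chB E A W \<tau>)"
    by (rule psd_on_gram[where R = "E \<times> A" and \<Phi> = "\<lambda>b p. amp A W \<Phi> b (fst p) (snd p)"]) (simp add: g(1) sum_Times)
  show "psd_on E (chE B A W \<tau>)"
    by (rule psd_on_gram[where R = "B \<times> A" and \<Phi> = "\<lambda>e p. amp A W \<Phi> (fst p) e (snd p)"]) (simp add: g(2) sum_Times)
qed

lemma tr_ch:
  assumes fin: "finite A" and \<tau>: "psd_on A \<tau>" and W: "isoW B E A W"
  shows "tr_on B (chB E A W \<tau>) = tr_on A \<tau>" "tr_on E (chE B A W \<tau>) = tr_on A \<tau>"
proof -
  obtain \<Phi> where \<Phi>: "gram_on A A \<tau> \<Phi>"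
    using psd_on_imp_gram[OF fin \<tau>] by auto
  note g = ch_gram[OF \<Phi>, where W = W]
  have "(\<Sum>b\<in>B. \<Sum>e\<in>E. \<Sum>r\<in>A. amp A W \<Phi> b e r * cnj (amp A W \<Phi> b e r))
     = (\<Sum>b\<in>B. \<Sum>r\<in>A. \<Sum>e\<in>E. amp A W \<Phi> b e r * cnj (amp A W \<Phi> b e r))"
    by (intro sum.cong refl sum.swap)
  also have "\<dots> = (\<Sum>r\<in>A. \<Sum>b\<in>B. \<Sum>e\<in>E. amp A W \<Phi> b e r * cnj (amp A W \<Phi> b e r))" by (rule sum.swap)
  also have "\<dots> = (\<Sum>r\<in>A. \<Sum>a\<in>A. \<Phi> a r * cnj (\<Phi> a r))" unfolding amp_def isoW_inner[OF W fin] ..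
  also have "\<dots> = (\<Sum>a\<in>A. \<Sum>r\<in>A. \<Phi> a r * cnj (\<Phi> a r))" by (rule sum.swap)
  also have "\<dots> = (\<Sum>a\<in>A. \<tau> a a)" using \<Phi> by simp
  finally have *: "(\<Sum>b\<in>B. \<Sum>e\<in>E. \<Sum>r\<in>A. amp A W \<Phi> b e r * cnj (amp A W \<Phi> b e r)) = (\<Sum>a\<in>A. \<tau> a a)" .
  show "tr_on B (chB E A W \<tau>) = tr_on A \<tau>" unfolding tr_on_def g(1) * ..
  have "(\<Sum>e\<in>E. \<Sum>b\<in>B. \<Sum>r\<in>A. amp A W \<Phi> b e r * cnj (amp A W \<Phi> b e r)) = (\<Sum>a\<in>A. \<tau> a a)"
    using * by (subst sum.swap)
  then show "tr_on E (chE B A W \<tau>) = tr_on A \<tau>" unfolding tr_on_def g(2) by (simp only:)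
qed

lemma chB_sum: "chB E A W (\<lambda>a a'. \<Sum>x\<in>X. \<tau> x a a') b b' = (\<Sum>x\<in>X. chB E A W (\<tau> x) b b')"
proof -
  have "chB E A W (\<lambda>a a'. \<Sum>x\<in>X. \<tau> x a a') b b' = (\<Sum>e\<in>E. \<Sum>a\<in>A. \<Sum>a'\<in>A. \<Sum>x\<in>X. W b e a * \<tau> x a a' * cnj (W b' e a'))"
    unfolding chB_def sum_distrib_left sum_distrib_right ..
  also have "\<dots> = (\<Sum>e\<in>E. \<Sum>x\<in>X. \<Sum>a\<in>A. \<Sum>a'\<in>A. W b e a * \<tau> x a a' * cnj (W b' e a'))"
    by (intro sum.cong refl sum_swap3[symmetric])
  also have "\<dots> = (\<Sum>x\<in>X. chB E A W (\<tau> x) b b')" unfolding chB_def by (rule sum.swap)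
  finally show ?thesis .
qed

text \<open>A Hadamard channel is degradable, so its coherent information on pure inputs is nonnegative.\<close>

lemma hadamard_Ent_le:
  assumes fin: "finite A" "finite B" "finite E" and h: "hadW B E A W Y v \<omega>" and \<tau>: "psd_on A \<tau>"
  shows "Ent E (chE B A W \<tau>) \<le> Ent B (chB E A W \<tau>)"
proof -
  obtain \<Phi> where \<Phi>: "gram_on A A \<tau> \<Phi>"
    using psd_on_imp_gram[OF fin(1) \<tau>] by auto
  note g = ch_gram[OF \<Phi>, where W = W]
  define \<xi> where "\<xi> y r = (\<Sum>a\<in>A. cnj (v y a) * \<Phi> a r)" for y r
  define M where "M p b = amp A W \<Phi> b (snd p) (fst p)" for p b
  define F where "F p q = (\<Sum>b\<in>B. M p b * cnj (M q b))" for p q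
  have pY: "psd_on A (\<lambda>r r'. \<xi> y r * cnj (\<xi> y r'))" for y
    by (rule psd_on_gram[where R = "{()}" and \<Phi> = "\<lambda>r _. \<xi> y r"]) simp
  \<comment> \<open>The reference plays the role of \<open>C\<close>: each outcome y leaves it pure,
    so the left-hand side is 0, while purity of the global vector turns the entropy of reference and
    environment into H(B).\<close>
  have "(\<Sum>y\<in>Y. Ent A (\<lambda>r r'. \<xi> y r * cnj (\<xi> y r')) - eta (tr_on A (\<lambda>r r'. \<xi> y r * cnj (\<xi> y r')))) \<le> Ent (A \<times> E) F - Ent E (ptrace1 A F)"
  proof (rule cond_entropy_product_trivial[OF fin(1,3) _ pY])
    show "psd_on (A \<times> E) F" by (rule psd_on_gram[where R = B and \<Phi> = M]) (simp add: F_def)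
    show "finite Y" "\<And>y. y \<in> Y \<Longrightarrow> psd_on E (\<omega> y)" "\<And>y. y \<in> Y \<Longrightarrow> tr_on E (\<omega> y) = 1"
      using h by (auto simp: hadW_def)
    fix r e r' e' assume "e \<in> E" "e' \<in> E"
    then show "F (r, e) (r', e') = (\<Sum>y\<in>Y. \<xi> y r * cnj (\<xi> y r') * \<omega> y e e')"
      unfolding F_def M_def amp_def \<xi>_def by (simp only: fst_conv snd_conv hadW_inner[OF h])
  qed
  also have "(\<Sum>y\<in>Y. Ent A (\<lambda>r r'. \<xi> y r * cnj (\<xi> y r')) - eta (tr_on A (\<lambda>r r'. \<xi> y r * cnj (\<xi> y r')))) = 0"
    unfolding Ent_pure[OF fin(1)] tr_on_def complex_norm_square[symmetric] by simp
  also have "Ent (A \<times> E) F = Ent B (chB E A W \<tau>)"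
  proof -
    have "Ent (A \<times> E) F = Ent B (\<lambda>b b'. \<Sum>p\<in>A \<times> E. M p b * cnj (M p b'))"
      unfolding F_def using fin by (intro Ent_gram_swap) auto
    also have "(\<lambda>b b'. \<Sum>p\<in>A \<times> E. M p b * cnj (M p b')) = chB E A W \<tau>"
      unfolding g(1) sum_Times M_def fst_conv snd_conv fun_eq_iff by (intro allI sum.swap)
    finally show ?thesis .
  qed
  also have "ptrace1 A F = chE B A W \<tau>"
    unfolding g(2) ptrace1_def F_def M_def fst_conv snd_conv fun_eq_iff by (intro allI sum.swap)
  finally show ?thesis by simp
qed

section \<open>Additivity of the trade-off functional\<close>

definition tensW :: "(('b1, 'e1, 'a1) kraus) \<Rightarrow> (('b2, 'e2, 'a2) kraus) \<Rightarrow> 'b1 \<times> 'b2 \<Rightarrow> 'e1 \<times> 'e2 \<Rightarrow> 'a1 \<times> 'a2 \<Rightarrow> complex" where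
  "tensW W1 W2 b e a = W1 (fst b) (fst e) (fst a) * W2 (snd b) (snd e) (snd a)"

text \<open>Subnormalised second input left by the rank-one effect with vector \<open>v\<close> on
  the first; its trace is the weight of that outcome.\<close>

definition post :: "'a1 set \<Rightarrow> ('a1 \<Rightarrow> complex) \<Rightarrow> (('a1 \<times> 'a2) op) \<Rightarrow> 'a2 \<Rightarrow> 'a2 \<Rightarrow> complex" where
  "post A v \<tau> c c' = (\<Sum>a\<in>A. \<Sum>a'\<in>A. cnj (v a) * \<tau> (a, c) (a', c') * v a')"

text \<open>Contribution of one letter: \<open>eta\<close> of the trace is its share of H(X), and
  H(B) collects \<open>- 1\<close> from I(X;B) and \<open>lam\<close> from the coherent
  information.\<close>

definition cq_term :: "real \<Rightarrow> 'b set \<Rightarrow> 'e set \<Rightarrow> 'a set \<Rightarrow> ('b, 'e, 'a) kraus \<Rightarrow> 'a op \<Rightarrow> real" where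
  "cq_term lam B E A W \<tau> = (lam - 1) * Ent B (chB E A W \<tau>) - lam * Ent E (chE B A W \<tau>) + eta (tr_on A \<tau>)"

lemma sum_swap4: "(\<Sum>a\<in>A. \<Sum>b\<in>B. \<Sum>c\<in>C. \<Sum>d\<in>D. F a b c d) = (\<Sum>d\<in>D. \<Sum>b\<in>B. \<Sum>a\<in>A. \<Sum>c\<in>C. F a b c d)"
proof -
  have "(\<Sum>a\<in>A. \<Sum>b\<in>B. \<Sum>c\<in>C. \<Sum>d\<in>D. F a b c d) = (\<Sum>b\<in>B. \<Sum>a\<in>A. \<Sum>c\<in>C. \<Sum>d\<in>D. F a b c d)"
    by (rule sum.swap)
  also have "\<dots> = (\<Sum>b\<in>B. \<Sum>d\<in>D. \<Sum>a\<in>A. \<Sum>c\<in>C. F a b c d)"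
    by (intro sum.cong refl sum_swap3[symmetric])
  also have "\<dots> = (\<Sum>d\<in>D. \<Sum>b\<in>B. \<Sum>a\<in>A. \<Sum>c\<in>C. F a b c d)" by (rule sum.swap)
  finally show ?thesis .
qed

lemma psd_trace: "finite I \<Longrightarrow> psd_on I f \<Longrightarrow> (\<Sum>i\<in>I. f i i) = of_real (tr_on I f)"
  unfolding tr_on_def by (metis Re_complex_of_real psd_on_spec spec_trace)

text \<open>Trace the identity in \<open>hadW\<close> over \<open>E\<close>: one side becomes the
  isometry relation, and on the other the states have trace 1.\<close>

lemma hadW_complete:
  assumes fin: "finite E" and h: "hadW B E A W Y v \<omega>" and W: "isoW B E A W" and a: "a \<in> A" "a' \<in> A"
  shows "(\<Sum>y\<in>Y. cnj (v y a) * v y a') = of_bool (a = a')"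
proof -
  have "(\<Sum>y\<in>Y. cnj (v y a) * v y a') = (\<Sum>y\<in>Y. \<Sum>e\<in>E. cnj (v y a) * v y a' * \<omega> y e e)"
    using h unfolding hadW_def sum_distrib_left[symmetric]
    by (intro sum.cong refl) (simp add: psd_trace[OF fin])
  also have "\<dots> = (\<Sum>e\<in>E. \<Sum>y\<in>Y. cnj (v y a) * v y a' * \<omega> y e e)" by (rule sum.swap)
  also have "\<dots> = (\<Sum>e\<in>E. \<Sum>b\<in>B. W b e a * cnj (W b e a'))"
    using h a unfolding hadW_def by (intro sum.cong refl) simp
  also have "\<dots> = (\<Sum>b\<in>B. \<Sum>e\<in>E. W b e a * cnj (W b e a'))" by (rule sum.swap)
  also have "\<dots> = of_bool (a = a')" using W a unfolding isoW_def by simp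
  finally show ?thesis .
qed

locale joint_channel =
  fixes A1 :: "'a1 set" and B1 :: "'b1 set" and E1 :: "'e1 set" and A2 :: "'a2 set" and B2 :: "'b2 set" and E2 :: "'e2 set"
    and W1 :: "('b1, 'e1, 'a1) kraus" and W2 :: "('b2, 'e2, 'a2) kraus"
    and Y :: "'y set" and v :: "'y \<Rightarrow> 'a1 \<Rightarrow> complex" and \<omega> :: "'y \<Rightarrow> 'e1 \<Rightarrow> 'e1 \<Rightarrow> complex"
  assumes fin: "finite A1" "finite B1" "finite E1" "finite A2" "finite B2" "finite E2"
    and iso1: "isoW B1 E1 A1 W1" and iso2: "isoW B2 E2 A2 W2"
    and had: "hadW B1 E1 A1 W1 Y v \<omega>"
begin

abbreviation "W12 \<equiv> tensW W1 W2"
abbreviation "amp12 \<Phi> \<equiv> amp (A1 \<times> A2) W12 \<Phi>"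
abbreviation "\<Phi>1 \<Phi> a1 p \<equiv> \<Phi> (a1, fst p) (snd p)"
abbreviation "\<Phi>2 \<Phi> a2 p \<equiv> \<Phi> (fst p, a2) (snd p)"
abbreviation "\<Phi>post \<Phi> y a2 r \<equiv> \<Sum>a1\<in>A1. cnj (v y a1) * \<Phi> (a1, a2) r"

lemma amp12_first: "amp12 \<Phi> (b1, b2) (e1, e2) r = (\<Sum>a1\<in>A1. W1 b1 e1 a1 * amp A2 W2 (\<Phi>2 \<Phi>) b2 e2 (a1, r))"
  unfolding amp_def sum_Times tensW_def sum_distrib_left by (simp add: mult_ac)

lemma amp12_second: "amp12 \<Phi> (b1, b2) (e1, e2) r = (\<Sum>a2\<in>A2. W2 b2 e2 a2 * amp A1 W1 (\<Phi>1 \<Phi>) b1 e1 (a2, r))"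
  unfolding amp_def sum_Times tensW_def sum_distrib_left by (subst sum.swap) (simp add: mult_ac)

lemma amp_post: "(\<Sum>a1\<in>A1. cnj (v y a1) * amp A2 W2 (\<Phi>2 \<Phi>) b2 e2 (a1, r)) = amp A2 W2 (\<Phi>post \<Phi> y) b2 e2 r"
  unfolding amp_def sum_distrib_left by (subst sum.swap) (simp add: mult_ac)

text \<open>Tracing out B1 leaves E1 in the state prepared for y, next to the vector that the second
  channel makes of the post-measurement input.\<close>

lemma measure_first:
  assumes "e1 \<in> E1" "e1' \<in> E1"
  shows "(\<Sum>b1\<in>B1. amp12 \<Phi> (b1, b2) (e1, e2) r * cnj (amp12 \<Phi> (b1, b2') (e1', e2') r'))
    = (\<Sum>y\<in>Y. amp A2 W2 (\<Phi>post \<Phi> y) b2 e2 r * cnj (amp A2 W2 (\<Phi>post \<Phi> y) b2' e2' r') * \<omega> y e1 e1')"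
  unfolding amp12_first hadW_inner[OF had assms] amp_post ..

lemma discard_second:
  "(\<Sum>b2\<in>B2. \<Sum>e2\<in>E2. amp12 \<Phi> (b1, b2) (e1, e2) r * cnj (amp12 \<Phi> (b1', b2) (e1', e2) r))
    = (\<Sum>a2\<in>A2. amp A1 W1 (\<Phi>1 \<Phi>) b1 e1 (a2, r) * cnj (amp A1 W1 (\<Phi>1 \<Phi>) b1' e1' (a2, r)))"
  unfolding amp12_second isoW_inner[OF iso2 fin(4)] ..

lemma discard_first:
  "(\<Sum>b1\<in>B1. \<Sum>e1\<in>E1. amp12 \<Phi> (b1, b2) (e1, e2) r * cnj (amp12 \<Phi> (b1, b2') (e1, e2') r))
    = (\<Sum>a1\<in>A1. amp A2 W2 (\<Phi>2 \<Phi>) b2 e2 (a1, r) * cnj (amp A2 W2 (\<Phi>2 \<Phi>) b2' e2' (a1, r)))"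
  unfolding amp12_first isoW_inner[OF iso1 fin(1)] ..

context
  fixes \<tau> :: "('a1 \<times> 'a2) op" and R :: "'r set" and \<Phi> :: "'a1 \<times> 'a2 \<Rightarrow> 'r \<Rightarrow> complex"
  assumes finR: "finite R" and gram: "gram_on (A1 \<times> A2) R \<tau> \<Phi>"
begin

lemma gram1: "gram_on A1 (A2 \<times> R) (ptrace2 A2 \<tau>) (\<Phi>1 \<Phi>)"
  unfolding ptrace2_def sum_Times using gram by simp

lemma gram2: "gram_on A2 (A1 \<times> R) (ptrace1 A1 \<tau>) (\<Phi>2 \<Phi>)"
  unfolding ptrace1_def sum_Times using gram by simp

text \<open>A rank-one effect sends a purification to a vector over the same reference, so the
  post-measurement state is purified without any additional system.\<close>

lemma gram_post: "gram_on A2 R (post A1 (v y) \<tau>) (\<Phi>post \<Phi> y)"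
proof (intro ballI)
  fix c c' assume c: "c \<in> A2" "c' \<in> A2"
  have "post A1 (v y) \<tau> c c' = (\<Sum>a\<in>A1. \<Sum>a'\<in>A1. \<Sum>r\<in>R. (cnj (v y a) * \<Phi> (a, c) r) * cnj (cnj (v y a') * \<Phi> (a', c') r))"
    unfolding post_def using gram c by (intro sum.cong refl) (simp add: sum_distrib_left sum_distrib_right mult_ac)
  also have "\<dots> = (\<Sum>r\<in>R. \<Sum>a\<in>A1. \<Sum>a'\<in>A1. (cnj (v y a) * \<Phi> (a, c) r) * cnj (cnj (v y a') * \<Phi> (a', c') r))"
    by (rule sum_swap3[symmetric])
  finally show "post A1 (v y) \<tau> c c' = (\<Sum>r\<in>R. \<Phi>post \<Phi> y c r * cnj (\<Phi>post \<Phi> y c' r))"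
    unfolding cnj_sum sum_product .
qed

lemma psd_post: "psd_on A2 (post A1 (v y) \<tau>)"
  by (rule psd_on_gram[where R = R and \<Phi> = "\<Phi>post \<Phi> y"]) (use gram_post in blast)

lemmas ch12 = ch_gram[OF gram, where W = W12]
lemmas ch1 = ch_gram[OF gram1, where W = W1, unfolded sum_Times]
lemmas ch2 = ch_gram[OF gram2, where W = W2, unfolded sum_Times]
lemmas ch_post = ch_gram[OF gram_post, where W = W2]

lemma chB12_ptrace2: "ptrace2 B2 (chB (E1 \<times> E2) (A1 \<times> A2) W12 \<tau>) = chB E1 A1 W1 (ptrace2 A2 \<tau>)"
proof (intro ext)
  fix b b'
  let ?x = "\<lambda>b2 e1 e2 r. amp12 \<Phi> (b, b2) (e1, e2) r * cnj (amp12 \<Phi> (b', b2) (e1, e2) r)"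
  have "ptrace2 B2 (chB (E1 \<times> E2) (A1 \<times> A2) W12 \<tau>) b b' = (\<Sum>b2\<in>B2. \<Sum>e1\<in>E1. \<Sum>e2\<in>E2. \<Sum>r\<in>R. ?x b2 e1 e2 r)"
    unfolding ptrace2_def ch12 sum_Times ..
  also have "\<dots> = (\<Sum>r\<in>R. \<Sum>e1\<in>E1. \<Sum>b2\<in>B2. \<Sum>e2\<in>E2. ?x b2 e1 e2 r)" by (rule sum_swap4)
  also have "\<dots> = chB E1 A1 W1 (ptrace2 A2 \<tau>) b b'"
    unfolding discard_second ch1 by (rule sum_swap3)
  finally show "ptrace2 B2 (chB (E1 \<times> E2) (A1 \<times> A2) W12 \<tau>) b b' = chB E1 A1 W1 (ptrace2 A2 \<tau>) b b'" .
qed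

lemma chB12_ptrace1: "ptrace1 B1 (chB (E1 \<times> E2) (A1 \<times> A2) W12 \<tau>) = chB E2 A2 W2 (ptrace1 A1 \<tau>)"
proof (intro ext)
  fix b b'
  let ?x = "\<lambda>b1 e1 e2 r. amp12 \<Phi> (b1, b) (e1, e2) r * cnj (amp12 \<Phi> (b1, b') (e1, e2) r)"
  have "ptrace1 B1 (chB (E1 \<times> E2) (A1 \<times> A2) W12 \<tau>) b b' = (\<Sum>b1\<in>B1. \<Sum>e1\<in>E1. \<Sum>e2\<in>E2. \<Sum>r\<in>R. ?x b1 e1 e2 r)"
    unfolding ptrace1_def ch12 sum_Times ..
  also have "\<dots> = (\<Sum>b1\<in>B1. \<Sum>e2\<in>E2. \<Sum>e1\<in>E1. \<Sum>r\<in>R. ?x b1 e1 e2 r)"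
    by (intro sum.cong refl sum.swap)
  also have "\<dots> = (\<Sum>r\<in>R. \<Sum>e2\<in>E2. \<Sum>b1\<in>B1. \<Sum>e1\<in>E1. ?x b1 e1 e2 r)" by (rule sum_swap4)
  also have "\<dots> = chB E2 A2 W2 (ptrace1 A1 \<tau>) b b'"
    unfolding discard_first ch2 by (rule sum_swap3)
  finally show "ptrace1 B1 (chB (E1 \<times> E2) (A1 \<times> A2) W12 \<tau>) b b' = chB E2 A2 W2 (ptrace1 A1 \<tau>) b b'" .
qed

text \<open>By purity of the joint output, H(B1) is the entropy of B2, R, E2, E1 and H(B1 B2) that
  of R, E2, E1, so the right-hand side is H(B2|R E2 E1). Since E1 is prepared from y, this is at
  least the sum of H(B2|R E2) over the branches y. A branch is pure because the effects have rank
  one, so its term is \<open>eta\<close> of its weight minus H(B2).\<close>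

lemma output_entropy_bound:
  "(\<Sum>y\<in>Y. eta (tr_on A2 (post A1 (v y) \<tau>)) - Ent B2 (chB E2 A2 W2 (post A1 (v y) \<tau>)))
    \<le> Ent B1 (chB E1 A1 W1 (ptrace2 A2 \<tau>)) - Ent (B1 \<times> B2) (chB (E1 \<times> E2) (A1 \<times> A2) W12 \<tau>)"
proof -
  \<comment> \<open>The joint output vector, cut between B1 and the rest. The rest has index
    \<open>(b2, ((r, e2), e1))\<close>, with E1 last as \<open>cond_entropy_product\<close>
    expects.\<close>
  define M where "M p b1 = amp12 \<Phi> (b1, fst p) (snd (snd p), snd (fst (snd p))) (fst (fst (snd p)))" for p b1
  define F where "F p q = (\<Sum>b1\<in>B1. M p b1 * cnj (M q b1))" for p q
  define x where "x y p = amp A2 W2 (\<Phi>post \<Phi> y) (fst p) (snd (snd p)) (fst (snd p))" for y p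
  define \<rho> where "\<rho> y p q = x y p * cnj (x y q)" for y p q
  have finD: "finite (R \<times> E2)" "finite ((R \<times> E2) \<times> E1)" "finite (B2 \<times> (R \<times> E2))" "finite (B2 \<times> ((R \<times> E2) \<times> E1))"
    using fin finR by auto
  have \<rho>p: "psd_on I (\<rho> y)" for I y
    by (rule psd_on_gram[where R = "{()}" and \<Phi> = "\<lambda>p _. x y p"]) (simp add: \<rho>_def)
  have "(\<Sum>y\<in>Y. Ent (B2 \<times> (R \<times> E2)) (\<rho> y) - Ent (R \<times> E2) (ptrace1 B2 (\<rho> y)))
     \<le> Ent (B2 \<times> ((R \<times> E2) \<times> E1)) F - Ent ((R \<times> E2) \<times> E1) (ptrace1 B2 F)"
  proof (rule cond_entropy_product[OF fin(5) finD(1) fin(3) _ \<rho>p])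
    show "finite Y" "\<And>y. y \<in> Y \<Longrightarrow> psd_on E1 (\<omega> y)" "\<And>y. y \<in> Y \<Longrightarrow> tr_on E1 (\<omega> y) = 1"
      using had by (auto simp: hadW_def)
    fix c d e c' d' e' assume "e \<in> E1" "e' \<in> E1"
    then show "F (c, (d, e)) (c', (d', e')) = (\<Sum>y\<in>Y. \<rho> y (c, d) (c', d') * \<omega> y e e')"
      unfolding F_def M_def \<rho>_def x_def fst_conv snd_conv by (rule measure_first)
  qed
  also have "Ent (B2 \<times> ((R \<times> E2) \<times> E1)) F = Ent B1 (chB E1 A1 W1 (ptrace2 A2 \<tau>))"
  proof -
    have "Ent (B2 \<times> ((R \<times> E2) \<times> E1)) F = Ent B1 (\<lambda>b b'. \<Sum>p\<in>B2 \<times> ((R \<times> E2) \<times> E1). M p b * cnj (M p b'))"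
      unfolding F_def by (rule Ent_gram_swap[OF finD(4) fin(2)])
    also have "(\<lambda>b b'. \<Sum>p\<in>B2 \<times> ((R \<times> E2) \<times> E1). M p b * cnj (M p b')) = chB E1 A1 W1 (ptrace2 A2 \<tau>)"
    proof (intro ext)
      fix b b'
      let ?x = "\<lambda>b2 e1 e2 r. amp12 \<Phi> (b, b2) (e1, e2) r * cnj (amp12 \<Phi> (b', b2) (e1, e2) r)"
      have "(\<Sum>p\<in>B2 \<times> ((R \<times> E2) \<times> E1). M p b * cnj (M p b')) = (\<Sum>b2\<in>B2. \<Sum>r\<in>R. \<Sum>e2\<in>E2. \<Sum>e1\<in>E1. ?x b2 e1 e2 r)"
        unfolding sum_Times M_def fst_conv snd_conv ..
      also have "\<dots> = (\<Sum>e1\<in>E1. \<Sum>r\<in>R. \<Sum>b2\<in>B2. \<Sum>e2\<in>E2. ?x b2 e1 e2 r)" by (rule sum_swap4)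
      also have "\<dots> = chB E1 A1 W1 (ptrace2 A2 \<tau>) b b'"
        unfolding discard_second ch1 by (intro sum.cong refl sum.swap)
      finally show "(\<Sum>p\<in>B2 \<times> ((R \<times> E2) \<times> E1). M p b * cnj (M p b')) = chB E1 A1 W1 (ptrace2 A2 \<tau>) b b'" .
    qed
    finally show ?thesis .
  qed
  also have "Ent ((R \<times> E2) \<times> E1) (ptrace1 B2 F) = Ent (B1 \<times> B2) (chB (E1 \<times> E2) (A1 \<times> A2) W12 \<tau>)"
  proof -
    let ?N = "\<lambda>d \<beta>. M (snd \<beta>, d) (fst \<beta>)"
    have "ptrace1 B2 F = (\<lambda>d d'. \<Sum>\<beta>\<in>B1 \<times> B2. ?N d \<beta> * cnj (?N d' \<beta>))"
      unfolding ptrace1_def F_def sum_Times fst_conv snd_conv fun_eq_iff by (intro allI sum.swap)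
    then have "Ent ((R \<times> E2) \<times> E1) (ptrace1 B2 F) = Ent (B1 \<times> B2) (\<lambda>\<beta> \<beta>'. \<Sum>d\<in>(R \<times> E2) \<times> E1. ?N d \<beta> * cnj (?N d \<beta>'))"
      using Ent_gram_swap[OF finD(2), of "B1 \<times> B2" ?N] fin by simp
    also have "\<dots> = Ent (B1 \<times> B2) (chB (E1 \<times> E2) (A1 \<times> A2) W12 \<tau>)"
    proof (rule Ent_cong)
      fix \<beta> \<beta>'
      show "(\<Sum>d\<in>(R \<times> E2) \<times> E1. ?N d \<beta> * cnj (?N d \<beta>')) = chB (E1 \<times> E2) (A1 \<times> A2) W12 \<tau> \<beta> \<beta>'"
        unfolding sum_Times M_def ch12 fst_conv snd_conv prod.collapse by (rule sum_swap3')
    qed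
    finally show ?thesis .
  qed
  also have "(\<Sum>y\<in>Y. Ent (B2 \<times> (R \<times> E2)) (\<rho> y) - Ent (R \<times> E2) (ptrace1 B2 (\<rho> y)))
     = (\<Sum>y\<in>Y. eta (tr_on A2 (post A1 (v y) \<tau>)) - Ent B2 (chB E2 A2 W2 (post A1 (v y) \<tau>)))"
  proof (intro sum.cong refl)
    fix y
    have sw: "chB E2 A2 W2 (post A1 (v y) \<tau>) b b' = (\<Sum>d\<in>R \<times> E2. x y (b, d) * cnj (x y (b', d)))" for b b'
      unfolding ch_post sum_Times x_def fst_conv snd_conv by (rule sum.swap)
    have "tr_on A2 (post A1 (v y) \<tau>) = tr_on B2 (chB E2 A2 W2 (post A1 (v y) \<tau>))"
      using tr_ch(1)[OF fin(4) psd_post iso2] by simp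
    also have "\<dots> = (\<Sum>p\<in>B2 \<times> (R \<times> E2). (cmod (x y p))\<^sup>2)"
      unfolding tr_on_def sw complex_norm_square[symmetric] sum_Times[of _ B2] by simp
    finally have "Ent (B2 \<times> (R \<times> E2)) (\<rho> y) = eta (tr_on A2 (post A1 (v y) \<tau>))"
      unfolding \<rho>_def Ent_pure[OF finD(3)] by simp
    moreover have "Ent (R \<times> E2) (ptrace1 B2 (\<rho> y)) = Ent B2 (chB E2 A2 W2 (post A1 (v y) \<tau>))"
    proof -
      have "Ent (R \<times> E2) (ptrace1 B2 (\<rho> y)) = Ent (R \<times> E2) (\<lambda>d d'. \<Sum>b\<in>B2. x y (b, d) * cnj (x y (b, d')))"
        unfolding ptrace1_def \<rho>_def ..
      also have "\<dots> = Ent B2 (\<lambda>b b'. \<Sum>d\<in>R \<times> E2. x y (b, d) * cnj (x y (b', d)))"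
        by (rule Ent_gram_swap[OF finD(1) fin(5)])
      finally show ?thesis unfolding sw[symmetric] .
    qed
    ultimately show "Ent (B2 \<times> (R \<times> E2)) (\<rho> y) - Ent (R \<times> E2) (ptrace1 B2 (\<rho> y))
       = eta (tr_on A2 (post A1 (v y) \<tau>)) - Ent B2 (chB E2 A2 W2 (post A1 (v y) \<tau>))" by simp
  qed
  finally show ?thesis .
qed

text \<open>Here E1 conditions directly: the right-hand side is H(E2|E1), which dominates H(E2|Y)
  because E1 is prepared from y.\<close>

lemma environment_entropy_bound:
  "(\<Sum>y\<in>Y. Ent E2 (chE B2 A2 W2 (post A1 (v y) \<tau>)) - eta (tr_on A2 (post A1 (v y) \<tau>)))
    \<le> Ent (E1 \<times> E2) (chE (B1 \<times> B2) (A1 \<times> A2) W12 \<tau>) - Ent E1 (chE B1 A1 W1 (ptrace2 A2 \<tau>))"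
proof -
  let ?c = "chE (B1 \<times> B2) (A1 \<times> A2) W12 \<tau>"
  \<comment> \<open>Exchanges the factors, since the conditioning system has to come second.\<close>
  define F where "F p q = ?c (prod.swap p) (prod.swap q)" for p q
  have \<tau>: "psd_on (A1 \<times> A2) \<tau>" by (rule psd_on_gram[where R = R and \<Phi> = \<Phi>]) (use gram in blast)
  have cp: "psd_on (E1 \<times> E2) ?c" using fin by (intro psd_on_ch \<tau>) auto
  have Fp: "psd_on (E2 \<times> E1) F" unfolding F_def by (rule psd_on_pullback[OF _ cp]) (use fin in auto)
  have "(\<Sum>y\<in>Y. Ent E2 (chE B2 A2 W2 (post A1 (v y) \<tau>)) - eta (tr_on E2 (chE B2 A2 W2 (post A1 (v y) \<tau>))))
     \<le> Ent (E2 \<times> E1) F - Ent E1 (ptrace1 E2 F)"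
  proof (rule cond_entropy_product_trivial[OF fin(6,3) _ _ _ _ _ Fp])
    show "finite Y" "\<And>y. y \<in> Y \<Longrightarrow> psd_on E1 (\<omega> y)" "\<And>y. y \<in> Y \<Longrightarrow> tr_on E1 (\<omega> y) = 1"
      using had by (auto simp: hadW_def)
    show "psd_on E2 (chE B2 A2 W2 (post A1 (v y) \<tau>))" for y
      by (rule psd_on_ch(2)[OF fin(4) psd_post])
    fix e2 e1 e2' e1' assume e: "e1 \<in> E1" "e1' \<in> E1"
    let ?x = "\<lambda>b1 b2 r. amp12 \<Phi> (b1, b2) (e1, e2) r * cnj (amp12 \<Phi> (b1, b2) (e1', e2') r)"
    have "F (e2, e1) (e2', e1') = (\<Sum>b1\<in>B1. \<Sum>b2\<in>B2. \<Sum>r\<in>R. ?x b1 b2 r)"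
      unfolding F_def ch12 sum_Times swap_simp ..
    also have "\<dots> = (\<Sum>b2\<in>B2. \<Sum>r\<in>R. \<Sum>b1\<in>B1. ?x b1 b2 r)" by (rule sum_swap3)
    also have "\<dots> = (\<Sum>b2\<in>B2. \<Sum>r\<in>R. \<Sum>y\<in>Y. amp A2 W2 (\<Phi>post \<Phi> y) b2 e2 r * cnj (amp A2 W2 (\<Phi>post \<Phi> y) b2 e2' r) * \<omega> y e1 e1')"
      unfolding measure_first[OF e] ..
    also have "\<dots> = (\<Sum>y\<in>Y. chE B2 A2 W2 (post A1 (v y) \<tau>) e2 e2' * \<omega> y e1 e1')"
      unfolding ch_post sum_distrib_right by (rule sum_swap3[symmetric])
    finally show "F (e2, e1) (e2', e1') = (\<Sum>y\<in>Y. chE B2 A2 W2 (post A1 (v y) \<tau>) e2 e2' * \<omega> y e1 e1')" .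
  qed
  also have "Ent (E2 \<times> E1) F = Ent (E1 \<times> E2) ?c"
    unfolding F_def by (rule Ent_reindex[OF _ _ psd_on_hermitian[OF cp]])
      (use fin in \<open>auto intro!: bij_betw_byWitness[where f' = prod.swap]\<close>)
  also have "ptrace1 E2 F = chE B1 A1 W1 (ptrace2 A2 \<tau>)"
  proof (intro ext)
    fix e e'
    let ?x = "\<lambda>e2 b1 b2 r. amp12 \<Phi> (b1, b2) (e, e2) r * cnj (amp12 \<Phi> (b1, b2) (e', e2) r)"
    have "ptrace1 E2 F e e' = (\<Sum>e2\<in>E2. \<Sum>b1\<in>B1. \<Sum>b2\<in>B2. \<Sum>r\<in>R. ?x e2 b1 b2 r)"
      unfolding ptrace1_def F_def ch12 sum_Times swap_simp ..
    also have "\<dots> = (\<Sum>r\<in>R. \<Sum>b1\<in>B1. \<Sum>e2\<in>E2. \<Sum>b2\<in>B2. ?x e2 b1 b2 r)" by (rule sum_swap4)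
    also have "\<dots> = (\<Sum>r\<in>R. \<Sum>b1\<in>B1. \<Sum>b2\<in>B2. \<Sum>e2\<in>E2. ?x e2 b1 b2 r)" by (intro sum.cong refl sum.swap)
    also have "\<dots> = chE B1 A1 W1 (ptrace2 A2 \<tau>) e e'"
      unfolding discard_second ch1 by (rule sum_swap3)
    finally show "ptrace1 E2 F e e' = chE B1 A1 W1 (ptrace2 A2 \<tau>) e e'" .
  qed
  finally show ?thesis unfolding tr_ch(2)[OF fin(4) psd_post iso2] .
qed

text \<open>The two entropy bounds enter with the factors \<open>lam - 1\<close> and
  \<open>lam\<close>, and the first is nonnegative exactly because \<open>1 \<le> lam\<close>. The
  \<open>eta\<close> sums over y then occur with \<open>lam - 1\<close>, \<open>- lam\<close> and
  \<open>1\<close> and cancel.\<close>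

lemma cq_term_subadditive:
  assumes "1 \<le> lam"
  shows "cq_term lam (B1 \<times> B2) (E1 \<times> E2) (A1 \<times> A2) W12 \<tau>
    \<le> cq_term lam B1 E1 A1 W1 (ptrace2 A2 \<tau>) + (\<Sum>y\<in>Y. cq_term lam B2 E2 A2 W2 (post A1 (v y) \<tau>))"
proof -
  let ?SB = "\<Sum>y\<in>Y. Ent B2 (chB E2 A2 W2 (post A1 (v y) \<tau>))" and ?SE = "\<Sum>y\<in>Y. Ent E2 (chE B2 A2 W2 (post A1 (v y) \<tau>))"
    and ?S = "\<Sum>y\<in>Y. eta (tr_on A2 (post A1 (v y) \<tau>))"
  have 1: "(lam - 1) * (?S - ?SB) \<le> (lam - 1) * (Ent B1 (chB E1 A1 W1 (ptrace2 A2 \<tau>)) - Ent (B1 \<times> B2) (chB (E1 \<times> E2) (A1 \<times> A2) W12 \<tau>))"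
    using output_entropy_bound assms by (intro mult_left_mono) (simp_all add: sum_subtractf)
  have 2: "lam * (?SE - ?S) \<le> lam * (Ent (E1 \<times> E2) (chE (B1 \<times> B2) (A1 \<times> A2) W12 \<tau>) - Ent E1 (chE B1 A1 W1 (ptrace2 A2 \<tau>)))"
    using environment_entropy_bound assms by (intro mult_left_mono) (simp_all add: sum_subtractf)
  have 3: "(\<Sum>y\<in>Y. cq_term lam B2 E2 A2 W2 (post A1 (v y) \<tau>)) = (lam - 1) * ?SB - lam * ?SE + ?S"
    unfolding cq_term_def by (simp only: sum.distrib sum_subtractf sum_distrib_left)
  show ?thesis unfolding 3 unfolding cq_term_def tr_on_ptrace
    using 1 2 unfolding right_diff_distrib left_diff_distrib mult_1 by linarith
qed

end

end

section \<open>Ensembles, their values and the additive bound\<close>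

definition cq_val :: "real \<Rightarrow> 'b set \<Rightarrow> 'e set \<Rightarrow> 'a set \<Rightarrow> ('b, 'e, 'a) kraus \<Rightarrow> 'x set \<Rightarrow> ('x \<Rightarrow> 'a \<Rightarrow> 'a \<Rightarrow> complex) \<Rightarrow> real" where
  "cq_val lam B E A W X \<tau> = Ent B (chB E A W (\<lambda>a a'. \<Sum>x\<in>X. \<tau> x a a')) + (\<Sum>x\<in>X. cq_term lam B E A W (\<tau> x))"

text \<open>An upper bound over all ensembles instead of a supremum, so boundedness is never an
  issue. Alphabets are initial segments of the naturals because a definition cannot range over index
  types; \<open>cq_boundD\<close> extends the bound to every finite alphabet.\<close>

definition cq_bound :: "real \<Rightarrow> 'b set \<Rightarrow> 'e set \<Rightarrow> 'a set \<Rightarrow> ('b, 'e, 'a) kraus \<Rightarrow> real \<Rightarrow> bool" where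
  "cq_bound lam B E A W f \<longleftrightarrow> (\<forall>(n::nat) \<tau>. (\<forall>x<n. psd_on A (\<tau> x)) \<longrightarrow> (\<Sum>x<n. tr_on A (\<tau> x)) = 1 \<longrightarrow> cq_val lam B E A W {..<n} \<tau> \<le> f)"

lemma cq_boundD:
  assumes b: "cq_bound lam B E A W f" and X: "finite X" and \<tau>: "\<And>x. x \<in> X \<Longrightarrow> psd_on A (\<tau> x)" "(\<Sum>x\<in>X. tr_on A (\<tau> x)) = 1"
  shows "cq_val lam B E A W X \<tau> \<le> f"
proof -
  obtain h where h: "bij_betw h {..<card X} X"
    using ex_bij_betw_nat_finite[OF X] by (auto simp: atLeast0LessThan)
  have s: "(\<Sum>x<card X. F (h x)) = (\<Sum>x\<in>X. F x)" for F :: "_ \<Rightarrow> 'zz::comm_monoid_add"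
    by (rule sum.reindex_bij_betw[OF h])
  have "\<forall>x<card X. psd_on A (\<tau> (h x))" using h \<tau>(1) by (auto simp: bij_betw_def)
  moreover have "(\<Sum>x<card X. tr_on A (\<tau> (h x))) = 1" using \<tau>(2) s[of "\<lambda>x. tr_on A (\<tau> x)"] by simp
  ultimately have "cq_val lam B E A W {..<card X} (\<lambda>x. \<tau> (h x)) \<le> f"
    using b[unfolded cq_bound_def, THEN HOL.spec[of _ "card X"], THEN HOL.spec[of _ "\<lambda>x. \<tau> (h x)"]] by blast
  then show ?thesis unfolding cq_val_def s[of "\<lambda>x. cq_term lam B E A W (\<tau> x)"] s[of "\<lambda>x. \<tau> x _ _"] .
qed

lemma ch_cong:
  assumes "\<And>a a'. a \<in> A \<Longrightarrow> a' \<in> A \<Longrightarrow> \<tau> a a' = \<tau>' a a'"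
  shows "chB E A W \<tau> = chB E A W \<tau>'" "chE B A W \<tau> = chE B A W \<tau>'" "tr_on A \<tau> = tr_on A \<tau>'"
  using assms by (auto simp: chB_def chE_def tr_on_def fun_eq_iff intro!: sum.cong)

lemma cq_val_cong:
  assumes "\<And>x a a'. x \<in> X \<Longrightarrow> a \<in> A \<Longrightarrow> a' \<in> A \<Longrightarrow> \<tau> x a a' = \<tau>' x a a'"
  shows "cq_val lam B E A W X \<tau> = cq_val lam B E A W X \<tau>'"
proof -
  have "chB E A W (\<lambda>a a'. \<Sum>x\<in>X. \<tau> x a a') = chB E A W (\<lambda>a a'. \<Sum>x\<in>X. \<tau>' x a a')"
    using assms by (intro ch_cong) simp
  moreover have "cq_term lam B E A W (\<tau> x) = cq_term lam B E A W (\<tau>' x)" if "x \<in> X" for x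
  proof -
    note a = assms[OF that]
    show ?thesis unfolding cq_term_def
      using ch_cong(1)[of A "\<tau> x" "\<tau>' x", OF a, where W = W] ch_cong(2)[of A "\<tau> x" "\<tau>' x", OF a, where W = W]
        ch_cong(3)[of A "\<tau> x" "\<tau>' x", OF a] by simp
  qed
  ultimately show ?thesis unfolding cq_val_def by simp
qed

lemma isoW_tensW:
  assumes "isoW B1 E1 A1 W1" "isoW B2 E2 A2 W2"
  shows "isoW (B1 \<times> B2) (E1 \<times> E2) (A1 \<times> A2) (tensW W1 W2)"
  unfolding isoW_def
proof (intro ballI)
  fix a a' assume a: "a \<in> A1 \<times> A2" "a' \<in> A1 \<times> A2"
  have "(\<Sum>b\<in>B1 \<times> B2. \<Sum>e\<in>E1 \<times> E2. tensW W1 W2 b e a * cnj (tensW W1 W2 b e a'))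
    = (\<Sum>b1\<in>B1. \<Sum>b2\<in>B2. (\<Sum>e1\<in>E1. W1 b1 e1 (fst a) * cnj (W1 b1 e1 (fst a'))) * (\<Sum>e2\<in>E2. W2 b2 e2 (snd a) * cnj (W2 b2 e2 (snd a'))))"
    unfolding sum_Times tensW_def sum_product by (simp add: mult_ac)
  also have "\<dots> = (\<Sum>b1\<in>B1. \<Sum>e1\<in>E1. W1 b1 e1 (fst a) * cnj (W1 b1 e1 (fst a'))) * (\<Sum>b2\<in>B2. \<Sum>e2\<in>E2. W2 b2 e2 (snd a) * cnj (W2 b2 e2 (snd a')))"
    by (rule sum_product[symmetric])
  also have "\<dots> = of_bool (a = a')"
    using a assms unfolding isoW_def by (auto simp: prod_eq_iff)
  finally show "(\<Sum>b\<in>B1 \<times> B2. \<Sum>e\<in>E1 \<times> E2. tensW W1 W2 b e a * cnj (tensW W1 W2 b e a')) = of_bool (a = a')" .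
qed

lemma ptrace_sum:
  "ptrace1 A (\<lambda>p q. \<Sum>x\<in>X. \<tau> x p q) = (\<lambda>a a'. \<Sum>x\<in>X. ptrace1 A (\<tau> x) a a')"
  "ptrace2 B (\<lambda>p q. \<Sum>x\<in>X. \<tau> x p q) = (\<lambda>a a'. \<Sum>x\<in>X. ptrace2 B (\<tau> x) a a')"
  unfolding ptrace1_def ptrace2_def fun_eq_iff by (intro allI sum.swap)+

text \<open>Completeness of the effects: forgetting the outcome of a measurement on the first input
  does not disturb the second.\<close>

lemma (in joint_channel) sum_post:
  "(\<Sum>y\<in>Y. post A1 (v y) \<tau> c c') = ptrace1 A1 \<tau> c c'"
proof -
  have "(\<Sum>y\<in>Y. post A1 (v y) \<tau> c c') = (\<Sum>a\<in>A1. \<Sum>a'\<in>A1. \<Sum>y\<in>Y. \<tau> (a, c) (a', c') * (cnj (v y a) * v y a'))"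
    unfolding post_def by (subst sum_swap3) (simp add: mult_ac)
  also have "\<dots> = (\<Sum>a\<in>A1. \<Sum>a'\<in>A1. \<tau> (a, c) (a', c') * of_bool (a = a'))"
    unfolding sum_distrib_left[symmetric]
    by (intro sum.cong refl) (simp only: hadW_complete[OF fin(3) had iso1])
  also have "\<dots> = ptrace1 A1 \<tau> c c'"
    unfolding ptrace1_def using fin by (intro sum.cong refl) (simp only: sum_delta_simps)
  finally show ?thesis .
qed

text \<open>The output entropy of the average splits by subadditivity, the letter terms by
  \<open>cq_term_subadditive\<close>. The second channel then receives the ensemble \<kappa> over
  letters and outcomes, whose average is the second marginal by \<open>sum_post\<close>.\<close>

lemma (in joint_channel) cq_bound_tensor:
  assumes lam: "1 \<le> lam" and b1: "cq_bound lam B1 E1 A1 W1 f1" and b2: "cq_bound lam B2 E2 A2 W2 f2"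
  shows "cq_bound lam (B1 \<times> B2) (E1 \<times> E2) (A1 \<times> A2) W12 (f1 + f2)"
  unfolding cq_bound_def
proof (intro allI impI)
  fix n :: nat and \<tau> :: "nat \<Rightarrow> ('a1 \<times> 'a2) op"
  assume p: "\<forall>x<n. psd_on (A1 \<times> A2) (\<tau> x)" and t: "(\<Sum>x<n. tr_on (A1 \<times> A2) (\<tau> x)) = 1"
  let ?X = "{..<n}"
  have finA: "finite (A1 \<times> A2)" using fin by simp
  have finY: "finite Y" using had by (simp add: hadW_def)
  define \<sigma> where "\<sigma> p q = (\<Sum>x<n. \<tau> x p q)" for p q
  have \<sigma>: "psd_on (A1 \<times> A2) \<sigma>" unfolding \<sigma>_def using p by (intro psd_on_sum) auto
  have \<sigma>t: "tr_on (A1 \<times> A2) \<sigma> = 1"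
    unfolding tr_on_def \<sigma>_def using t by (subst sum.swap) (simp add: tr_on_def)
  define \<kappa> where "\<kappa> z = post A1 (v (snd z)) (\<tau> (fst z))" for z
  have ex: "\<exists>\<Phi>. gram_on (A1 \<times> A2) (A1 \<times> A2) (\<tau> x) \<Phi>" if "x < n" for x
    using psd_on_imp_gram[OF finA] p that by blast
  have \<kappa>p: "psd_on A2 (\<kappa> z)" if "z \<in> ?X \<times> Y" for z
  proof -
    have z: "fst z < n" using that by auto
    obtain \<Phi> where "gram_on (A1 \<times> A2) (A1 \<times> A2) (\<tau> (fst z)) \<Phi>"
      using ex[OF z] ..
    from psd_post[OF finA this] show ?thesis unfolding \<kappa>_def .
  qed
  have g: "cq_term lam (B1 \<times> B2) (E1 \<times> E2) (A1 \<times> A2) W12 (\<tau> x)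
     \<le> cq_term lam B1 E1 A1 W1 (ptrace2 A2 (\<tau> x)) + (\<Sum>y\<in>Y. cq_term lam B2 E2 A2 W2 (\<kappa> (x, y)))" if x: "x < n" for x
  proof -
    obtain \<Phi> where "gram_on (A1 \<times> A2) (A1 \<times> A2) (\<tau> x) \<Phi>"
      using ex[OF x] ..
    from cq_term_subadditive[OF finA this lam] show ?thesis unfolding \<kappa>_def by simp
  qed
  obtain \<Phi> where \<Phi>: "gram_on (A1 \<times> A2) (A1 \<times> A2) \<sigma> \<Phi>"
    using psd_on_imp_gram[OF finA \<sigma>] ..
  let ?c = "chB (E1 \<times> E2) (A1 \<times> A2) W12 \<sigma>"
  have "psd_on (B1 \<times> B2) ?c" by (rule psd_on_ch(1)[OF finA \<sigma>])
  moreover have "tr_on (B1 \<times> B2) ?c = 1"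
    using tr_ch(1)[OF finA \<sigma> isoW_tensW[OF iso1 iso2]] \<sigma>t by simp
  ultimately have "Ent (B1 \<times> B2) ?c \<le> Ent B1 (ptrace2 B2 ?c) + Ent B2 (ptrace1 B1 ?c)"
    by (rule Ent_subadditive[OF fin(2,5)])
  also have "ptrace2 B2 ?c = chB E1 A1 W1 (\<lambda>a a'. \<Sum>x<n. ptrace2 A2 (\<tau> x) a a')"
    unfolding chB12_ptrace2[OF finA \<Phi>] unfolding \<sigma>_def ptrace_sum ..
  also have "ptrace1 B1 ?c = chB E2 A2 W2 (\<lambda>a a'. \<Sum>z\<in>?X \<times> Y. \<kappa> z a a')"
    unfolding chB12_ptrace1[OF finA \<Phi>] unfolding \<sigma>_def ptrace_sum sum_Times \<kappa>_def fst_conv snd_conv sum_post ..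
  finally have 1: "Ent (B1 \<times> B2) ?c \<le> Ent B1 (chB E1 A1 W1 (\<lambda>a a'. \<Sum>x<n. ptrace2 A2 (\<tau> x) a a'))
     + Ent B2 (chB E2 A2 W2 (\<lambda>a a'. \<Sum>z\<in>?X \<times> Y. \<kappa> z a a'))" .
  have "(\<Sum>x<n. cq_term lam (B1 \<times> B2) (E1 \<times> E2) (A1 \<times> A2) W12 (\<tau> x))
     \<le> (\<Sum>x<n. cq_term lam B1 E1 A1 W1 (ptrace2 A2 (\<tau> x)) + (\<Sum>y\<in>Y. cq_term lam B2 E2 A2 W2 (\<kappa> (x, y))))"
    using g by (intro sum_mono) auto
  also have "\<dots> = (\<Sum>x<n. cq_term lam B1 E1 A1 W1 (ptrace2 A2 (\<tau> x))) + (\<Sum>z\<in>?X \<times> Y. cq_term lam B2 E2 A2 W2 (\<kappa> z))"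
    by (simp only: sum.distrib sum_Times)
  finally have "cq_val lam (B1 \<times> B2) (E1 \<times> E2) (A1 \<times> A2) W12 ?X \<tau>
     \<le> cq_val lam B1 E1 A1 W1 ?X (\<lambda>x. ptrace2 A2 (\<tau> x)) + cq_val lam B2 E2 A2 W2 (?X \<times> Y) \<kappa>"
    using 1 unfolding cq_val_def \<sigma>_def by simp
  moreover have "cq_val lam B1 E1 A1 W1 ?X (\<lambda>x. ptrace2 A2 (\<tau> x)) \<le> f1"
    by (rule cq_boundD[OF b1]) (use p t fin in \<open>auto simp: tr_on_ptrace intro: psd_on_ptrace2\<close>)
  moreover have "cq_val lam B2 E2 A2 W2 (?X \<times> Y) \<kappa> \<le> f2"
  proof (rule cq_boundD[OF b2])
    show "finite (?X \<times> Y)" using finY by simp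
    show "psd_on A2 (\<kappa> z)" if "z \<in> ?X \<times> Y" for z by (rule \<kappa>p[OF that])
    have "(\<Sum>y\<in>Y. tr_on A2 (\<kappa> (x, y))) = tr_on (A1 \<times> A2) (\<tau> x)" for x
    proof -
      have "(\<Sum>y\<in>Y. \<Sum>c\<in>A2. \<kappa> (x, y) c c) = (\<Sum>c\<in>A2. ptrace1 A1 (\<tau> x) c c)"
        unfolding \<kappa>_def fst_conv snd_conv sum_post[symmetric] by (rule sum.swap)
      then have "(\<Sum>y\<in>Y. tr_on A2 (\<kappa> (x, y))) = tr_on A2 (ptrace1 A1 (\<tau> x))"
        unfolding tr_on_def Re_sum[of _ Y, symmetric] by (simp only:)
      then show ?thesis by (simp only: tr_on_ptrace)
    qed
    then show "(\<Sum>z\<in>?X \<times> Y. tr_on A2 (\<kappa> z)) = 1" unfolding sum_Times using t by simp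
  qed
  ultimately show "cq_val lam (B1 \<times> B2) (E1 \<times> E2) (A1 \<times> A2) W12 ?X \<tau> \<le> f1 + f2" by linarith
qed

section \<open>Relabelling of index sets\<close>

locale reindexing =
  fixes hb :: "'b1 \<Rightarrow> 'b" and he :: "'e1 \<Rightarrow> 'e" and ha :: "'a1 \<Rightarrow> 'a"
    and B1 B E1 E A1 A and W1 :: "('b1, 'e1, 'a1) kraus" and W :: "'b \<Rightarrow> 'e \<Rightarrow> 'a \<Rightarrow> complex"
  assumes hb: "bij_betw hb B1 B" and he: "bij_betw he E1 E" and ha: "bij_betw ha A1 A"
    and fin: "finite B" "finite E" "finite A"
    and W1: "\<And>b e a. b \<in> B1 \<Longrightarrow> e \<in> E1 \<Longrightarrow> a \<in> A1 \<Longrightarrow> W1 b e a = W (hb b) (he e) (ha a)"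
begin

lemma sums: "(\<Sum>b\<in>B. F b) = (\<Sum>b\<in>B1. F (hb b))" "(\<Sum>e\<in>E. G e) = (\<Sum>e\<in>E1. G (he e))" "(\<Sum>a\<in>A. H a) = (\<Sum>a\<in>A1. H (ha a))"
  by (simp_all add: sum.reindex_bij_betw[OF hb] sum.reindex_bij_betw[OF he] sum.reindex_bij_betw[OF ha])

lemma isoW_reindex: "isoW B1 E1 A1 W1 \<Longrightarrow> isoW B E A W"
proof -
  assume i: "isoW B1 E1 A1 W1"
  have "(\<Sum>b\<in>B. \<Sum>e\<in>E. W b e (ha a) * cnj (W b e (ha a'))) = of_bool (ha a = ha a')" if a: "a \<in> A1" "a' \<in> A1" for a a'
  proof -
    have "(\<Sum>b\<in>B. \<Sum>e\<in>E. W b e (ha a) * cnj (W b e (ha a'))) = (\<Sum>b\<in>B1. \<Sum>e\<in>E1. W1 b e a * cnj (W1 b e a'))"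
      unfolding sums using a by (intro sum.cong refl) (simp add: W1)
    then show ?thesis using i a ha unfolding isoW_def bij_betw_def inj_on_def by auto
  qed
  then show ?thesis unfolding isoW_def using ha by (auto simp: bij_betw_def)
qed

lemma cq_term_reindex:
  assumes "psd_on A \<tau>"
  shows "Ent B (chB E A W \<tau>) = Ent B1 (chB E1 A1 W1 (\<lambda>a a'. \<tau> (ha a) (ha a')))"
    "cq_term lam B E A W \<tau> = cq_term lam B1 E1 A1 W1 (\<lambda>a a'. \<tau> (ha a) (ha a'))"
proof -
  note h = psd_on_ch[OF fin(3) assms, THEN psd_on_hermitian]
  show 1: "Ent B (chB E A W \<tau>) = Ent B1 (chB E1 A1 W1 (\<lambda>a a'. \<tau> (ha a) (ha a')))"
    unfolding Ent_reindex[OF hb fin(1) h(1), symmetric]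
    by (rule Ent_cong) (auto simp: chB_def sums W1 intro!: sum.cong)
  have "Ent E (chE B A W \<tau>) = Ent E1 (chE B1 A1 W1 (\<lambda>a a'. \<tau> (ha a) (ha a')))"
    unfolding Ent_reindex[OF he fin(2) h(2), symmetric]
    by (rule Ent_cong) (auto simp: chE_def sums W1 intro!: sum.cong)
  then show "cq_term lam B E A W \<tau> = cq_term lam B1 E1 A1 W1 (\<lambda>a a'. \<tau> (ha a) (ha a'))"
    unfolding cq_term_def 1 tr_on_def sums by simp
qed

lemma cq_bound_reindex:
  assumes "cq_bound lam B1 E1 A1 W1 f"
  shows "cq_bound lam B E A W f"
  unfolding cq_bound_def
proof (intro allI impI)
  fix n :: nat and \<tau> assume p: "\<forall>x<n. psd_on A (\<tau> x)" and t: "(\<Sum>x<n. tr_on A (\<tau> x)) = 1"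
  let ?\<tau> = "\<lambda>x a a'. \<tau> x (ha a) (ha a')"
  have hA: "a \<in> A1 \<Longrightarrow> ha a \<in> A" for a using ha by (auto simp: bij_betw_def)
  have "cq_val lam B1 E1 A1 W1 {..<n} ?\<tau> \<le> f"
  proof (rule cq_boundD[OF assms finite_lessThan])
    show "psd_on A1 (?\<tau> x)" if "x \<in> {..<n}" for x
      using psd_on_pullback[OF fin(3), of "\<tau> x" A1 ha] p that hA by auto
    show "(\<Sum>x<n. tr_on A1 (?\<tau> x)) = 1" using t unfolding tr_on_def sums .
  qed
  also have "cq_val lam B1 E1 A1 W1 {..<n} ?\<tau> = cq_val lam B E A W {..<n} \<tau>"
  proof -
    have "psd_on A (\<lambda>a a'. \<Sum>x<n. \<tau> x a a')" using p by (intro psd_on_sum) auto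
    from cq_term_reindex(1)[OF this] show ?thesis
      unfolding cq_val_def using p by (simp add: cq_term_reindex(2))
  qed
  finally show "cq_val lam B E A W {..<n} \<tau> \<le> f" .
qed

end

section \<open>Information quantities of the matrix model\<close>

lemma digits_less: "i < m \<Longrightarrow> j < d \<Longrightarrow> i * d + j < m * (d :: nat)"
proof -
  assume ij: "i < m" "j < d"
  then have "i * d + j < Suc i * d" by simp
  also have "\<dots> \<le> m * d" using ij by (intro mult_le_mono1) simp
  finally show ?thesis .
qed

lemma bij_betw_digits: "bij_betw (\<lambda>p. fst p * d + snd p) ({..<m} \<times> {..<d}) {..<m * d :: nat}"
proof (rule bij_betw_byWitness[where f' = "\<lambda>k. (k div d, k mod d)"])
  show "(\<lambda>p. fst p * d + snd p) ` ({..<m} \<times> {..<d}) \<subseteq> {..<m * d}" by (auto intro: digits_less)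
  show "(\<lambda>k. (k div d, k mod d)) ` {..<m * d} \<subseteq> {..<m} \<times> {..<d}"
  proof safe
    fix k assume "k < m * d"
    then show "k div d < m" "k mod d < d"
      by (auto simp: less_mult_imp_div_less intro!: mod_less_divisor gr0I)
  qed
qed auto

lemma sum_digits: "(\<Sum>k<m * d. F k) = (\<Sum>i<m. \<Sum>j<(d::nat). F (i * d + j))"
  using sum.reindex_bij_betw[OF bij_betw_digits[of d m], of F] by (simp add: sum_Times)

lemma vN_reindex:
  assumes A: "A \<in> carrier_mat n n" and h: "bij_betw h J {..<n}"
    and f: "\<And>i j. i \<in> J \<Longrightarrow> j \<in> J \<Longrightarrow> A $$ (h i, h j) = f i j" and hf: "hermitian_on J f"
  shows "vN A = Ent J f"
proof -
  have im: "{..<n} = h ` J" using h by (simp add: bij_betw_def)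
  have herm: "hermitian_on {..<n} (\<lambda>i j. A $$ (i, j))"
    unfolding hermitian_on_def
  proof (intro ballI)
    fix i j assume "i \<in> {..<n}" "j \<in> {..<n}"
    then obtain k l where kl: "i = h k" "j = h l" "k \<in> J" "l \<in> J" unfolding im by blast
    then have "f l k = cnj (f k l)" using hf unfolding hermitian_on_def by blast
    then show "A $$ (j, i) = cnj (A $$ (i, j))" unfolding kl(1,2) f[OF kl(3,4)] f[OF kl(4,3)] .
  qed
  then have "vN A = Ent J (\<lambda>i j. A $$ (h i, h j))"
    using vN_eq_Ent[OF A herm] Ent_reindex[OF h finite_lessThan herm] by (simp only:)
  also have "\<dots> = Ent J f" by (rule Ent_cong[OF f])
  finally show ?thesis .
qed

lemma Ent_diagonal:
  assumes "finite I"
  shows "Ent I (\<lambda>i j. if i = j then of_real (d i) else 0) = (\<Sum>i\<in>I. eta (d i))"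
proof (rule Ent_eq[OF assms])
  have 1: "onb I (\<lambda>i j. of_bool (i = j))" using spec_id[OF assms] by (simp add: spec_def)
  have "(if i = j then of_real (d i) else 0) = (\<Sum>k\<in>I. complex_of_real (d k) * of_bool (i = k) * cnj (of_bool (j = k)))"
    if "i \<in> I" "j \<in> I" for i j
  proof -
    have "(\<Sum>k\<in>I. complex_of_real (d k) * of_bool (i = k) * cnj (of_bool (j = k))) = complex_of_real (d j) * of_bool (i = j)"
      using assms that by (simp only: cnj_of_bool sum_delta_simps)
    then show ?thesis by simp
  qed
  then show "spec I (\<lambda>i j. if i = j then of_real (d i) else 0) d (\<lambda>i j. of_bool (i = j))"
    unfolding spec_def using 1 by blast
qed

definition iso_fun :: "nat \<Rightarrow> complex mat \<Rightarrow> nat \<Rightarrow> nat \<Rightarrow> nat \<Rightarrow> complex" where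
  "iso_fun dE U b e a = U $$ (b * dE + e, a)"

text \<open>The information quantities of an admissible state depend only on these subnormalised inputs.\<close>

definition input_op :: "nat \<Rightarrow> nat \<Rightarrow> (nat \<Rightarrow> real) \<Rightarrow> (nat \<Rightarrow> complex vec) \<Rightarrow> nat \<Rightarrow> nat \<Rightarrow> nat \<Rightarrow> complex" where
  "input_op dA dR p \<phi> x a a' = of_real (p x) * (\<Sum>r<dR. \<phi> x $ (r * dA + a) * cnj (\<phi> x $ (r * dA + a')))"

lemma isoW_iso_fun:
  assumes U: "isometry dA dB dE U"
  shows "isoW {..<dB} {..<dE} {..<dA} (iso_fun dE U)"
  unfolding isoW_def
proof (intro ballI)
  fix a a' assume a: "a \<in> {..<dA}" "a' \<in> {..<dA}"
  have c: "U \<in> carrier_mat (dB * dE) dA" "adj U * U = 1\<^sub>m dA" using U by (auto simp: isometry_def)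
  have "of_bool (a = a') = (adj U * U) $$ (a', a)" using a c by auto
  also have "\<dots> = (\<Sum>i<dB * dE. cnj (U $$ (i, a')) * U $$ (i, a))"
    using a c(1) by (simp add: adj_def scalar_prod_def atLeast0LessThan)
  also have "\<dots> = (\<Sum>b<dB. \<Sum>e<dE. iso_fun dE U b e a * cnj (iso_fun dE U b e a'))"
    unfolding sum_digits iso_fun_def by (simp only: mult.commute)
  finally show "(\<Sum>b<dB. \<Sum>e<dE. iso_fun dE U b e a * cnj (iso_fun dE U b e a')) = of_bool (a = a')" by simp
qed

lemma conj_proj_index:
  assumes M: "M \<in> carrier_mat m n" and v: "v \<in> carrier_vec n" and ij: "i < m" "j < m"
  shows "(M * proj v * adj M) $$ (i, j) = (\<Sum>k<n. M $$ (i, k) * v $ k) * cnj (\<Sum>k<n. M $$ (j, k) * v $ k)"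
proof -
  have "(M * proj v * adj M) $$ (i, j) = (\<Sum>l<n. (\<Sum>k<n. M $$ (i, k) * (v $ k * cnj (v $ l))) * cnj (M $$ (j, l)))"
    using M v ij by (simp add: scalar_prod_def proj_def adj_def atLeast0LessThan)
  also have "\<dots> = (\<Sum>l<n. (\<Sum>k<n. M $$ (i, k) * v $ k) * cnj (M $$ (j, l) * v $ l))"
    by (intro sum.cong refl) (simp add: sum_distrib_left sum_distrib_right mult_ac)
  finally show ?thesis unfolding cnj_sum sum_distrib_left .
qed

lemma kron_carrier: "A \<in> carrier_mat m m' \<Longrightarrow> B \<in> carrier_mat n n' \<Longrightarrow> kron A B \<in> carrier_mat (m * n) (m' * n')"
  by (simp add: kron_def)

lemma kron_index:
  assumes "A \<in> carrier_mat m m'" "B \<in> carrier_mat n n'" "r < m" "r' < m'" "i < n" "j < n'"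
  shows "kron A B $$ (r * n + i, r' * n' + j) = A $$ (r, r') * B $$ (i, j)"
proof -
  have "r * n + i < m * n" "r' * n' + j < m' * n'" using assms by (auto intro: digits_less)
  then show ?thesis using assms unfolding kron_def by auto
qed

lemma state_index:
  assumes U: "U \<in> carrier_mat (dB * dE) dA" and P: "(n, p, dR, \<phi>) \<in> admissible dA"
    and x: "x < n" "x' < n" and r: "r < dR" "r' < dR" and i: "i < dB * dE" "i' < dB * dE"
  shows "state_XABE dB dE U (n, p, dR, \<phi>) $$ (x * (dR * (dB * dE)) + (r * (dB * dE) + i), x' * (dR * (dB * dE)) + (r' * (dB * dE) + i'))
    = (if x = x' then of_real (p x) * (\<Sum>a<dA. U $$ (i, a) * \<phi> x $ (r * dA + a)) * cnj (\<Sum>a<dA. U $$ (i', a) * \<phi> x $ (r' * dA + a)) else 0)"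
proof -
  let ?m = "dB * dE" let ?M = "kron (1\<^sub>m dR) U" let ?D = "dR * (dB * dE)"
  have \<phi>: "\<phi> y \<in> carrier_vec (dR * dA)" if "y < n" for y using P that by (auto simp: admissible_def)
  have M: "?M \<in> carrier_mat ?D (dR * dA)" using U by (simp add: kron_def)
  have I: "r * ?m + i < ?D" "r' * ?m + i' < ?D" using r i by (auto intro: digits_less)
  have X: "x * ?D + (r * ?m + i) < n * ?D" "x' * ?D + (r' * ?m + i') < n * ?D" using x I by (auto intro: digits_less)
  have Mv: "(\<Sum>k<dR * dA. ?M $$ (s * ?m + j, k) * \<phi> y $ k) = (\<Sum>a<dA. U $$ (j, a) * \<phi> y $ (s * dA + a))"
    if s: "s < dR" "j < ?m" for s j y
  proof -
    have "(\<Sum>k<dR * dA. ?M $$ (s * ?m + j, k) * \<phi> y $ k) = (\<Sum>q<dR. \<Sum>a<dA. of_bool (s = q) * (U $$ (j, a) * \<phi> y $ (q * dA + a)))"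
      unfolding sum_digits by (intro sum.cong refl) (simp add: kron_index[OF one_carrier_mat U] s)
    also have "\<dots> = (\<Sum>a<dA. U $$ (j, a) * \<phi> y $ (s * dA + a))"
      using s by (simp only: sum_distrib_left[symmetric] sum_delta_simps finite_lessThan lessThan_iff)
    finally show ?thesis .
  qed
  have c: "?M * proj (\<phi> y) * adj ?M \<in> carrier_mat ?D ?D" if "y < n" for y
    using M by (auto simp: adj_def)
  have pk: "proj (ket n y) \<in> carrier_mat n n" for y by (simp add: proj_def ket_def)
  let ?K = "\<lambda>y. kron (proj (ket n y)) (?M * proj (\<phi> y) * adj ?M)"
  have K: "?K y $$ (x * ?D + (r * ?m + i), x' * ?D + (r' * ?m + i')) = of_bool (x = y) * (of_bool (x' = y) *
     ((\<Sum>a<dA. U $$ (i, a) * \<phi> y $ (r * dA + a)) * cnj (\<Sum>a<dA. U $$ (i', a) * \<phi> y $ (r' * dA + a))))" if y: "y < n" for y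
  proof -
    have c: "?M * proj (\<phi> y) * adj ?M \<in> carrier_mat ?D ?D" by (rule c[OF y])
    have "?K y $$ (x * ?D + (r * ?m + i), x' * ?D + (r' * ?m + i')) =
       proj (ket n y) $$ (x, x') * (?M * proj (\<phi> y) * adj ?M) $$ (r * ?m + i, r' * ?m + i')"
      by (rule kron_index[OF pk c x I])
    also have "proj (ket n y) $$ (x, x') = of_bool (x = y) * of_bool (x' = y)"
      using x by (auto simp: proj_def ket_def)
    finally show ?thesis unfolding conj_proj_index[OF M \<phi>[OF y] I] using r i by (simp add: Mv)
  qed
  have "state_XABE dB dE U (n, p, dR, \<phi>) $$ (x * ?D + (r * ?m + i), x' * ?D + (r' * ?m + i'))
     = (\<Sum>y<n. (complex_of_real (p y) \<cdot>\<^sub>m ?K y) $$ (x * ?D + (r * ?m + i), x' * ?D + (r' * ?m + i')))"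
    unfolding state_XABE_def msum_def using X by simp
  also have "\<dots> = (\<Sum>y<n. complex_of_real (p y) * ?K y $$ (x * ?D + (r * ?m + i), x' * ?D + (r' * ?m + i')))"
  proof (intro sum.cong refl)
    fix y assume "y \<in> {..<n}"
    then have "?K y \<in> carrier_mat (n * ?D) (n * ?D)" by (intro kron_carrier pk c) simp
    then show "(complex_of_real (p y) \<cdot>\<^sub>m ?K y) $$ (x * ?D + (r * ?m + i), x' * ?D + (r' * ?m + i')) =
      complex_of_real (p y) * ?K y $$ (x * ?D + (r * ?m + i), x' * ?D + (r' * ?m + i'))" using X by auto
  qed
  also have "\<dots> = (\<Sum>y<n. of_bool (x = y) * (of_bool (x' = y) * (of_real (p y) *
     ((\<Sum>a<dA. U $$ (i, a) * \<phi> y $ (r * dA + a)) * cnj (\<Sum>a<dA. U $$ (i', a) * \<phi> y $ (r' * dA + a))))))"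
    by (intro sum.cong refl, simp only: K lessThan_iff, simp only: mult_ac)
  also have "\<dots> = of_bool (x' = x) * (of_real (p x) *
     ((\<Sum>a<dA. U $$ (i, a) * \<phi> x $ (r * dA + a)) * cnj (\<Sum>a<dA. U $$ (i', a) * \<phi> x $ (r' * dA + a))))"
    using x by (simp only: sum_delta_simps finite_lessThan lessThan_iff)
  finally show ?thesis by (auto simp: mult.assoc)
qed

lemma ptrace_mid_index:
  assumes "i1 < d1" "i3 < d3" "j1 < d1" "j3 < d3"
  shows "ptrace_mid d1 d2 d3 M $$ (i1 * d3 + i3, j1 * d3 + j3)
    = (\<Sum>k<d2. M $$ (i1 * (d2 * d3) + k * d3 + i3, j1 * (d2 * d3) + k * d3 + j3))"
  unfolding ptrace_mid_def using assms digits_less[of i1 d1 i3 d3] digits_less[of j1 d1 j3 d3] by simp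

lemma ptrace_right_index:
  assumes "i < d1" "j < d1"
  shows "ptrace_right d1 d2 M $$ (i, j) = (\<Sum>k<d2. M $$ (i * d2 + k, j * d2 + k))"
  using ptrace_mid_index[of i d1 0 1 j 0 d2 M] assms by simp

lemma ptrace_left_index:
  assumes "i < d2" "j < d2"
  shows "ptrace_left d1 d2 M $$ (i, j) = (\<Sum>k<d1. M $$ (k * d2 + i, k * d2 + j))"
  using ptrace_mid_index[of 0 1 i d2 0 j d1 M] assms by simp

lemma input_op_psd: "0 \<le> p x \<Longrightarrow> psd_on A (input_op dA dR p \<phi> x)"
proof (rule psd_on_gram[where R = "{..<dR}" and \<Phi> = "\<lambda>a r. of_real (sqrt (p x)) * \<phi> x $ (r * dA + a)"])
  assume p: "0 \<le> p x"
  have "complex_of_real (p x) = of_real (sqrt (p x)) * of_real (sqrt (p x))"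
    unfolding of_real_mult[symmetric] using p by simp
  then show "input_op dA dR p \<phi> x a a' = (\<Sum>r<dR. of_real (sqrt (p x)) * \<phi> x $ (r * dA + a) * cnj (of_real (sqrt (p x)) * \<phi> x $ (r * dA + a')))" for a a'
    unfolding input_op_def sum_distrib_left by (simp add: mult_ac)
qed

lemma admissible_input:
  assumes P: "(n, p, dR, \<phi>) \<in> admissible dA"
  shows "\<And>x. x < n \<Longrightarrow> psd_on {..<dA} (input_op dA dR p \<phi> x)"
    "\<And>x. x < n \<Longrightarrow> tr_on {..<dA} (input_op dA dR p \<phi> x) = p x"
    "(\<Sum>x<n. tr_on {..<dA} (input_op dA dR p \<phi> x)) = 1"
proof -
  show "psd_on {..<dA} (input_op dA dR p \<phi> x)" if "x < n" for x
    using P that by (intro input_op_psd) (auto simp: admissible_def)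
  show tr: "tr_on {..<dA} (input_op dA dR p \<phi> x) = p x" if "x < n" for x
  proof -
    have "vnorm2 (\<phi> x) = 1" "dim_vec (\<phi> x) = dR * dA" using P that by (auto simp: admissible_def)
    then have 1: "(\<Sum>r<dR. \<Sum>a<dA. (cmod (\<phi> x $ (r * dA + a)))\<^sup>2) = 1" unfolding vnorm2_def by (simp add: sum_digits)
    have "(\<Sum>a<dA. input_op dA dR p \<phi> x a a) = of_real (p x) * (\<Sum>a<dA. \<Sum>r<dR. of_real ((cmod (\<phi> x $ (r * dA + a)))\<^sup>2))"
      unfolding input_op_def complex_norm_square[symmetric] by (simp only: sum_distrib_left)
    also have "\<dots> = of_real (p x * (\<Sum>r<dR. \<Sum>a<dA. (cmod (\<phi> x $ (r * dA + a)))\<^sup>2))"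
      by (subst sum.swap) simp
    finally show ?thesis unfolding tr_on_def 1 by simp
  qed
  show "(\<Sum>x<n. tr_on {..<dA} (input_op dA dR p \<phi> x)) = 1"
    using tr P by (simp add: admissible_def)
qed

text \<open>Marginals that keep X are block diagonal, so their entropies are sums over letters.
  Within a block the vector on A, B, E is pure, so the entropy of AB is that of E, which eliminates
  the reference.\<close>

lemma information_quantities:
  assumes U: "isometry dA dB dE U" and P: "(n, p, dR, \<phi>) \<in> admissible dA"
  defines "\<tau> \<equiv> input_op dA dR p \<phi>" and "W \<equiv> iso_fun dE U"
  shows "mutual_XB dB dE U (n, p, dR, \<phi>) = (\<Sum>x<n. eta (p x))
      + Ent {..<dB} (chB {..<dE} {..<dA} W (\<lambda>a a'. \<Sum>x<n. \<tau> x a a')) - (\<Sum>x<n. Ent {..<dB} (chB {..<dE} {..<dA} W (\<tau> x)))"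
    and "coh_info dB dE U (n, p, dR, \<phi>) = (\<Sum>x<n. Ent {..<dB} (chB {..<dE} {..<dA} W (\<tau> x)))
      - (\<Sum>x<n. Ent {..<dE} (chE {..<dB} {..<dA} W (\<tau> x)))"
proof -
  let ?B = "chB {..<dE} {..<dA} W" and ?\<tau> = "\<lambda>a a'. \<Sum>x<n. \<tau> x a a'"
    and ?E = "chE {..<dB} {..<dA} W"
  have Uc: "U \<in> carrier_mat (dB * dE) dA" using U by (simp add: isometry_def)
  have p0: "0 \<le> p x" if "x < n" for x using P that by (auto simp: admissible_def)
  note psd\<tau> = admissible_input(1)[OF P, folded \<tau>_def]
  \<comment> \<open>The probability is absorbed into the purification, which makes every block a
    subnormalised vector.\<close>
  define \<Phi> where "\<Phi> x a r = of_real (sqrt (p x)) * \<phi> x $ (r * dA + a)" for x a r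
  have sq: "complex_of_real (p x) = of_real (sqrt (p x)) * of_real (sqrt (p x))" if "x < n" for x
    unfolding of_real_mult[symmetric] using p0[OF that] by simp
  have gram: "\<forall>a\<in>{..<dA}. \<forall>a'\<in>{..<dA}. \<tau> x a a' = (\<Sum>r<dR. \<Phi> x a r * cnj (\<Phi> x a' r))" if "x < n" for x
    unfolding \<tau>_def input_op_def sum_distrib_left \<Phi>_def by (simp add: sq[OF that] mult_ac)
  define \<psi> where "\<psi> x b e r = amp {..<dA} W (\<Phi> x) b e r" for x b e r
  let ?S = "state_XABE dB dE U (n, p, dR, \<phi>)"
  define XAB where "XAB = ptrace_right (n * dR * dB) dE ?S"
  define XB where "XB = ptrace_mid n dR dB XAB"
  define rX where "rX = ptrace_right n dB XB"
  define rB where "rB = ptrace_left n dB XB"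
  have c: "XAB \<in> carrier_mat (n * (dR * dB)) (n * (dR * dB))" "XB \<in> carrier_mat (n * dB) (n * dB)" "rX \<in> carrier_mat n n" "rB \<in> carrier_mat dB dB"
    by (auto simp: XAB_def XB_def rX_def rB_def ptrace_mid_def mult_ac)
  have XAB: "XAB $$ (x * (dR * dB) + (r * dB + b), x' * (dR * dB) + (r' * dB + b'))
      = (if x = x' then \<Sum>e<dE. \<psi> x b e r * cnj (\<psi> x b' e r') else 0)"
    if "x < n" "x' < n" "r < dR" "r' < dR" "b < dB" "b' < dB" for x x' r r' b b'
  proof -
    have l: "r * dB + b < dR * dB" "r' * dB + b' < dR * dB" using that by (auto intro: digits_less)
    have l2: "x * (dR * dB) + (r * dB + b) < n * dR * dB" "x' * (dR * dB) + (r' * dB + b') < n * dR * dB"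
      using digits_less[OF that(1) l(1)] digits_less[OF that(2) l(2)] by (simp_all only: mult.assoc)
    have "XAB $$ (x * (dR * dB) + (r * dB + b), x' * (dR * dB) + (r' * dB + b'))
      = (\<Sum>e<dE. ?S $$ ((x * (dR * dB) + (r * dB + b)) * dE + e, (x' * (dR * dB) + (r' * dB + b')) * dE + e))"
      unfolding XAB_def by (rule ptrace_right_index[OF l2])
    also have "\<dots> = (\<Sum>e<dE. if x = x' then \<psi> x b e r * cnj (\<psi> x b' e r') else 0)"
    proof (intro sum.cong refl)
      fix e assume "e \<in> {..<dE}"
      then have e: "b * dE + e < dB * dE" "b' * dE + e < dB * dE" using that by (auto intro: digits_less)
      have q: "(y * (dR * dB) + (s * dB + c)) * dE + e = y * (dR * (dB * dE)) + (s * (dB * dE) + (c * dE + e))" for y s c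
        by (simp add: algebra_simps)
      have am: "\<psi> x c e s = of_real (sqrt (p x)) * (\<Sum>a<dA. U $$ (c * dE + e, a) * \<phi> x $ (s * dA + a))" for c s
        unfolding \<psi>_def amp_def W_def iso_fun_def \<Phi>_def sum_distrib_left by (simp only: mult_ac)
      show "?S $$ ((x * (dR * dB) + (r * dB + b)) * dE + e, (x' * (dR * dB) + (r' * dB + b')) * dE + e)
         = (if x = x' then \<psi> x b e r * cnj (\<psi> x b' e r') else 0)"
        unfolding q state_index[OF Uc P that(1-4) e] am complex_cnj_mult sq[OF that(1)]
        by (simp only: mult_ac complex_cnj_complex_of_real)
    qed
    finally show ?thesis by simp
  qed
  have XB: "XB $$ (x * dB + b, x' * dB + b') = (if x = x' then ?B (\<tau> x) b b' else 0)"
    if "x < n" "x' < n" "b < dB" "b' < dB" for x x' b b'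
  proof -
    have "XB $$ (x * dB + b, x' * dB + b') = (\<Sum>r<dR. XAB $$ (x * (dR * dB) + (r * dB + b), x' * (dR * dB) + (r * dB + b')))"
      unfolding XB_def using ptrace_mid_index[OF that(1,3,2,4)] by (simp only: add.assoc)
    also have "\<dots> = (\<Sum>r<dR. if x = x' then \<Sum>e<dE. \<psi> x b e r * cnj (\<psi> x b' e r) else 0)"
      using that by (intro sum.cong refl) (simp add: XAB)
    also have "\<dots> = (if x = x' then ?B (\<tau> x) b b' else 0)"
      unfolding ch_gram(1)[OF gram[OF that(1)]] \<psi>_def by (simp add: sum.swap[of _ "{..<dE}"])
    finally show ?thesis .
  qed
  have rX: "rX $$ (x, x') = (if x = x' then of_real (p x) else 0)" if "x < n" "x' < n" for x x'
  proof -
    have "rX $$ (x, x') = (\<Sum>b<dB. XB $$ (x * dB + b, x' * dB + b))"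
      unfolding rX_def by (rule ptrace_right_index[OF that])
    also have "\<dots> = (\<Sum>b<dB. if x = x' then ?B (\<tau> x) b b else 0)"
      using that by (intro sum.cong refl) (simp add: XB)
    also have "\<dots> = (if x = x' then (\<Sum>b<dB. ?B (\<tau> x) b b) else 0)" by simp
    also have "(\<Sum>b<dB. ?B (\<tau> x) b b) = of_real (p x)"
    proof -
      have "psd_on {..<dB} (?B (\<tau> x))"
        by (rule psd_on_ch(1)[OF finite_lessThan psd\<tau>[OF that(1)]])
      from psd_trace[OF finite_lessThan this] show ?thesis
        using tr_ch(1)[OF finite_lessThan psd\<tau>[OF that(1)] isoW_iso_fun[OF U], folded W_def]
          admissible_input(2)[OF P that(1), folded \<tau>_def] by (simp only:)
    qed
    finally show ?thesis .
  qed
  have rB: "rB $$ (b, b') = ?B ?\<tau> b b'" if "b < dB" "b' < dB" for b b'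
  proof -
    have "rB $$ (b, b') = (\<Sum>x<n. XB $$ (x * dB + b, x * dB + b'))"
      unfolding rB_def by (rule ptrace_left_index[OF that])
    also have "\<dots> = (\<Sum>x<n. ?B (\<tau> x) b b')"
      using that by (intro sum.cong refl) (simp add: XB)
    finally show ?thesis by (simp only: chB_sum)
  qed
  have hB: "hermitian_on {..<dB} (?B (\<tau> x))" if "x < n" for x
    by (rule psd_on_hermitian[OF psd_on_ch(1)[OF finite_lessThan psd\<tau>[OF that]]])
  have vX: "vN rX = (\<Sum>x<n. eta (p x))"
    using vN_reindex[OF c(3), of id "{..<n}" "\<lambda>x x'. if x = x' then of_real (p x) else 0"] rX Ent_diagonal[of "{..<n}" p]
    by (simp add: hermitian_on_def)
  have vB: "vN rB = Ent {..<dB} (?B ?\<tau>)"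
  proof (rule vN_reindex[OF c(4), where h = id])
    have "psd_on {..<dA} (\<lambda>a a'. \<Sum>x<n. \<tau> x a a')" by (rule psd_on_sum) (simp add: psd\<tau>)
    then show "hermitian_on {..<dB} (?B ?\<tau>)"
      by (intro psd_on_hermitian psd_on_ch) simp_all
  qed (simp_all add: rB)
  have block_herm: "hermitian_on ({..<n} \<times> J) (\<lambda>p q. if fst p = fst q then f (fst p) (snd p) (snd q) else 0)"
    if "\<And>x. x < n \<Longrightarrow> hermitian_on J (f x)" for f and J :: "'z set"
    unfolding hermitian_on_def
  proof (intro ballI)
    fix s t assume st: "s \<in> {..<n} \<times> J" "t \<in> {..<n} \<times> J"
    then have "hermitian_on J (f (fst s))" by (intro that) auto
    then have "f (fst s) (snd t) (snd s) = cnj (f (fst s) (snd s) (snd t))"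
      using st[THEN mem_Times_iff[THEN iffD1]] unfolding hermitian_on_def by blast
    then show "(if fst t = fst s then f (fst t) (snd t) (snd s) else 0) = cnj (if fst s = fst t then f (fst s) (snd s) (snd t) else 0)"
      by auto
  qed
  have vXB: "vN XB = (\<Sum>x<n. Ent {..<dB} (?B (\<tau> x)))"
  proof -
    have "vN XB = Ent ({..<n} \<times> {..<dB}) (\<lambda>p q. if fst p = fst q then ?B (\<tau> (fst p)) (snd p) (snd q) else 0)"
      by (rule vN_reindex[OF c(2) bij_betw_digits]) (use XB block_herm[OF hB] in auto)
    then show ?thesis using Ent_block_diagonal[of "{..<n}" "{..<dB}" "\<lambda>x. ?B (\<tau> x)"] hB by simp
  qed
  define g where "g x s t = (\<Sum>e<dE. \<psi> x (snd s) e (fst s) * cnj (\<psi> x (snd t) e (fst t)))" for x s t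
  have hg: "hermitian_on J (g x)" for J x
    by (rule psd_on_hermitian[OF psd_on_gram[where R = "{..<dE}" and \<Phi> = "\<lambda>s e. \<psi> x (snd s) e (fst s)"]]) (simp add: g_def)
  let ?h = "\<lambda>q. fst q * (dR * dB) + (fst (snd q) * dB + snd (snd q))"
  have h: "bij_betw ?h ({..<n} \<times> ({..<dR} \<times> {..<dB})) {..<n * (dR * dB)}"
  proof -
    have 1: "bij_betw (map_prod id (\<lambda>p. fst p * dB + snd p)) ({..<n} \<times> ({..<dR} \<times> {..<dB})) ({..<n} \<times> {..<dR * dB})"
      by (rule bij_betw_map_prod[OF bij_betw_id bij_betw_digits])
    have "?h = (\<lambda>p. fst p * (dR * dB) + snd p) \<circ> map_prod id (\<lambda>p. fst p * dB + snd p)" by (auto simp: fun_eq_iff)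
    then show ?thesis using bij_betw_trans[OF 1 bij_betw_digits] by simp
  qed
  have vXAB: "vN XAB = (\<Sum>x<n. Ent {..<dE} (?E (\<tau> x)))"
  proof -
    have "vN XAB = Ent ({..<n} \<times> ({..<dR} \<times> {..<dB})) (\<lambda>p q. if fst p = fst q then g (fst p) (snd p) (snd q) else 0)"
      by (rule vN_reindex[OF c(1) h]) (use XAB block_herm[OF hg] in \<open>auto simp: g_def\<close>)
    also have "\<dots> = (\<Sum>x<n. Ent ({..<dR} \<times> {..<dB}) (g x))"
      by (rule Ent_block_diagonal) (use hg in auto)
    also have "\<dots> = (\<Sum>x<n. Ent {..<dE} (?E (\<tau> x)))"
    proof (intro sum.cong refl)
      fix x assume "x \<in> {..<n}"
      then have x: "x < n" by simp
      have "Ent ({..<dR} \<times> {..<dB}) (g x) = Ent {..<dE} (\<lambda>e e'. \<Sum>s\<in>{..<dR} \<times> {..<dB}. \<psi> x (snd s) e (fst s) * cnj (\<psi> x (snd s) e' (fst s)))"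
        unfolding g_def by (rule Ent_gram_swap) auto
      also have "\<dots> = Ent {..<dE} (?E (\<tau> x))"
      proof (rule Ent_cong)
        fix e e'
        show "(\<Sum>s\<in>{..<dR} \<times> {..<dB}. \<psi> x (snd s) e (fst s) * cnj (\<psi> x (snd s) e' (fst s))) = ?E (\<tau> x) e e'"
          unfolding ch_gram(2)[OF gram[OF x]] sum_Times \<psi>_def fst_conv snd_conv by (rule sum.swap)
      qed
      finally show "Ent ({..<dR} \<times> {..<dB}) (g x) = Ent {..<dE} (?E (\<tau> x))" .
    qed
    finally show ?thesis .
  qed
  have "mutual_XB dB dE U (n, p, dR, \<phi>) = vN rX + vN rB - vN XB"
    unfolding mutual_XB_def Let_def prod.case rX_def rB_def XB_def XAB_def ..
  then show "mutual_XB dB dE U (n, p, dR, \<phi>) = (\<Sum>x<n. eta (p x))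
      + Ent {..<dB} (?B ?\<tau>) - (\<Sum>x<n. Ent {..<dB} (?B (\<tau> x)))"
    unfolding vX vB vXB .
  have "coh_info dB dE U (n, p, dR, \<phi>) = vN XB - vN XAB"
    unfolding coh_info_def Let_def prod.case XB_def XAB_def ..
  then show "coh_info dB dE U (n, p, dR, \<phi>) = (\<Sum>x<n. Ent {..<dB} (?B (\<tau> x)))
      - (\<Sum>x<n. Ent {..<dE} (?E (\<tau> x)))"
    unfolding vXB vXAB .
qed

text \<open>Polarisation with test vectors having entries 1 at \<open>i\<close> and \<open>c\<close>
  at \<open>j\<close>. \<open>psd\<close> demands only that the form be real and nonnegative,
  whereas \<open>psd_on\<close> asks for Hermiticity.\<close>

lemma hermitian_on_real_form:
  assumes fin: "finite I" and im: "\<And>x. Im (\<Sum>i\<in>I. \<Sum>j\<in>I. cnj (x i) * f i j * x j) = 0"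
  shows "hermitian_on I f"
  unfolding hermitian_on_def
proof (intro ballI)
  fix i j assume ij: "i \<in> I" "j \<in> I"
  have form: "Im (f i i + c * f i j + cnj c * f j i + cnj c * c * f j j) = 0" for c
  proof -
    let ?x = "\<lambda>k. of_bool (k = i) + c * of_bool (k = j)"
    have "(\<Sum>k\<in>I. \<Sum>l\<in>I. cnj (?x k) * f k l * ?x l) = (\<Sum>k\<in>I. (f k i + c * f k j) * (of_bool (k = i) + cnj c * of_bool (k = j)))"
    proof (intro sum.cong refl)
      fix k assume "k \<in> I"
      define K where "K = cnj (?x k)"
      have "(\<Sum>l\<in>I. K * f k l * ?x l) = (\<Sum>l\<in>I. (K * f k l) * of_bool (l = i) + (K * f k l * c) * of_bool (l = j))"
        by (intro sum.cong refl) (simp only: distrib_left mult.assoc)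
      also have "\<dots> = K * f k i + K * f k j * c"
        unfolding sum.distrib using fin ij by (simp only: sum_delta_simps)
      also have "\<dots> = (f k i + c * f k j) * K" by (simp add: algebra_simps)
      finally show "(\<Sum>l\<in>I. cnj (?x k) * f k l * ?x l) = (f k i + c * f k j) * (of_bool (k = i) + cnj c * of_bool (k = j))"
        unfolding K_def by (simp only: complex_cnj_add complex_cnj_mult cnj_of_bool)
    qed
    also have "\<dots> = (\<Sum>k\<in>I. (f k i + c * f k j) * of_bool (k = i) + ((f k i + c * f k j) * cnj c) * of_bool (k = j))"
      by (simp only: distrib_left mult.assoc)
    also have "\<dots> = (f i i + c * f i j) + (f j i + c * f j j) * cnj c"
      unfolding sum.distrib using fin ij by (simp only: sum_delta_simps)
    finally have "(\<Sum>k\<in>I. \<Sum>l\<in>I. cnj (?x k) * f k l * ?x l) = f i i + c * f i j + cnj c * f j i + cnj c * c * f j j"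
      by (simp add: algebra_simps)
    then show ?thesis using im[of ?x] by simp
  qed
  have "Im (f i i) = 0" "Im (f i i + f i j + f j i + f j j) = 0" "Im (f i i + f i j * \<i> - \<i> * f j i + f j j) = 0"
    using form[of 0] form[of 1] form[of \<i>] by (simp_all add: mult.commute)
  \<comment> \<open>\<open>c = 2\<close> weighs the diagonal entry at \<open>j\<close> by 4 and the
    off-diagonal part by 2; compared with \<open>c = 1\<close> this separates the two.\<close>
  moreover have "Im (f j j) = 0"
  proof -
    have "Im (f i i + 2 * f i j + 2 * f j i + 4 * f j j) = 0" using form[of 2] by simp
    then show ?thesis using form[of 0] form[of 1] by simp
  qed
  ultimately show "f j i = cnj (f i j)" by (simp add: complex_eq_iff)
qed

lemma psd_imp_psd_on:
  assumes "psd n M"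
  shows "psd_on {..<n} (\<lambda>i j. M $$ (i, j))"
proof -
  have M: "M \<in> carrier_mat n n" using assms by (simp add: psd_def)
  have form: "(\<Sum>i<n. \<Sum>j<n. cnj (x i) * M $$ (i, j) * x j) = conjugate (vec n x) \<bullet> (M *\<^sub>v vec n x)" for x
    using M by (simp add: scalar_prod_def atLeast0LessThan sum_distrib_left mult.assoc)
  have p: "Im (\<Sum>i<n. \<Sum>j<n. cnj (x i) * M $$ (i, j) * x j) = 0" "0 \<le> Re (\<Sum>i<n. \<Sum>j<n. cnj (x i) * M $$ (i, j) * x j)" for x
    unfolding form using assms unfolding psd_def Let_def by (simp_all only: vec_carrier)
  show ?thesis
    unfolding psd_on_def using hermitian_on_real_form[OF finite_lessThan p(1)] p(2) by blast
qed

text \<open>Each effect splits into the rank-one effects of its Gram factorisation, all with the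
  same prepared state; the outcome becomes a pair of y and the factor index. Rank one is what keeps
  the branches in the entropy bounds pure.\<close>

lemma hadamard_hadW:
  assumes U: "isometry dA dB dE U" and h: "hadamard dA dB dE U"
  obtains Y :: "(nat \<times> nat) set" and v \<omega> where "hadW {..<dB} {..<dE} {..<dA} (iso_fun dE U) Y v \<omega>"
proof -
  have Uc: "U \<in> carrier_mat (dB * dE) dA" using U by (simp add: isometry_def)
  obtain Y :: "nat set" and \<Lambda> \<omega> where Y: "finite Y" and pd: "\<forall>y\<in>Y. psd dA (\<Lambda> y) \<and> density dE (\<omega> y)"
    and ch: "\<forall>\<sigma>\<in>carrier_mat dA dA. complementary dB dE U \<sigma> = msum dE dE (\<lambda>y. mtrace (\<Lambda> y * \<sigma>) \<cdot>\<^sub>m \<omega> y) Y"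
    using h unfolding hadamard_def entanglement_breaking_def by blast
  have "\<forall>y\<in>Y. \<exists>\<Phi>. \<forall>i\<in>{..<dA}. \<forall>j\<in>{..<dA}. \<Lambda> y $$ (i, j) = (\<Sum>k<dA. \<Phi> i k * cnj (\<Phi> j k))"
    using psd_on_imp_gram[OF finite_lessThan psd_imp_psd_on] pd by blast
  from bchoice[OF this] obtain \<Phi> where \<Phi>: "\<forall>y\<in>Y. \<forall>i\<in>{..<dA}. \<forall>j\<in>{..<dA}. \<Lambda> y $$ (i, j) = (\<Sum>k<dA. \<Phi> y i k * cnj (\<Phi> y j k))" ..
  have "hadW {..<dB} {..<dE} {..<dA} (iso_fun dE U) (Y \<times> {..<dA}) (\<lambda>z a. \<Phi> (fst z) a (snd z)) (\<lambda>z e e'. \<omega> (fst z) $$ (e, e'))"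
    unfolding hadW_def
  proof (intro conjI ballI)
    show "finite (Y \<times> {..<dA})" using Y by simp
    fix z assume z: "z \<in> Y \<times> {..<dA}"
    then have d: "density dE (\<omega> (fst z))" using pd by auto
    then show "psd_on {..<dE} (\<lambda>e e'. \<omega> (fst z) $$ (e, e'))" by (auto simp: density_def intro: psd_imp_psd_on)
    have "\<omega> (fst z) \<in> carrier_mat dE dE" using d by (simp add: density_def psd_def)
    then show "tr_on {..<dE} (\<lambda>e e'. \<omega> (fst z) $$ (e, e')) = 1"
      using d by (simp add: tr_on_def density_def mtrace_def)
  next
    fix a a' e e' assume a: "a \<in> {..<dA}" "a' \<in> {..<dA}" and e: "e \<in> {..<dE}" "e' \<in> {..<dE}"
    \<comment> \<open>A matrix unit: on it the measure-and-prepare formula yields the required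
      identity for the entries \<open>a\<close> and \<open>a'\<close>.\<close>
    define \<sigma> where "\<sigma> = mat dA dA (\<lambda>(i, j). of_bool (i = a) * of_bool (j = a') :: complex)"
    have \<sigma>: "\<sigma> \<in> carrier_mat dA dA" by (simp add: \<sigma>_def)
    have US: "(U * \<sigma> * adj U) $$ (i, j) = U $$ (i, a) * cnj (U $$ (j, a'))" if "i < dB * dE" "j < dB * dE" for i j
    proof -
      have "(U * \<sigma> * adj U) $$ (i, j) = (\<Sum>l<dA. (\<Sum>k<dA. U $$ (i, k) * (of_bool (k = a) * of_bool (l = a'))) * cnj (U $$ (j, l)))"
        using Uc that by (simp add: \<sigma>_def scalar_prod_def adj_def atLeast0LessThan)
      also have "\<dots> = (\<Sum>l<dA. of_bool (l = a') * (U $$ (i, a) * cnj (U $$ (j, l))))"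
      proof (intro sum.cong refl)
        fix l
        have "(\<Sum>k<dA. U $$ (i, k) * (of_bool (k = a) * of_bool (l = a'))) = (\<Sum>k<dA. (U $$ (i, k) * of_bool (l = a')) * of_bool (k = a))"
          by (simp only: mult_ac)
        also have "\<dots> = U $$ (i, a) * of_bool (l = a')" using a by (simp only: sum_delta_simps finite_lessThan)
        finally show "(\<Sum>k<dA. U $$ (i, k) * (of_bool (k = a) * of_bool (l = a'))) * cnj (U $$ (j, l)) = of_bool (l = a') * (U $$ (i, a) * cnj (U $$ (j, l)))"
          by (simp only: mult_ac)
      qed
      also have "\<dots> = U $$ (i, a) * cnj (U $$ (j, a'))" using a by (simp only: sum_delta_simps finite_lessThan)
      finally show ?thesis .
    qed
    have tr: "mtrace (\<Lambda> y * \<sigma>) = \<Lambda> y $$ (a', a)" if "y \<in> Y" for y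
    proof -
      have L: "\<Lambda> y \<in> carrier_mat dA dA" using pd that by (simp add: psd_def)
      have "mtrace (\<Lambda> y * \<sigma>) = (\<Sum>i<dA. \<Sum>k<dA. \<Lambda> y $$ (i, k) * (of_bool (k = a) * of_bool (i = a')))"
        using L unfolding mtrace_def by (simp add: \<sigma>_def scalar_prod_def atLeast0LessThan)
      also have "\<dots> = (\<Sum>i<dA. \<Sum>k<dA. (\<Lambda> y $$ (i, k) * of_bool (i = a')) * of_bool (k = a))"
        by (simp only: mult_ac)
      also have "\<dots> = \<Lambda> y $$ (a', a)" using a by (simp only: sum_delta_simps finite_lessThan)
      finally show ?thesis .
    qed
    have "(\<Sum>b<dB. iso_fun dE U b e a * cnj (iso_fun dE U b e' a')) = (\<Sum>b<dB. (U * \<sigma> * adj U) $$ (b * dE + e, b * dE + e'))"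
      unfolding iso_fun_def using e by (intro sum.cong refl) (simp add: US digits_less)
    also have "\<dots> = complementary dB dE U \<sigma> $$ (e, e')"
      unfolding complementary_def by (rule ptrace_left_index[symmetric]) (use e in auto)
    also have "\<dots> = (\<Sum>y\<in>Y. (mtrace (\<Lambda> y * \<sigma>) \<cdot>\<^sub>m \<omega> y) $$ (e, e'))"
      using bspec[OF ch \<sigma>] e by (simp add: msum_def)
    also have "\<dots> = (\<Sum>y\<in>Y. \<Lambda> y $$ (a', a) * \<omega> y $$ (e, e'))"
    proof (intro sum.cong refl)
      fix y assume y: "y \<in> Y"
      then have "\<omega> y \<in> carrier_mat dE dE" using pd by (simp add: density_def psd_def)
      then show "(mtrace (\<Lambda> y * \<sigma>) \<cdot>\<^sub>m \<omega> y) $$ (e, e') = \<Lambda> y $$ (a', a) * \<omega> y $$ (e, e')"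
        using e tr[OF y] by simp
    qed
    also have "\<dots> = (\<Sum>y\<in>Y. \<Sum>k<dA. cnj (\<Phi> y a k) * \<Phi> y a' k * \<omega> y $$ (e, e'))"
      using \<Phi> a by (intro sum.cong refl) (simp add: sum_distrib_left sum_distrib_right mult_ac)
    finally show "(\<Sum>b<dB. iso_fun dE U b e a * cnj (iso_fun dE U b e' a'))
      = (\<Sum>z\<in>Y \<times> {..<dA}. cnj (\<Phi> (fst z) a (snd z)) * \<Phi> (fst z) a' (snd z) * \<omega> (fst z) $$ (e, e'))"
      unfolding sum_Times fst_conv snd_conv .
  qed
  then show thesis by (rule that)
qed

text \<open>The converse of \<open>admissible_input\<close>. A reference as large as the input
  suffices, because a Gram factor indexed by the input space, divided by the root of its weight, is
  a unit vector.\<close>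

lemma purification:
  fixes \<tau> :: "nat \<Rightarrow> nat \<Rightarrow> nat \<Rightarrow> complex"
  assumes dA: "0 < dA" and \<tau>: "\<forall>x<n. psd_on {..<dA} (\<tau> x)" and t: "(\<Sum>x<n. tr_on {..<dA} (\<tau> x)) = 1"
  obtains p \<phi> where "(n, p, dA, \<phi>) \<in> admissible dA"
    "\<And>x a a'. x < n \<Longrightarrow> a < dA \<Longrightarrow> a' < dA \<Longrightarrow> input_op dA dA p \<phi> x a a' = \<tau> x a a'"
proof -
  have "\<forall>x\<in>{..<n}. \<exists>\<Phi>. \<forall>i\<in>{..<dA}. \<forall>j\<in>{..<dA}. \<tau> x i j = (\<Sum>k<dA. \<Phi> i k * cnj (\<Phi> j k))"
    using psd_on_imp_gram[OF finite_lessThan] \<tau> by blast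
  from bchoice[OF this] obtain \<Phi> where \<Phi>: "\<forall>x\<in>{..<n}. \<forall>i\<in>{..<dA}. \<forall>j\<in>{..<dA}. \<tau> x i j = (\<Sum>k<dA. \<Phi> x i k * cnj (\<Phi> x j k))" ..
  define p where "p x = tr_on {..<dA} (\<tau> x)" for x
  have p0: "0 \<le> p x" if "x < n" for x unfolding p_def using \<tau> that by (intro tr_on_nonneg) auto
  \<comment> \<open>A letter of probability 0 still needs a unit vector; the first basis vector is
    taken.\<close>
  define \<phi> where "\<phi> x = vec (dA * dA) (\<lambda>i. if p x = 0 then of_bool (i = 0) else \<Phi> x (i mod dA) (i div dA) / of_real (sqrt (p x)))" for x
  have nr: "(\<Sum>r<dA. \<Sum>a<dA. (cmod (\<Phi> x a r))\<^sup>2) = p x" if "x < n" for x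
  proof -
    have "(\<Sum>a<dA. \<tau> x a a) = (\<Sum>a<dA. \<Sum>r<dA. of_real ((cmod (\<Phi> x a r))\<^sup>2))"
      using \<Phi> that unfolding complex_norm_square by (intro sum.cong refl) auto
    also have "\<dots> = of_real (\<Sum>r<dA. \<Sum>a<dA. (cmod (\<Phi> x a r))\<^sup>2)" by (subst sum.swap) simp
    finally show ?thesis unfolding p_def tr_on_def by simp
  qed
  have \<phi>i: "\<phi> x $ (r * dA + a) = (if p x = 0 then of_bool (r = 0 \<and> a = 0) else \<Phi> x a r / of_real (sqrt (p x)))" if "r < dA" "a < dA" for x r a
    using digits_less[OF that] that dA unfolding \<phi>_def by auto
  have vn: "vnorm2 (\<phi> x) = 1" if x: "x < n" for x
  proof -
    have "vnorm2 (\<phi> x) = (\<Sum>r<dA. \<Sum>a<dA. (cmod (\<phi> x $ (r * dA + a)))\<^sup>2)"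
    proof -
      have "dim_vec (\<phi> x) = dA * dA" by (simp add: \<phi>_def)
      then show ?thesis unfolding vnorm2_def by (simp only: sum_digits)
    qed
    also have "\<dots> = 1"
    proof (cases "p x = 0")
      case True
      have "(\<Sum>r<dA. \<Sum>a<dA. (cmod (\<phi> x $ (r * dA + a)))\<^sup>2) = (\<Sum>r<dA. \<Sum>a<dA. of_bool (r = 0) * of_bool (a = 0))"
        by (intro sum.cong refl) (simp add: \<phi>i True)
      also have "\<dots> = 1" using dA by (simp only: sum_delta_simps finite_lessThan lessThan_iff sum_distrib_left[symmetric] mult_1_right of_bool_eq refl)
         (simp add: sum_delta_simps[where f = "\<lambda>_. 1", simplified])
      finally show ?thesis .
    next
      case False
      have "(\<Sum>r<dA. \<Sum>a<dA. (cmod (\<phi> x $ (r * dA + a)))\<^sup>2) = (\<Sum>r<dA. \<Sum>a<dA. (cmod (\<Phi> x a r))\<^sup>2 / p x)"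
        using p0[OF x] False by (intro sum.cong refl) (simp add: \<phi>i norm_divide power_divide)
      also have "\<dots> = 1" unfolding sum_divide_distrib[symmetric] nr[OF x] using False by simp
      finally show ?thesis .
    qed
    finally show ?thesis .
  qed
  have "n \<noteq> 0" using t by (intro notI) simp
  then have P: "(n, p, dA, \<phi>) \<in> admissible dA"
    using dA p0 t vn by (simp add: admissible_def p_def[symmetric]) (simp add: \<phi>_def)
  have "input_op dA dA p \<phi> x a a' = \<tau> x a a'" if x: "x < n" and a: "a < dA" "a' < dA" for x a a'
  proof (cases "p x = 0")
    case True
    have "\<Phi> x b r = 0" if "b < dA" "r < dA" for b r
    proof -
      have "(\<Sum>a<dA. (cmod (\<Phi> x a r))\<^sup>2) = 0"
        using nr[OF x] True \<open>r < dA\<close> by (simp add: sum_nonneg_eq_0_iff sum_nonneg)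
      then show ?thesis using \<open>b < dA\<close> by (simp add: sum_nonneg_eq_0_iff)
    qed
    then show ?thesis using \<Phi> x a True by (simp add: input_op_def)
  next
    case False
    have sq: "complex_of_real (sqrt (p x)) * of_real (sqrt (p x)) = of_real (p x)"
      unfolding of_real_mult[symmetric] using p0[OF x] by simp
    have "input_op dA dA p \<phi> x a a' = (\<Sum>r<dA. of_real (p x) * (\<Phi> x a r / of_real (sqrt (p x)) * cnj (\<Phi> x a' r / of_real (sqrt (p x)))))"
      unfolding input_op_def sum_distrib_left using a False by (intro sum.cong refl) (simp add: \<phi>i)
    also have "\<dots> = (\<Sum>r<dA. \<Phi> x a r * cnj (\<Phi> x a' r))"
      using False by (intro sum.cong refl) (simp add: sq[symmetric] field_simps)
    also have "\<dots> = \<tau> x a a'" using \<Phi> x a by simp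
    finally show ?thesis .
  qed
  then show thesis using that P by blast
qed

lemma objective_eq_cq_val:
  assumes U: "isometry dA dB dE U" and P: "(n, p, dR, \<phi>) \<in> admissible dA"
  shows "mutual_XB dB dE U (n, p, dR, \<phi>) + lam * coh_info dB dE U (n, p, dR, \<phi>)
    = cq_val lam {..<dB} {..<dE} {..<dA} (iso_fun dE U) {..<n} (input_op dA dR p \<phi>)"
proof -
  have "(\<Sum>x<n. eta (p x)) = (\<Sum>x<n. eta (tr_on {..<dA} (input_op dA dR p \<phi> x)))"
    by (intro sum.cong refl) (simp add: admissible_input(2)[OF P])
  then show ?thesis
    unfolding information_quantities[OF U P] cq_val_def cq_term_def
    by (simp add: sum.distrib sum_subtractf sum_distrib_left[symmetric] algebra_simps)
qed

text \<open>\<open>Ent_concave\<close> for the letter outputs. Together with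
  \<open>hadamard_coh_info_nonneg\<close> it puts the optimal point into the one-shot region, which
  contains only nonnegative pairs.\<close>

lemma mutual_XB_nonneg:
  assumes U: "isometry dA dB dE U" and P: "P \<in> admissible dA"
  shows "0 \<le> mutual_XB dB dE U P"
proof -
  obtain n p dR \<phi> where Pe: "P = (n, p, dR, \<phi>)" by (cases P) auto
  note P' = P[unfolded Pe]
  let ?c = "\<lambda>x. chB {..<dE} {..<dA} (iso_fun dE U) (input_op dA dR p \<phi> x)"
  have p: "psd_on {..<dB} (?c x)" if "x \<in> {..<n}" for x
    by (rule psd_on_ch(1)[OF finite_lessThan admissible_input(1)[OF P']]) (use that in simp)
  have t: "tr_on {..<dB} (?c x) = p x" if "x \<in> {..<n}" for x
    using tr_ch(1)[OF finite_lessThan admissible_input(1)[OF P'] isoW_iso_fun[OF U]] admissible_input(2)[OF P'] that by simp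
  have "(\<Sum>x<n. p x) = 1" using P' by (simp add: admissible_def)
  moreover have "(\<Sum>x<n. Ent {..<dB} (?c x) - eta (tr_on {..<dB} (?c x)))
      \<le> Ent {..<dB} (\<lambda>b b'. \<Sum>x<n. ?c x b b') - eta (\<Sum>x<n. tr_on {..<dB} (?c x))"
    by (rule Ent_concave[OF finite_lessThan finite_lessThan p])
  moreover have "eta 1 = 0" by (simp add: eta_def)
  ultimately have "(\<Sum>x<n. Ent {..<dB} (?c x) - eta (p x)) \<le> Ent {..<dB} (\<lambda>b b'. \<Sum>x<n. ?c x b b')"
    using t by simp
  moreover have "(\<lambda>b b'. \<Sum>x<n. ?c x b b') = chB {..<dE} {..<dA} (iso_fun dE U) (\<lambda>a a'. \<Sum>x<n. input_op dA dR p \<phi> x a a')"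
    by (simp add: chB_sum fun_eq_iff)
  ultimately show ?thesis
    unfolding Pe information_quantities(1)[OF U P'] by (simp add: sum_subtractf)
qed

lemma hadamard_coh_info_nonneg:
  assumes U: "isometry dA dB dE U" and h: "hadamard dA dB dE U" and P: "P \<in> admissible dA"
  shows "0 \<le> coh_info dB dE U P"
proof -
  obtain n p dR \<phi> where Pe: "P = (n, p, dR, \<phi>)" by (cases P) auto
  note P' = P[unfolded Pe]
  obtain Y :: "(nat \<times> nat) set" and v \<omega> where "hadW {..<dB} {..<dE} {..<dA} (iso_fun dE U) Y v \<omega>"
    by (rule hadamard_hadW[OF U h])
  then have "(\<Sum>x<n. Ent {..<dE} (chE {..<dB} {..<dA} (iso_fun dE U) (input_op dA dR p \<phi> x)))
      \<le> (\<Sum>x<n. Ent {..<dB} (chB {..<dE} {..<dA} (iso_fun dE U) (input_op dA dR p \<phi> x)))"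
    by (intro sum_mono hadamard_Ent_le admissible_input(1)[OF P']) auto
  then show ?thesis unfolding Pe information_quantities(2)[OF U P'] by simp
qed

section \<open>Tensor powers of the channel\<close>

lemma tensor_pow_iso_one:
  assumes "U \<in> carrier_mat (dB * dE) dA"
  shows "tensor_pow_iso dA dB dE U 1 = U"
proof (rule eq_matI)
  fix i j assume ij: "i < dim_row U" "j < dim_col U"
  then have "i < dB * dE" "j < dA" using assms by auto
  moreover have "i div dE < dB" using \<open>i < dB * dE\<close> by (simp add: less_mult_imp_div_less)
  ultimately show "tensor_pow_iso dA dB dE U 1 $$ (i, j) = U $$ (i, j)"
    by (simp add: tensor_pow_iso_def digit_def)
qed (use assms in \<open>auto simp: tensor_pow_iso_def\<close>)

abbreviation pow_fun :: "nat \<Rightarrow> nat \<Rightarrow> nat \<Rightarrow> complex mat \<Rightarrow> nat \<Rightarrow> (nat, nat, nat) kraus" where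
  "pow_fun dA dB dE U k \<equiv> iso_fun (dE ^ k) (tensor_pow_iso dA dB dE U k)"

lemma isometry_tensor_pow:
  assumes "isoW {..<dB ^ k} {..<dE ^ k} {..<dA ^ k} (pow_fun dA dB dE U k)"
  shows "isometry (dA ^ k) (dB ^ k) (dE ^ k) (tensor_pow_iso dA dB dE U k)"
proof -
  let ?V = "tensor_pow_iso dA dB dE U k"
  have V: "?V \<in> carrier_mat (dB ^ k * dE ^ k) (dA ^ k)" by (simp add: tensor_pow_iso_def)
  have "adj ?V * ?V = 1\<^sub>m (dA ^ k)"
  proof (rule eq_matI)
    fix a a' assume "a < dim_row (1\<^sub>m (dA ^ k) :: complex mat)" "a' < dim_col (1\<^sub>m (dA ^ k) :: complex mat)"
    then have a: "a < dA ^ k" "a' < dA ^ k" by auto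
    have "(adj ?V * ?V) $$ (a, a') = (\<Sum>i<dB ^ k * dE ^ k. cnj (?V $$ (i, a)) * ?V $$ (i, a'))"
      using a V by (simp add: adj_def scalar_prod_def atLeast0LessThan)
    also have "\<dots> = (\<Sum>b<dB ^ k. \<Sum>e<dE ^ k. iso_fun (dE ^ k) ?V b e a' * cnj (iso_fun (dE ^ k) ?V b e a))"
      unfolding sum_digits iso_fun_def by (simp only: mult.commute)
    also have "\<dots> = of_bool (a' = a)" using assms a unfolding isoW_def by simp
    finally show "(adj ?V * ?V) $$ (a, a') = 1\<^sub>m (dA ^ k) $$ (a, a')" using a by auto
  qed (use V in \<open>auto simp: adj_def\<close>)
  then show ?thesis unfolding isometry_def using V by simp
qed

text \<open>The factor split off is the most significant digit, number \<open>k\<close>, which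
  matches the pairing with the single channel in front.\<close>

lemma digit_Suc:
  assumes "m < d ^ k" "i \<le> k" "q < d"
  shows "digit d i (q * d ^ k + m) = (if i = k then q else digit d i m)"
proof (cases "i = k")
  case True
  then show ?thesis using assms by (simp add: digit_def)
next
  case False
  then have "i < k" using assms by simp
  then have "d ^ k = d ^ i * (d * d ^ (k - Suc i))"
    by (metis Suc_leI add_diff_inverse_nat not_less power_Suc power_add power_Suc2 mult.assoc le_imp_less_Suc not_less_eq)
  \<comment> \<open>Below position \<open>k\<close> the added part is a multiple of
    \<open>d ^ Suc i\<close>, so it disappears after division by \<open>d ^ i\<close> and reduction
    modulo \<open>d\<close>.\<close>
  then have e: "q * d ^ k + m = m + d ^ i * (d * (q * d ^ (k - Suc i)))"
    by (simp only: mult_ac add_ac)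
  have "(q * d ^ k + m) div d ^ i = d * (q * d ^ (k - Suc i)) + m div d ^ i"
    unfolding e using assms(3) by (intro div_mult_self2) auto
  then show ?thesis using False by (simp add: digit_def)
qed

lemma iso_fun_tensor_pow:
  assumes "b < dB ^ k" "e < dE ^ k" "a < dA ^ k"
  shows "pow_fun dA dB dE U k b e a
    = (\<Prod>i<k. iso_fun dE U (digit dB i b) (digit dE i e) (digit dA i a))"
proof -
  have nz: "dE ^ k \<noteq> 0" using assms(2) by (metis not_less_zero)
  have "(b * dE ^ k + e) div dE ^ k = b" "(b * dE ^ k + e) mod dE ^ k = e"
    using div_mult_self3[OF nz, of b e] assms(2) by (simp_all add: mod_mult_self3)
  then show ?thesis
    unfolding iso_fun_def tensor_pow_iso_def using assms digits_less[OF assms(1,2)] by simp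
qed

lemma iso_fun_tensor_Suc:
  assumes "b1 < dB" "b < dB ^ k" "e1 < dE" "e < dE ^ k" "a1 < dA" "a < dA ^ k"
  shows "tensW (iso_fun dE U) (pow_fun dA dB dE U k) (b1, b) (e1, e) (a1, a)
    = pow_fun dA dB dE U (Suc k) (b1 * dB ^ k + b) (e1 * dE ^ k + e) (a1 * dA ^ k + a)"
proof -
  have l: "b1 * dB ^ k + b < dB ^ Suc k" "e1 * dE ^ k + e < dE ^ Suc k" "a1 * dA ^ k + a < dA ^ Suc k"
    using assms by (auto intro: digits_less)
  show ?thesis
    unfolding iso_fun_tensor_pow[OF l] tensW_def fst_conv snd_conv iso_fun_tensor_pow[OF assms(2,4,6)]
    using assms by (simp add: digit_Suc mult.commute)
qed

text \<open>Induction with the single channel as the Hadamard factor. The isometry property is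
  carried along because the next step requires it of the power.\<close>

lemma tensor_pow_bound:
  assumes U: "isometry dA dB dE U" and h: "hadamard dA dB dE U" and lam: "1 \<le> lam"
    and b: "cq_bound lam {..<dB} {..<dE} {..<dA} (iso_fun dE U) f" and k: "1 \<le> k"
  shows "cq_bound lam {..<dB ^ k} {..<dE ^ k} {..<dA ^ k} (pow_fun dA dB dE U k) (real k * f)
    \<and> isoW {..<dB ^ k} {..<dE ^ k} {..<dA ^ k} (pow_fun dA dB dE U k)"
  using k
proof (induction k rule: dec_induct)
  case base
  have "U \<in> carrier_mat (dB * dE) dA" using U by (simp add: isometry_def)
  from tensor_pow_iso_one[OF this] show ?case using b isoW_iso_fun[OF U] by simp
next
  case (step k)
  obtain Y :: "(nat \<times> nat) set" and v \<omega> where had: "hadW {..<dB} {..<dE} {..<dA} (iso_fun dE U) Y v \<omega>"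
    by (rule hadamard_hadW[OF U h])
  let ?Wk = "pow_fun dA dB dE U k"
  interpret j: joint_channel "{..<dA}" "{..<dB}" "{..<dE}" "{..<dA ^ k}" "{..<dB ^ k}" "{..<dE ^ k}" "iso_fun dE U" ?Wk Y v \<omega>
    by unfold_locales (use isoW_iso_fun[OF U] step.IH had in auto)
  interpret r: reindexing "\<lambda>p. fst p * dB ^ k + snd p" "\<lambda>p. fst p * dE ^ k + snd p" "\<lambda>p. fst p * dA ^ k + snd p"
    "{..<dB} \<times> {..<dB ^ k}" "{..<dB ^ Suc k}" "{..<dE} \<times> {..<dE ^ k}" "{..<dE ^ Suc k}" "{..<dA} \<times> {..<dA ^ k}" "{..<dA ^ Suc k}"
    "tensW (iso_fun dE U) ?Wk" "pow_fun dA dB dE U (Suc k)"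
    by unfold_locales (auto simp: bij_betw_digits iso_fun_tensor_Suc simp del: power_Suc simp: power_Suc[of _ k] intro: bij_betw_digits)
  have "real (Suc k) * f = f + real k * f" by (simp add: algebra_simps)
  then show ?case
    using r.cq_bound_reindex[OF j.cq_bound_tensor[OF lam b conjunct1[OF step.IH]]]
      r.isoW_reindex[OF isoW_tensW[OF isoW_iso_fun[OF U] conjunct2[OF step.IH]]] by (simp only:)
qed


section \<open>The optimal point on the trade-off curve\<close>

theorem theorem4:
  fixes dA dB dE :: nat and U :: "complex mat" and lam :: real and P :: params
  assumes "0 < dA" and "0 < dB" and "0 < dE"
    and "isometry dA dB dE U"
    and "hadamard dA dB dE U"
    and "1 \<le> lam"
    and "P \<in> admissible dA"
    and "\<forall>P' \<in> admissible dA. mutual_XB dB dE U P' + lam * coh_info dB dE U P'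
                              \<le> mutual_XB dB dE U P + lam * coh_info dB dE U P"
  shows "pareto_optimal (CQ_region dA dB dE U) (mutual_XB dB dE U P, coh_info dB dE U P)
    \<and> (mutual_XB dB dE U P, coh_info dB dE U P) \<in> CQ_region dA dB dE U
    \<and> (\<forall>(C, Q) \<in> CQ_region dA dB dE U.
           C + lam * Q \<le> mutual_XB dB dE U P + lam * coh_info dB dE U P)
    \<and> mutual_XB dB dE U P + lam * coh_info dB dE U P = f_lambda dA dB dE U lam"
proof -
  note U = assms(4) and had = assms(5) and lam = assms(6) and P = assms(7) and opt = assms(8)
  let ?I = "mutual_XB dB dE U P" and ?C = "coh_info dB dE U P"
  define f where "f = ?I + lam * ?C"
  let ?V = "\<lambda>k. tensor_pow_iso dA dB dE U k"
  have Uc: "U \<in> carrier_mat (dB * dE) dA" using U by (simp add: isometry_def)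
  \<comment> \<open>Optimality is assumed over admissible states; by \<open>purification\<close> it
    bounds the values of all ensembles.\<close>
  have bound1: "cq_bound lam {..<dB} {..<dE} {..<dA} (iso_fun dE U) f"
    unfolding cq_bound_def
  proof (intro allI impI)
    fix n :: nat and \<tau> :: "nat \<Rightarrow> nat \<Rightarrow> nat \<Rightarrow> complex"
    assume "\<forall>x<n. psd_on {..<dA} (\<tau> x)" "(\<Sum>x<n. tr_on {..<dA} (\<tau> x)) = 1"
    then obtain p \<phi> where P': "(n, p, dA, \<phi>) \<in> admissible dA"
      and \<tau>: "\<And>x a a'. x < n \<Longrightarrow> a < dA \<Longrightarrow> a' < dA \<Longrightarrow> input_op dA dA p \<phi> x a a' = \<tau> x a a'"
      by (rule purification[OF assms(1)]) blast
    have "cq_val lam {..<dB} {..<dE} {..<dA} (iso_fun dE U) {..<n} \<tau>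
        = cq_val lam {..<dB} {..<dE} {..<dA} (iso_fun dE U) {..<n} (input_op dA dA p \<phi>)"
      by (rule cq_val_cong) (simp add: \<tau>)
    also have "\<dots> \<le> f"
      unfolding objective_eq_cq_val[OF U P', symmetric] f_def using opt P' by blast
    finally show "cq_val lam {..<dB} {..<dE} {..<dA} (iso_fun dE U) {..<n} \<tau> \<le> f" .
  qed
  have region_k: "fst z + lam * snd z \<le> real k * f"
    if k: "1 \<le> k" and z: "z \<in> one_shot_region (dA ^ k) (dB ^ k) (dE ^ k) (?V k)" for k z
  proof -
    obtain Q where Q: "Q \<in> admissible (dA ^ k)" "fst z \<le> mutual_XB (dB ^ k) (dE ^ k) (?V k) Q"
      "snd z \<le> coh_info (dB ^ k) (dE ^ k) (?V k) Q"
      using z unfolding one_shot_region_def by auto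
    obtain n p dR \<phi> where Qe: "Q = (n, p, dR, \<phi>)" by (cases Q) auto
    note Q' = Q(1)[unfolded Qe]
    note b = tensor_pow_bound[OF U had lam bound1 k]
    have "fst z + lam * snd z \<le> mutual_XB (dB ^ k) (dE ^ k) (?V k) Q + lam * coh_info (dB ^ k) (dE ^ k) (?V k) Q"
      using Q lam by (intro add_mono mult_left_mono) auto
    also have "\<dots> = cq_val lam {..<dB ^ k} {..<dE ^ k} {..<dA ^ k} (iso_fun (dE ^ k) (?V k)) {..<n} (input_op (dA ^ k) dR p \<phi>)"
      unfolding Qe by (rule objective_eq_cq_val[OF isometry_tensor_pow[OF b[THEN conjunct2]] Q'])
    also have "\<dots> \<le> real k * f"
      by (rule cq_boundD[OF conjunct1[OF b]]) (use admissible_input[OF Q'] in auto)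
    finally show ?thesis .
  qed
  \<comment> \<open>Rescaling by \<open>1 / real k\<close> removes the factor \<open>real k\<close>,
    and the half-plane is closed, so the bound survives the closure.\<close>
  have half: "fst z + lam * snd z \<le> f" if "z \<in> CQ_region dA dB dE U" for z
  proof -
    have "CQ_region dA dB dE U \<subseteq> {z. fst z + lam * snd z \<le> f}"
      unfolding CQ_region_def
    proof (rule closure_minimal)
      show "closed {z :: real \<times> real. fst z + lam * snd z \<le> f}"
        by (intro closed_Collect_le continuous_intros)
      show "(\<Union>k\<in>{1..}. (\<lambda>z. (1 / real k) *\<^sub>R z) ` one_shot_region (dA ^ k) (dB ^ k) (dE ^ k) (?V k)) \<subseteq> {z. fst z + lam * snd z \<le> f}"
      proof
        fix z assume "z \<in> (\<Union>k\<in>{1..}. (\<lambda>z. (1 / real k) *\<^sub>R z) ` one_shot_region (dA ^ k) (dB ^ k) (dE ^ k) (?V k))"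
        then obtain k w where k: "1 \<le> k" and w: "w \<in> one_shot_region (dA ^ k) (dB ^ k) (dE ^ k) (?V k)"
          and z: "z = (1 / real k) *\<^sub>R w" by auto
        have "fst z + lam * snd z = (fst w + lam * snd w) / real k" unfolding z by (simp add: add_divide_distrib)
        also have "\<dots> \<le> f" using region_k[OF k w] k by (simp add: divide_le_eq mult.commute)
        finally show "z \<in> {z. fst z + lam * snd z \<le> f}" by simp
      qed
    qed
    then show ?thesis using that by auto
  qed
  \<comment> \<open>The case \<open>k = 1\<close>, at the corner of the rectangle that belongs to
    \<open>P\<close>.\<close>
  have mem: "(?I, ?C) \<in> CQ_region dA dB dE U"
  proof -
    have "(?I, ?C) \<in> one_shot_region (dA ^ 1) (dB ^ 1) (dE ^ 1) (?V 1)"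
      unfolding one_shot_region_def tensor_pow_iso_one[OF Uc] power_one_right
      using P mutual_XB_nonneg[OF U P] hadamard_coh_info_nonneg[OF U had P] by blast
    then have "(?I, ?C) \<in> (\<lambda>z. (1 / real 1) *\<^sub>R z) ` one_shot_region (dA ^ 1) (dB ^ 1) (dE ^ 1) (?V 1)"
      by (rule rev_image_eqI) simp
    then have "(?I, ?C) \<in> (\<Union>k\<in>{1..}. (\<lambda>z. (1 / real k) *\<^sub>R z) ` one_shot_region (dA ^ k) (dB ^ k) (dE ^ k) (?V k))"
      by (intro UN_I[of 1]) simp_all
    then show ?thesis unfolding CQ_region_def by (rule closure_subset[THEN subsetD])
  qed
  \<comment> \<open>A dominating point has at least the same objective value; the half-plane bound
    then forces equality in both terms, and \<open>lam\<close> is positive.\<close>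
  have "z' = (?I, ?C)" if "z' \<in> CQ_region dA dB dE U" "?I \<le> fst z'" "?C \<le> snd z'" for z'
  proof -
    have "fst z' + lam * snd z' \<le> ?I + lam * ?C" using half[OF that(1)] unfolding f_def .
    moreover have "lam * ?C \<le> lam * snd z'" using lam that(3) by (intro mult_left_mono) auto
    ultimately have "fst z' = ?I" "lam * snd z' = lam * ?C" using that(2) by linarith+
    then show ?thesis using lam by (simp add: prod_eq_iff)
  qed
  then have "pareto_optimal (CQ_region dA dB dE U) (?I, ?C)"
    unfolding pareto_optimal_def fst_conv snd_conv using mem by blast
  moreover have "?I + lam * ?C = f_lambda dA dB dE U lam"
    unfolding f_lambda_def by (rule cSup_eq_maximum[symmetric]) (use P opt in auto)
  moreover have "\<forall>(C, Q) \<in> CQ_region dA dB dE U. C + lam * Q \<le> ?I + lam * ?C"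
  proof clarify
    fix C Q assume "(C, Q) \<in> CQ_region dA dB dE U"
    from half[OF this] show "C + lam * Q \<le> ?I + lam * ?C" by (simp add: f_def)
  qed
  ultimately show ?thesis using mem by (intro conjI)
qed

end
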